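(* Let $N_4(B)$ be the number of subrings of $\mathbb{Z}^4$ (componentwise operations) containing $(1,1,1,1)$, of finite index at most $B$. There is a polynomial $P_4$ of degree $5$ such that for every $\epsilon>0$, $$N_4(B)=B\,P_4(\log B)+O_\epsilon(B^{\frac{11}{12}+\epsilon})$$ as $B\to\infty$. *)

theory Defs
  imports
    "HOL-Analysis.Finite_Cartesian_Product"
    "HOL-Computational_Algebra.Polynomial"
    "HOL-Library.Landau_Symbols"
    "HOL-Algebra.Subrings"
begin

text \<open>On \<^typ>\<open>int ^ 4\<close> the operations \<^term>\<open>(+)\<close> and \<^term>\<open>(*)\<close> are componentwise, and \<^term>\<open>1\<close>
  is the constant vector $(1,1,1,1)$.\<close>

definition Z4 :: "(int ^ 4) ring"
  where "Z4 = \<lparr>carrier = UNIV, mult = (*), one = 1, zero = 0, add = (+)\<rparr>"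

text \<open>The library's notion of a subring requires it to contain the ambient unit \<^term>\<open>\<one>\<^bsub>Z4\<^esub>\<close>.
  The index is that of the additive groups. Finiteness is asked for separately, since the
  cardinality of an infinite set is \<^term>\<open>0::nat\<close>.\<close>

definition subrings_upto :: "real \<Rightarrow> (int ^ 4) set set"
  where "subrings_upto B =
    {S. subring S Z4 \<and> finite (a_rcosets\<^bsub>Z4\<^esub> S) \<and> real (card (a_rcosets\<^bsub>Z4\<^esub> S)) \<le> B}"

definition N4 :: "real \<Rightarrow> nat"
  where "N4 B = card (subrings_upto B)"

lemma Z4_simps [simp]:
  "carrier Z4 = UNIV" "x \<otimes>\<^bsub>Z4\<^esub> y = x * y" "\<one>\<^bsub>Z4\<^esub> = 1" "\<zero>\<^bsub>Z4\<^esub> = 0" "x \<oplus>\<^bsub>Z4\<^esub> y = x + y"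
  by (simp_all add: Z4_def)

lemma cring_Z4: "cring Z4"
proof (rule cringI)
  show "abelian_group Z4"
  proof (rule abelian_groupI)
    show "\<exists>y\<in>carrier Z4. y \<oplus>\<^bsub>Z4\<^esub> x = \<zero>\<^bsub>Z4\<^esub>" for x
      by (rule bexI[of _ "- x"]) auto
  qed auto
  show "Group.comm_monoid Z4"
    by (rule comm_monoidI) (auto simp: mult_ac)
qed (auto simp: distrib_right)

lemma a_inv_Z4 [simp]: "\<ominus>\<^bsub>Z4\<^esub> x = - x"
proof -
  interpret cring Z4 by (rule cring_Z4)
  show ?thesis by (rule minus_equality) auto
qed

lemma subring_Z4_iff:
  "subring S Z4 \<longleftrightarrow> 1 \<in> S \<and> (\<forall>x\<in>S. - x \<in> S) \<and> (\<forall>x\<in>S. \<forall>y\<in>S. x * y \<in> S \<and> x + y \<in> S)"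
proof
  assume "subring S Z4"
  from subringE[OF this] show "1 \<in> S \<and> (\<forall>x\<in>S. - x \<in> S) \<and> (\<forall>x\<in>S. \<forall>y\<in>S. x * y \<in> S \<and> x + y \<in> S)"
    by auto
next
  interpret cring Z4 by (rule cring_Z4)
  assume "1 \<in> S \<and> (\<forall>x\<in>S. - x \<in> S) \<and> (\<forall>x\<in>S. \<forall>y\<in>S. x * y \<in> S \<and> x + y \<in> S)"
  then show "subring S Z4" by (intro subringI) auto
qed

lemma a_rcosets_Z4: "a_rcosets\<^bsub>Z4\<^esub> S = range (\<lambda>a. (\<lambda>h. h + a) ` S)"
  by (auto simp: A_RCOSETS_def RCOSETS_def r_coset_def)

lemma of_int_vec_nth: "(of_int k :: int ^ 'n) $ i = k"
  by (cases k rule: int_cases2) (simp_all add: of_nat_index)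

lemma fact_mult_mem:
  assumes S: "subring S Z4" and fin: "finite (a_rcosets\<^bsub>Z4\<^esub> S)"
    and le: "card (a_rcosets\<^bsub>Z4\<^esub> S) \<le> n"
  shows "of_int (fact n * k) * x \<in> S"
proof -
  from S have S': "1 \<in> S" "\<And>x. x \<in> S \<Longrightarrow> - x \<in> S" "\<And>x y. x \<in> S \<Longrightarrow> y \<in> S \<Longrightarrow> x + y \<in> S"
    by (auto simp: subring_Z4_iff)
  have z: "0 \<in> S" using S'(3)[OF S'(1) S'(2)[OF S'(1)]] by simp
  have natmult: "of_nat m * y \<in> S" if "y \<in> S" for m y
    by (induction m) (use z S'(3) that in \<open>auto simp: distrib_right\<close>)
  have intmult: "of_int m * y \<in> S" if "y \<in> S" for m y
    by (cases m rule: int_cases2) (use natmult[OF that] S'(2) in auto)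
  define f where "f m = (\<lambda>h. h + of_nat m * x) ` S" for m :: nat
  have "card (f ` {..n}) \<le> card (a_rcosets\<^bsub>Z4\<^esub> S)"
    by (rule card_mono[OF fin]) (auto simp: a_rcosets_Z4 f_def)
  also have "\<dots> < card {..n}" using le by simp
  finally have "\<not> inj_on f {..n}" by (rule pigeonhole)
  then obtain a b where "a \<le> n" "b \<le> n" "a \<noteq> b" "f a = f b"
    by (auto simp: inj_on_def)
  then obtain i j where ij: "i < j" "j \<le> n" "f i = f j"
    by (metis linorder_neqE_nat)
  have "0 + of_nat j * x \<in> f j" unfolding f_def using z by (rule imageI)
  then obtain h where h: "h \<in> S" "of_nat j * x = h + of_nat i * x"
    unfolding ij(3)[symmetric] by (auto simp: f_def)
  have "of_nat (j - i) * x = h"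
    using ij(1) h(2) by (simp add: of_nat_diff left_diff_distrib)
  with h(1) have mem: "of_nat (j - i) * x \<in> S" by simp
  have "(j - i) dvd fact n" using ij by (intro dvd_fact) auto
  then obtain c where c: "fact n = (j - i) * c" by (elim dvdE)
  have "fact n * k = (int c * k) * int (j - i)"
    using arg_cong[OF c, of int] by (simp add: mult_ac)
  then have "of_int (fact n * k) * x = of_int (int c * k) * (of_int (int (j - i)) * x)"
    by (simp only: of_int_mult mult.assoc)
  then show ?thesis using intmult[OF mem] by (simp only: of_int_of_nat_eq)
qed

lemma finite_subrings_upto: "finite (subrings_upto B)"
proof -
  define n where "n = nat \<lfloor>B\<rfloor>"
  define M :: int where "M = fact n"
  define Q :: "(int ^ 4) set" where "Q = {x. \<forall>i. x $ i \<in> {0..<M}}"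
  have M: "M > 0" by (simp add: M_def)
  have "Q \<subseteq> (\<lambda>f. \<chi> i. f i) ` (UNIV \<rightarrow>\<^sub>E {0..<M})"
  proof
    fix x assume "x \<in> Q"
    then show "x \<in> (\<lambda>f. \<chi> i. f i) ` (UNIV \<rightarrow>\<^sub>E {0..<M})"
      by (intro image_eqI[of _ _ "\<lambda>i. x $ i"]) (auto simp: Q_def)
  qed
  then have "finite Q" by (rule finite_subset) (intro finite_imageI finite_PiE, auto)
  define r :: "int ^ 4 \<Rightarrow> int ^ 4" where "r x = (\<chi> i. x $ i mod M)" for x
  have rQ: "r x \<in> Q" for x using M by (auto simp: r_def Q_def)
  have mem_iff: "x \<in> S \<longleftrightarrow> r x \<in> S \<inter> Q" if "S \<in> subrings_upto B" for S x
  proof -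
    from that have S: "subring S Z4" "finite (a_rcosets\<^bsub>Z4\<^esub> S)"
      and le: "card (a_rcosets\<^bsub>Z4\<^esub> S) \<le> n"
      by (auto simp: subrings_upto_def n_def le_nat_iff le_floor_iff)
    have "x = r x + of_int (M * 1) * (\<chi> i. x $ i div M)"
      by (simp add: vec_eq_iff r_def of_int_vec_nth)
    moreover have "of_int (M * 1) * (\<chi> i. x $ i div M) \<in> S"
      unfolding M_def by (rule fact_mult_mem[OF S le])
    ultimately obtain y where y: "x = r x + y" "y \<in> S" by blast
    have "r x = x + - y" using y(1) by (simp add: algebra_simps)
    with y S(1) rQ show ?thesis unfolding subring_Z4_iff by (metis Int_iff)
  qed
  have "inj_on (\<lambda>S. S \<inter> Q) (subrings_upto B)"
  proof (rule inj_onI)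
    fix S T assume "S \<in> subrings_upto B" "T \<in> subrings_upto B" "S \<inter> Q = T \<inter> Q"
    then show "S = T" using mem_iff[of S] mem_iff[of T] by blast
  qed
  then show ?thesis
    by (rule inj_on_finite[of _ _ "Pow Q"]) (use \<open>finite Q\<close> in auto)
qed

end

theory Submission
  imports Defs "HOL-Analysis.Analysis"
begin

text \<open>Subtracting the last coordinate identifies the subrings of \<open>\<int>\<^sup>4\<close> with the multiplicatively closed
  sublattices of \<open>\<int>\<^sup>3\<close>, with the same index. By the Chinese remainder theorem the number \<open>f(n)\<close> of those of
  index \<open>n\<close> is multiplicative. Hermite normal forms give \<open>f(p) = 6\<close> and
  \<open>f(p\<^sup>k) \<le> 8 (k+1)\<^sup>2 p\<^bsup>6k/7 - 1\<^esup>\<close> for \<open>k \<ge> 2\<close>. Hence \<open>f = g * 1 * \<dots> * 1\<close> (six Dirichlet factors \<open>1\<close>), where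
  \<open>\<Sum> \<bar>g(n)\<bar> n\<^bsup>-s\<^esup>\<close> converges for \<open>s > 6/7\<close>. The first factor \<open>1\<close> leaves the error exponent at \<open>6/7\<close>; each
  of the other five, treated by the hyperbola method, adds a power of the logarithm to the main term and turns an
  error exponent \<open>1 - 1/q\<close> into \<open>1 - 1/(q+1)\<close>, which ends at \<open>11/12\<close>.\<close>

section \<open>Asymptotics with polynomials in the logarithm\<close>

text \<open>The constant 6/7 is the largest value of (E + 1) / k, where p^E bounds, up to a
  constant, the number of forms with diagonal (p^a, p^b, p^c) and k = a + b + c >= 2: a term p^(E -
  k s) summed over all primes needs k s > E + 1. The maximum occurs at (a, b, c) = (1, 2, 4), with E
  = 5. Index p itself escapes this condition, because dividing by six zeta factors removes exactly
  the term f(p) = 6; hence all bounds start at k = 2. No complex analysis enters, and the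
  coefficients of the polynomial are nowhere computed: each step only asserts that some polynomial
  in the logarithm exists. The price is that the exact degree needs its own argument. If the
  coefficient of log^5 vanished, the sums of f would be O(x log^4 x), while the function counting
  factorisations into six factors agrees with f at primes and has sums of order at least x log^5
  x.\<close>

lemma ln_power_le_powr:
  assumes "\<delta> > (0::real)"
  shows "\<exists>K\<ge>0. \<forall>x\<ge>1. ln x ^ j \<le> K * x powr \<delta>"
proof (cases "j = 0")
  case True
  then show ?thesis using assms by (intro exI[of _ 1]) (auto simp: ge_one_powr_ge_zero)
next
  case False
  define e where "e = \<delta> / real j"
  have e: "e > 0" "e * real j = \<delta>" using assms False by (auto simp: e_def)
  show ?thesis
  proof (intro exI[of _ "(1 / e) ^ j"] conjI allI impI)
    show "(1 / e) ^ j \<ge> 0" using e by simp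
    fix x :: real assume x: "x \<ge> 1"
    have "ln x \<le> x powr e / e" using x e by (intro ln_powr_bound) auto
    then have "ln x ^ j \<le> (x powr e / e) ^ j" using x by (intro power_mono) auto
    also have "\<dots> = (1 / e) ^ j * x powr (e * real j)"
      using x by (simp add: power_divide powr_powr[symmetric] powr_realpow)
    finally show "ln x ^ j \<le> (1 / e) ^ j * x powr \<delta>" using e by simp
  qed
qed

lemma one_plus_ln_power_le_powr:
  assumes "\<delta> > (0::real)"
  shows "\<exists>K\<ge>0. \<forall>x\<ge>1. (1 + ln x) ^ j \<le> K * x powr \<delta>"
proof -
  from ln_power_le_powr[OF assms] obtain K where K: "K \<ge> 0" "\<And>x. x \<ge> 1 \<Longrightarrow> ln x ^ j \<le> K * x powr \<delta>"
    by blast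
  \<comment> \<open>Since 1 + ln x = ln (e x), the bound for powers of ln is used at e x.\<close>
  have "(1 + ln x) ^ j \<le> (K * exp 1 powr \<delta>) * x powr \<delta>" if "x \<ge> 1" for x
  proof -
    have "exp 1 * x \<ge> exp 1 * 1" using that by (intro mult_left_mono) auto
    moreover have "exp 1 \<ge> (1::real)" by simp
    ultimately have "exp 1 * x \<ge> 1" by linarith
    from K(2)[OF this] show ?thesis using that by (simp add: ln_mult powr_mult mult_ac add.commute)
  qed
  then show ?thesis using K(1) by (intro exI[of _ "K * exp 1 powr \<delta>"]) auto
qed

abbreviation powr_bounded :: "(real \<Rightarrow> real) \<Rightarrow> real \<Rightarrow> bool" where
  "powr_bounded F e \<equiv> \<exists>K. \<forall>x\<ge>1. \<bar>F x\<bar> \<le> K * x powr e"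

text \<open>\<open>\<eta>\<close> is the saved power of x. The coefficients are chosen before
  \<open>\<delta>\<close>, so one polynomial of degree below \<open>k\<close> serves every
  \<open>\<delta>\<close>, and the arbitrary \<open>\<delta>\<close> swallows powers of the
  logarithm. The bound holds on all of [1, \<infinity>), not just eventually, so that it can be used
  at every x / e >= 1.\<close>

definition log_poly_asymp :: "nat \<Rightarrow> real \<Rightarrow> (real \<Rightarrow> real) \<Rightarrow> bool" where
  "log_poly_asymp k \<eta> F \<longleftrightarrow>
     (\<exists>c. \<forall>\<delta>>0. powr_bounded (\<lambda>x. F x - (\<Sum>i<k. c i * ln x ^ i)) (- \<eta> + \<delta>))"

text \<open>A smaller \<open>\<delta>\<close> gives a stronger bound, so large ones can be ignored.
  This matters where a series converges only for \<open>\<delta>\<close> below the saving.\<close>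

lemma log_poly_asympI:
  assumes "\<delta>0 > 0"
    and "\<And>\<delta>. 0 < \<delta> \<Longrightarrow> \<delta> < \<delta>0 \<Longrightarrow>
      powr_bounded (\<lambda>x. F x - (\<Sum>i<k. c i * ln x ^ i)) (- \<eta> + \<delta>)"
  shows "log_poly_asymp k \<eta> F"
  unfolding log_poly_asymp_def
proof (intro exI[of _ c] allI impI)
  fix \<delta> :: real assume "\<delta> > 0"
  define d where "d = min \<delta> (\<delta>0 / 2)"
  have d: "0 < d" "d < \<delta>0" "d \<le> \<delta>" using assms(1) \<open>\<delta> > 0\<close> by (auto simp: d_def)
  from assms(2)[OF d(1,2)] obtain K
    where K: "\<And>x. x \<ge> 1 \<Longrightarrow> \<bar>F x - (\<Sum>i<k. c i * ln x ^ i)\<bar> \<le> K * x powr (- \<eta> + d)"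
    by blast
  have "\<bar>F x - (\<Sum>i<k. c i * ln x ^ i)\<bar> \<le> \<bar>K\<bar> * x powr (- \<eta> + \<delta>)" if "x \<ge> 1" for x
  proof -
    have "\<bar>F x - (\<Sum>i<k. c i * ln x ^ i)\<bar> \<le> K * x powr (- \<eta> + d)" by (rule K[OF that])
    also have "\<dots> \<le> \<bar>K\<bar> * x powr (- \<eta> + \<delta>)"
      using that d by (intro mult_mono powr_mono) auto
    finally show ?thesis .
  qed
  then show "powr_bounded (\<lambda>x. F x - (\<Sum>i<k. c i * ln x ^ i)) (- \<eta> + \<delta>)" by blast
qed

lemma log_poly_asymp_cong:
  assumes "log_poly_asymp k \<eta> F" "\<And>x. x \<ge> 1 \<Longrightarrow> F x = G x"
  shows "log_poly_asymp k \<eta> G"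
  using assms unfolding log_poly_asymp_def by simp

lemma log_poly_asymp_add:
  assumes "log_poly_asymp k \<eta> F" "log_poly_asymp k \<eta> G"
  shows "log_poly_asymp k \<eta> (\<lambda>x. F x + G x)"
proof -
  from assms obtain c d where
    c: "\<And>\<delta>. \<delta> > 0 \<Longrightarrow> powr_bounded (\<lambda>x. F x - (\<Sum>i<k. c i * ln x ^ i)) (- \<eta> + \<delta>)" and
    d: "\<And>\<delta>. \<delta> > 0 \<Longrightarrow> powr_bounded (\<lambda>x. G x - (\<Sum>i<k. d i * ln x ^ i)) (- \<eta> + \<delta>)"
    unfolding log_poly_asymp_def by blast
  show ?thesis
  proof (rule log_poly_asympI[of 1 _ "\<lambda>i. c i + d i"])
    fix \<delta> :: real assume "\<delta> > 0"
    from c[OF this] d[OF this] obtain K L where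
      K: "\<And>x. x\<ge>1 \<Longrightarrow> \<bar>F x - (\<Sum>i<k. c i * ln x ^ i)\<bar> \<le> K * x powr (- \<eta> + \<delta>)" and
      L: "\<And>x. x\<ge>1 \<Longrightarrow> \<bar>G x - (\<Sum>i<k. d i * ln x ^ i)\<bar> \<le> L * x powr (- \<eta> + \<delta>)" by blast
    have "\<bar>F x + G x - (\<Sum>i<k. (c i + d i) * ln x ^ i)\<bar> \<le> (K + L) * x powr (- \<eta> + \<delta>)" if "x \<ge> 1" for x
      using K[OF that] L[OF that] by (simp add: distrib_right sum.distrib)
    then show "powr_bounded (\<lambda>x. F x + G x - (\<Sum>i<k. (c i + d i) * ln x ^ i)) (- \<eta> + \<delta>)"
      by blast
  qed simp
qed

lemma log_poly_asymp_small:
  assumes "\<And>\<delta>. \<delta> > 0 \<Longrightarrow> powr_bounded F (- \<eta> + \<delta>)"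
  shows "log_poly_asymp k \<eta> F"
  using assms by (intro log_poly_asympI[of 1 _ "\<lambda>_. 0"]) auto

lemma log_poly_asymp_cmult:
  assumes "log_poly_asymp k \<eta> F"
  shows "log_poly_asymp k \<eta> (\<lambda>x. a * F x)"
proof -
  from assms obtain c where
    c: "\<And>\<delta>. \<delta> > 0 \<Longrightarrow> powr_bounded (\<lambda>x. F x - (\<Sum>i<k. c i * ln x ^ i)) (- \<eta> + \<delta>)"
    unfolding log_poly_asymp_def by blast
  show ?thesis
  proof (rule log_poly_asympI[of 1 _ "\<lambda>i. a * c i"])
    fix \<delta> :: real assume "\<delta> > 0"
    from c[OF this] obtain K where
      K: "\<And>x. x\<ge>1 \<Longrightarrow> \<bar>F x - (\<Sum>i<k. c i * ln x ^ i)\<bar> \<le> K * x powr (- \<eta> + \<delta>)" by blast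
    have "\<bar>a * F x - (\<Sum>i<k. a * c i * ln x ^ i)\<bar> \<le> (\<bar>a\<bar> * K) * x powr (- \<eta> + \<delta>)" if "x \<ge> 1" for x
    proof -
      have "a * F x - (\<Sum>i<k. a * c i * ln x ^ i) = a * (F x - (\<Sum>i<k. c i * ln x ^ i))"
        by (simp add: sum_distrib_left right_diff_distrib mult.assoc)
      then show ?thesis using mult_left_mono[OF K[OF that], of "\<bar>a\<bar>"] by (simp add: abs_mult mult.assoc)
    qed
    then show "powr_bounded (\<lambda>x. a * F x - (\<Sum>i<k. a * c i * ln x ^ i)) (- \<eta> + \<delta>)"
      by blast
  qed simp
qed

lemma log_poly_asymp_zero: "log_poly_asymp k \<eta> (\<lambda>x. 0)"
  by (rule log_poly_asymp_small) (auto intro!: exI[of _ 0])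

lemma log_poly_asymp_sum:
  assumes "\<And>i. i \<in> I \<Longrightarrow> log_poly_asymp k \<eta> (F i)"
  shows "log_poly_asymp k \<eta> (\<lambda>x. \<Sum>i\<in>I. F i x)"
  using assms by (induction I rule: infinite_finite_induct)
    (auto intro: log_poly_asymp_zero log_poly_asymp_add)

lemma log_poly_asymp_mono:
  assumes "log_poly_asymp k \<eta> F" "k \<le> k'" "\<eta>' \<le> \<eta>"
  shows "log_poly_asymp k' \<eta>' F"
proof -
  from assms obtain c where
    c: "\<And>\<delta>. \<delta> > 0 \<Longrightarrow> powr_bounded (\<lambda>x. F x - (\<Sum>i<k. c i * ln x ^ i)) (- \<eta> + \<delta>)"
    unfolding log_poly_asymp_def by blast
  define d where "d i = (if i < k then c i else 0)" for i
  have eq: "(\<Sum>i<k'. d i * ln x ^ i) = (\<Sum>i<k. c i * ln x ^ i)" for x :: real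
    using assms(2) by (intro sum.mono_neutral_cong_right) (auto simp: d_def)
  show ?thesis
  proof (rule log_poly_asympI[of 1 _ d])
    fix \<delta> :: real assume "\<delta> > 0"
    from c[OF this] obtain K where
      K: "\<And>x. x\<ge>1 \<Longrightarrow> \<bar>F x - (\<Sum>i<k. c i * ln x ^ i)\<bar> \<le> K * x powr (- \<eta> + \<delta>)" by blast
    have "\<bar>F x - (\<Sum>i<k'. d i * ln x ^ i)\<bar> \<le> \<bar>K\<bar> * x powr (- \<eta>' + \<delta>)" if "x \<ge> 1" for x
    proof -
      have "K * x powr (- \<eta> + \<delta>) \<le> \<bar>K\<bar> * x powr (- \<eta>' + \<delta>)"
        using that assms(3) by (intro mult_mono powr_mono) auto
      with K[OF that] show ?thesis by (simp add: eq)
    qed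
    then show "powr_bounded (\<lambda>x. F x - (\<Sum>i<k'. d i * ln x ^ i)) (- \<eta>' + \<delta>)" by blast
  qed simp
qed

lemma log_poly_asymp_ln_power: "log_poly_asymp (Suc j) \<eta> (\<lambda>x. ln x ^ j)"
proof (rule log_poly_asympI[of 1 _ "\<lambda>i. if i = j then 1 else 0"])
  fix \<delta> :: real
  have "(\<Sum>i<Suc j. (if i = j then 1 else 0) * ln x ^ i) = ln x ^ j" for x :: real
    by (subst sum.remove[of _ j]) (auto intro!: sum.neutral)
  then show "powr_bounded (\<lambda>x. ln x ^ j - (\<Sum>i<Suc j. (if i = j then 1 else 0) * ln x ^ i)) (- \<eta> + \<delta>)"
    by (intro exI[of _ 0]) auto
qed simp

lemma log_poly_asymp_mult_ln_power:
  assumes "log_poly_asymp k \<eta> F"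
  shows "log_poly_asymp (k + j) \<eta> (\<lambda>x. ln x ^ j * F x)"
proof -
  from assms obtain c where
    c: "\<And>\<delta>. \<delta> > 0 \<Longrightarrow> powr_bounded (\<lambda>x. F x - (\<Sum>i<k. c i * ln x ^ i)) (- \<eta> + \<delta>)"
    unfolding log_poly_asymp_def by blast
  have 1: "log_poly_asymp (k + j) \<eta> (\<lambda>x. \<Sum>i<k. c i * ln x ^ (i + j))"
    by (intro log_poly_asymp_sum log_poly_asymp_cmult)
       (rule log_poly_asymp_mono[OF log_poly_asymp_ln_power], auto)
  have 2: "log_poly_asymp (k + j) \<eta> (\<lambda>x. ln x ^ j * (F x - (\<Sum>i<k. c i * ln x ^ i)))"
  proof (rule log_poly_asymp_small)
    fix \<delta> :: real assume "\<delta> > 0"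
    \<comment> \<open>One half of \<open>\<delta>\<close> pays for the error of \<open>F\<close>,
      the other for the factor \<open>ln x ^ j\<close>.\<close>
    then have d: "\<delta> / 2 > 0" by simp
    from c[OF d] obtain K where
      K: "\<And>x. x\<ge>1 \<Longrightarrow> \<bar>F x - (\<Sum>i<k. c i * ln x ^ i)\<bar> \<le> K * x powr (- \<eta> + \<delta> / 2)" by blast
    from ln_power_le_powr[OF d] obtain L where
      L: "L \<ge> 0" "\<And>x. x\<ge>1 \<Longrightarrow> ln x ^ j \<le> L * x powr (\<delta> / 2)" by blast
    have "\<bar>ln x ^ j * (F x - (\<Sum>i<k. c i * ln x ^ i))\<bar> \<le> (L * K) * x powr (- \<eta> + \<delta>)" if "x \<ge> 1" for x
    proof -
      have "\<bar>ln x ^ j * (F x - (\<Sum>i<k. c i * ln x ^ i))\<bar> \<le> (L * x powr (\<delta>/2)) * (K * x powr (- \<eta> + \<delta>/2))"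
        unfolding abs_mult using K[OF that] L(2)[OF that] L(1) that by (intro mult_mono) auto
      also have "\<dots> = (L * K) * (x powr (\<delta>/2) * x powr (- \<eta> + \<delta>/2))" by simp
      also have "x powr (\<delta>/2) * x powr (- \<eta> + \<delta>/2) = x powr (- \<eta> + \<delta>)"
        using that by (simp add: powr_add[symmetric])
      finally show ?thesis .
    qed
    then show "powr_bounded (\<lambda>x. ln x ^ j * (F x - (\<Sum>i<k. c i * ln x ^ i))) (- \<eta> + \<delta>)" by blast
  qed
  show ?thesis
    by (rule log_poly_asymp_cong[OF log_poly_asymp_add[OF 1 2]])
       (simp add: right_diff_distrib sum_distrib_left power_add mult_ac)
qed

text \<open>The logarithm of \<open>x powr \<alpha>\<close> is \<alpha> ln x, so the substitution
  only rescales the coefficients and the saving.\<close>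

lemma log_poly_asymp_compose_powr:
  assumes "log_poly_asymp k \<eta> F" "\<alpha> > 0"
  shows "log_poly_asymp k (\<alpha> * \<eta>) (\<lambda>x. F (x powr \<alpha>))"
proof -
  from assms obtain c where
    c: "\<And>\<delta>. \<delta> > 0 \<Longrightarrow> powr_bounded (\<lambda>x. F x - (\<Sum>i<k. c i * ln x ^ i)) (- \<eta> + \<delta>)"
    unfolding log_poly_asymp_def by blast
  show ?thesis
  proof (rule log_poly_asympI[of 1 _ "\<lambda>i. c i * \<alpha> ^ i"])
    fix \<delta> :: real assume "\<delta> > 0"
    then have "\<delta> / \<alpha> > 0" using assms by simp
    from c[OF this] obtain K where
      K: "\<And>x. x\<ge>1 \<Longrightarrow> \<bar>F x - (\<Sum>i<k. c i * ln x ^ i)\<bar> \<le> K * x powr (- \<eta> + \<delta> / \<alpha>)" by blast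
    have "\<bar>F (x powr \<alpha>) - (\<Sum>i<k. c i * \<alpha> ^ i * ln x ^ i)\<bar> \<le> K * x powr (- (\<alpha> * \<eta>) + \<delta>)" if "x \<ge> 1" for x
    proof -
      have "x powr \<alpha> \<ge> 1" using that assms by (simp add: ge_one_powr_ge_zero)
      from K[OF this] show ?thesis using that assms
        by (simp add: ln_powr power_mult_distrib powr_powr algebra_simps)
    qed
    then show "powr_bounded (\<lambda>x. F (x powr \<alpha>) - (\<Sum>i<k. c i * \<alpha> ^ i * ln x ^ i)) (- (\<alpha> * \<eta>) + \<delta>)" by blast
  qed simp
qed

lemma log_poly_asymp_bound:
  assumes "log_poly_asymp k \<eta> F" "\<eta> \<ge> 0" "\<delta> > 0"
  shows "\<exists>K\<ge>0. \<forall>x\<ge>1. \<bar>F x\<bar> \<le> K * x powr \<delta>"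
proof -
  from assms obtain c where
    c: "\<And>\<delta>. \<delta> > 0 \<Longrightarrow> powr_bounded (\<lambda>x. F x - (\<Sum>i<k. c i * ln x ^ i)) (- \<eta> + \<delta>)"
    unfolding log_poly_asymp_def by blast
  from c[OF assms(3)] obtain K where
    K: "\<And>x. x\<ge>1 \<Longrightarrow> \<bar>F x - (\<Sum>i<k. c i * ln x ^ i)\<bar> \<le> K * x powr (- \<eta> + \<delta>)" by blast
  have "\<forall>i. \<exists>L\<ge>0. \<forall>x\<ge>1. ln x ^ i \<le> L * x powr \<delta>"
    using ln_power_le_powr[OF assms(3)] by blast
  then obtain L where L: "\<And>i. L i \<ge> 0" "\<And>i x. x \<ge> 1 \<Longrightarrow> ln x ^ i \<le> L i * x powr \<delta>" by metis
  have "\<bar>F x\<bar> \<le> (\<bar>K\<bar> + (\<Sum>i<k. \<bar>c i\<bar> * L i)) * x powr \<delta>" if x: "x \<ge> 1" for x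
  proof -
    have "\<bar>\<Sum>i<k. c i * ln x ^ i\<bar> \<le> (\<Sum>i<k. \<bar>c i\<bar> * (L i * x powr \<delta>))"
      using x L(2)[OF x]
      by (intro order_trans[OF sum_abs] sum_mono) (auto simp: abs_mult intro!: mult_left_mono)
    moreover have "K * x powr (- \<eta> + \<delta>) \<le> \<bar>K\<bar> * x powr \<delta>"
      using x assms by (intro mult_mono powr_mono) auto
    ultimately show ?thesis using K[OF x] by (simp add: distrib_right sum_distrib_right mult.assoc)
  qed
  moreover have "\<bar>K\<bar> + (\<Sum>i<k. \<bar>c i\<bar> * L i) \<ge> 0" using L by (intro add_nonneg_nonneg sum_nonneg) auto
  ultimately show ?thesis by blast
qed

section \<open>Partial sums: convergent series and harmonic sums with logarithms\<close>

definition psum :: "(nat \<Rightarrow> real) \<Rightarrow> real \<Rightarrow> real" where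
  "psum a x = (\<Sum>n\<in>{1..nat \<lfloor>x\<rfloor>}. a n)"

lemma mem_nat_floor_iff: "n \<in> {1..nat \<lfloor>x\<rfloor>} \<longleftrightarrow> 1 \<le> n \<and> real n \<le> x"
proof
  assume "n \<in> {1..nat \<lfloor>x\<rfloor>}"
  then have "1 \<le> n" "int n \<le> \<lfloor>x\<rfloor>" by auto
  then show "1 \<le> n \<and> real n \<le> x" by (simp add: le_floor_iff)
qed (auto simp: le_nat_floor)

lemma nat_floor_bounds:
  assumes "x \<ge> (1::real)"
  shows "nat \<lfloor>x\<rfloor> \<ge> 1" "real (nat \<lfloor>x\<rfloor>) \<le> x" "x < real (nat \<lfloor>x\<rfloor>) + 1" "x / 2 \<le> real (nat \<lfloor>x\<rfloor>)"
proof -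
  show 1: "nat \<lfloor>x\<rfloor> \<ge> 1" "real (nat \<lfloor>x\<rfloor>) \<le> x" "x < real (nat \<lfloor>x\<rfloor>) + 1"
    using assms by linarith+
  have "real (nat \<lfloor>x\<rfloor>) \<ge> 1" using of_nat_mono[OF 1(1), where 'a = real] by simp
  with 1 show "x / 2 \<le> real (nat \<lfloor>x\<rfloor>)" by linarith
qed

text \<open>The mean value theorem for t powr (-s). It allows tails to be bounded by telescoping
  sums instead of integrals.\<close>

lemma powr_le_telescope:
  assumes "s > 0" "(m::nat) \<ge> 1"
  shows "real (Suc m) powr (-1 - s) \<le> (real m powr (-s) - real (Suc m) powr (-s)) / s"
proof -
  have "\<exists>z>real m. z < real (Suc m) \<and>
      real (Suc m) powr (-s) - real m powr (-s) = (real (Suc m) - real m) * (-s * z powr (-s - 1))"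
    using assms by (intro MVT2) (auto intro!: derivative_eq_intros)
  then obtain z where z: "z > real m" "z < real (Suc m)"
    "real (Suc m) powr (-s) - real m powr (-s) = -s * z powr (-s - 1)" by auto
  have "real (Suc m) powr (-s-1) \<le> z powr (-s-1)" using z assms by (intro powr_mono2') auto
  moreover have "-1 - s = -s - 1" by simp
  ultimately have "s * real (Suc m) powr (-1-s) \<le> s * z powr (-s-1)"
    using assms(1) by (metis mult_left_mono less_imp_le)
  also have "\<dots> = real m powr (-s) - real (Suc m) powr (-s)" using z(3) by simp
  finally show ?thesis using assms by (simp add: field_simps)
qed

lemma tail_bound:
  assumes "s > 0" "\<And>m. m \<ge> 1 \<Longrightarrow> \<bar>u m\<bar> \<le> K * real m powr (-1 - s)"
  shows "summable u" "\<exists>L. \<forall>x\<ge>1. \<bar>(\<Sum>m. u (Suc m)) - psum u x\<bar> \<le> L * x powr (-s)"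
proof -
  have K: "K \<ge> 0" using assms(2)[of 1] by auto
  have "summable (\<lambda>n. K * real n powr (-1 - s))"
    using assms(1) by (intro summable_mult) (simp add: summable_real_powr_iff)
  then show sm: "summable u"
    by (rule summable_comparison_test[rotated]) (use assms(2) in \<open>auto intro!: exI[of _ 1]\<close>)
  have smS: "summable (\<lambda>m. u (Suc m))" using sm by (simp add: summable_Suc_iff)
  have tail: "\<bar>\<Sum>m. u (Suc (m + N))\<bar> \<le> K / s * real N powr (-s)" if "N \<ge> 1" for N
  proof -
    define t where "t m = real (m + N) powr (-s)" for m
    have tl: "t \<longlonglongrightarrow> 0" unfolding t_def using assms(1)
      by (intro tendsto_neg_powr filterlim_compose[OF filterlim_real_sequentially filterlim_add_const_nat_at_top]) auto
    have sums: "(\<lambda>m. K / s * (t m - t (Suc m))) sums (K / s * (t 0 - 0))"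
      by (intro sums_mult telescope_sums'[OF tl])
    have le: "\<bar>u (Suc (m + N))\<bar> \<le> K / s * (t m - t (Suc m))" for m
    proof -
      have "\<bar>u (Suc (m + N))\<bar> \<le> K * real (Suc (m + N)) powr (-1 - s)" by (intro assms(2)) auto
      also have "\<dots> \<le> K * ((real (m+N) powr (-s) - real (Suc (m+N)) powr (-s)) / s)"
        using K assms(1) that by (intro mult_left_mono powr_le_telescope) auto
      finally show ?thesis by (simp add: t_def)
    qed
    have "summable (\<lambda>m. \<bar>u (Suc (m + N))\<bar>)"
      by (rule summable_comparison_test[OF _ sums_summable[OF sums]]) (use le in auto)
    then have "\<bar>\<Sum>m. u (Suc (m + N))\<bar> \<le> (\<Sum>m. \<bar>u (Suc (m + N))\<bar>)" by (rule summable_rabs)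
    also have "\<dots> \<le> (\<Sum>m. K / s * (t m - t (Suc m)))"
      by (intro suminf_le le \<open>summable (\<lambda>m. \<bar>u (Suc (m + N))\<bar>)\<close> sums_summable[OF sums])
    also have "\<dots> = K / s * t 0" using sums_unique[OF sums] by simp
    finally show ?thesis by (simp add: t_def)
  qed
  show "\<exists>L. \<forall>x\<ge>1. \<bar>(\<Sum>m. u (Suc m)) - psum u x\<bar> \<le> L * x powr (-s)"
  \<comment> \<open>The factor \<open>2 powr s\<close> pays for replacing the integer part of x by
    its lower bound x / 2.\<close>
  proof (intro exI[of _ "K / s * 2 powr s"] allI impI)
    fix x :: real assume x: "x \<ge> 1"
    define N where "N = nat \<lfloor>x\<rfloor>"
    have N: "N \<ge> 1" "x / 2 \<le> real N" using nat_floor_bounds[OF x] unfolding N_def by auto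
    have "(\<Sum>m. u (Suc m)) = (\<Sum>m. u (Suc (m + N))) + (\<Sum>m<N. u (Suc m))"
      using suminf_split_initial_segment[OF smS, of N] by simp
    also have "(\<Sum>m<N. u (Suc m)) = psum u x"
      unfolding psum_def N_def[symmetric] by (rule sum.reindex_bij_witness[of _ "\<lambda>n. n - 1" Suc]) auto
    finally have "\<bar>(\<Sum>m. u (Suc m)) - psum u x\<bar> \<le> K / s * real N powr (-s)" using tail[OF N(1)] by simp
    also have "real N powr (-s) \<le> (x / 2) powr (-s)" using N x assms(1) by (intro powr_mono2') auto
    also have "(x / 2) powr (-s) = 2 powr s * x powr (-s)" using x by (simp add: powr_divide powr_minus field_simps)
    finally show "\<bar>(\<Sum>m. u (Suc m)) - psum u x\<bar> \<le> K / s * 2 powr s * x powr (-s)"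
      using K assms(1) by (simp add: mult_left_mono divide_right_mono)
  qed
qed

text \<open>The polynomial is a constant, the value of the full series, and the error is its tail.
  Restricting to \<open>\<delta> < \<eta>\<close> keeps the exponent of the terms below -1.\<close>

lemma log_poly_asymp_psum_summable:
  assumes "\<eta> > 0" "\<And>\<delta>. \<delta> > 0 \<Longrightarrow> \<exists>K. \<forall>m\<ge>1. \<bar>u m\<bar> \<le> K * real m powr (-1 - \<eta> + \<delta>)"
  shows "log_poly_asymp 1 \<eta> (psum u)"
proof (rule log_poly_asympI[of _ _ "\<lambda>_. \<Sum>m. u (Suc m)"])
  fix \<delta> assume d: "0 < \<delta>" "\<delta> < \<eta>"
  from assms(2)[OF d(1)] obtain K where K: "\<And>m. m \<ge> 1 \<Longrightarrow> \<bar>u m\<bar> \<le> K * real m powr (-1 - (\<eta> - \<delta>))"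
    by (auto simp: algebra_simps)
  obtain L where "\<forall>x\<ge>1. \<bar>(\<Sum>m. u (Suc m)) - psum u x\<bar> \<le> L * x powr (-(\<eta> - \<delta>))"
    using tail_bound(2)[of "\<eta> - \<delta>" u K] K d by auto
  then show "powr_bounded (\<lambda>x. psum u x - (\<Sum>i<1. (\<Sum>m. u (Suc m)) * ln x ^ i)) (- \<eta> + \<delta>)"
    by (intro exI[of _ L]) (auto simp: abs_minus_commute algebra_simps)
qed fact

text \<open>The mean value bound with exponent j in place of the sharp j - 1; this is harmless for A
  >= 1 and keeps the induction free of subtraction.\<close>

lemma power_diff_le:
  fixes a b A :: real
  assumes "0 \<le> b" "b \<le> a" "a \<le> A" "1 \<le> A"
  shows "a ^ j - b ^ j \<le> real j * A ^ j * (a - b)"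
proof (induction j)
  case (Suc j)
  have "a ^ Suc j - b ^ Suc j = a * (a ^ j - b ^ j) + b ^ j * (a - b)" by (simp add: algebra_simps)
  also have "\<dots> \<le> A * (real j * A ^ j * (a - b)) + A ^ Suc j * (a - b)"
  proof (intro add_mono mult_right_mono mult_mono)
    have "b ^ j \<le> A ^ j" using assms by (intro power_mono) auto
    also have "\<dots> \<le> A ^ Suc j" using assms by (intro power_increasing) auto
    finally show "b ^ j \<le> A ^ Suc j" .
    show "0 \<le> a ^ j - b ^ j" using assms power_mono[of b a j] by simp
  qed (use assms Suc.IH in auto)
  also have "\<dots> = real (Suc j) * A ^ Suc j * (a - b)" by (simp add: algebra_simps)
  finally show ?case .
qed simp

lemma ln_power_diff_le:
  assumes "1 \<le> b" "b \<le> (a::real)"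
  shows "ln a ^ j - ln b ^ j \<le> real j * (1 + ln a) ^ j * ((a - b) / b)"
proof -
  have "ln a ^ j - ln b ^ j \<le> real j * (1 + ln a) ^ j * (ln a - ln b)"
    using assms by (intro power_diff_le) auto
  also have "ln a - ln b \<le> (a - b) / b" using assms by (intro ln_diff_le) auto
  finally show ?thesis using assms by (simp add: mult_left_mono)
qed

lemma has_real_derivative_ln_power:
  assumes "t > (0::real)"
  shows "((\<lambda>t. ln t ^ Suc j / real (Suc j)) has_real_derivative ln t ^ j / t) (at t)"
proof -
  have "((\<lambda>t. ln t ^ Suc j / real (Suc j)) has_real_derivative
      (1 + real j) * (1 / t * ln t ^ j) / real (Suc j)) (at t)"
    using assms by (intro DERIV_cdivide DERIV_power_Suc DERIV_ln_divide)
  moreover have "(1 + real j) * (1 / t * ln t ^ j) / real (Suc j) = ln t ^ j / t" by simp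
  ultimately show ?thesis by metis
qed

text \<open>Subtracting from each term the increment of the antiderivative ln^(j+1) / (j+1) leaves
  terms of size ln^j m / m^2, whose partial sums converge with saving 1. The increments telescope to
  the antiderivative at the integer part of x, which differs from its value at x by
  O(x^(-1+\<delta>)).\<close>

lemma log_poly_asymp_harmonic:
  "log_poly_asymp (j + 2) 1 (psum (\<lambda>m. ln (real m) ^ j / real m))"
proof -
  define g where "g m = ln (real m) ^ Suc j / real (Suc j)" for m
  \<comment> \<open>The term m = 1 has no preceding increment and stays whole; since
    \<open>g 1 = 0\<close>, the identity \<open>tele\<close> holds from N = 1 on.\<close>
  define u where "u m = ln (real m) ^ j / real m - (if m \<le> 1 then 0 else g m - g (m - 1))" for m
  have ub: "\<bar>u m\<bar> \<le> 2 * real (j + 1) * (1 + ln m) ^ j / real m ^ 2" if m: "m \<ge> 2" for m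
  proof -
    define b where "b = real m - 1"
    have b: "b \<ge> 1" "b < real m" using m by (auto simp: b_def)
    have mb: "real m - b = 1" by (simp add: b_def)
    have bm: "real (m - 1) = b" using m by (auto simp: b_def)
    have "\<exists>z>b. z < real m \<and> ln (real m) ^ Suc j / real (Suc j) - ln b ^ Suc j / real (Suc j)
        = (real m - b) * (ln z ^ j / z)"
      using b by (intro MVT2 has_real_derivative_ln_power) auto
    then obtain z where z: "b < z" "z < real m" and gz: "g m - g (m - 1) = ln z ^ j / z"
      using b m unfolding g_def bm by (auto simp: b_def)
    have um: "u m = ln (real m) ^ j / real m - ln z ^ j / z" using m gz by (simp add: u_def)
    have l: "0 \<le> ln b" "ln b \<le> ln z" "ln z \<le> ln (real m)" using z b by auto
    \<comment> \<open>For j > 0 the function ln^j t / t is not monotone, so numerator and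
      denominator are estimated separately.\<close>
    have "ln z ^ j / z \<le> ln (real m) ^ j / b" using z b l by (intro frac_le power_mono) auto
    moreover have "ln b ^ j / real m \<le> ln z ^ j / z" using z b l by (intro frac_le power_mono) auto
    moreover have "ln (real m) ^ j / b - ln (real m) ^ j / real m = ln (real m) ^ j / (b * real m)"
    proof -
      have "ln (real m) ^ j / b - ln (real m) ^ j / real m = ln (real m) ^ j * (real m - b) / (b * real m)"
        using b by (simp add: field_simps)
      then show ?thesis by (simp add: mb)
    qed
    moreover have "ln (real m) ^ j / real m - ln b ^ j / real m \<le> real j * (1 + ln m) ^ j / (b * real m)"
    proof -
      have "(ln (real m) ^ j - ln b ^ j) / real m \<le> (real j * (1 + ln m) ^ j * ((real m - b) / b)) / real m"
        using b by (intro divide_right_mono ln_power_diff_le) auto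
      then show ?thesis unfolding mb by (simp only: diff_divide_distrib) simp
    qed
    moreover have "ln (real m) ^ j \<le> (1 + ln m) ^ j" using b by (intro power_mono) auto
    then have "ln (real m) ^ j / (b * real m) \<le> (1 + ln m) ^ j / (b * real m)"
      using b by (intro divide_right_mono) auto
    moreover have "real j * (1 + ln m) ^ j / (b * real m) \<ge> 0" "(1 + ln m) ^ j / (b * real m) \<ge> 0"
      using b by auto
    ultimately have "\<bar>u m\<bar> \<le> real j * (1 + ln m) ^ j / (b * real m) + (1 + ln m) ^ j / (b * real m)"
      unfolding um by linarith
    also have "\<dots> = real (j + 1) * (1 + ln m) ^ j * (1 / (b * real m))"
      by (simp add: distrib_right add_divide_distrib)
    also have "\<dots> \<le> real (j + 1) * (1 + ln m) ^ j * (2 / real m ^ 2)"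
    proof (intro mult_left_mono)
      have "real m ^ 2 \<le> 2 * (b * real m)" using m by (simp add: b_def power2_eq_square algebra_simps)
      then show "1 / (b * real m) \<le> 2 / real m ^ 2"
        using frac_le[of 2 2 "real m ^ 2" "2 * (b * real m)"] b by simp
    qed (use b in auto)
    finally show ?thesis by (simp only: mult.assoc mult.left_commute times_divide_eq_right mult.commute[of 2])
  qed
  have 1: "log_poly_asymp 1 1 (psum u)"
  proof (rule log_poly_asymp_psum_summable)
    fix \<delta> :: real assume "\<delta> > 0"
    from one_plus_ln_power_le_powr[OF this] obtain K where
      K: "K \<ge> 0" "\<And>x. x \<ge> 1 \<Longrightarrow> (1 + ln x) ^ j \<le> K * x powr \<delta>" by blast
    have "\<bar>u m\<bar> \<le> (2 * real (j + 1) * K + 1) * real m powr (-1 - 1 + \<delta>)" if m: "m \<ge> 1" for m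
    proof (cases "m = 1")
      case True
      then have "\<bar>u m\<bar> \<le> 1" by (simp add: u_def power_0_left)
      moreover have "2 * real (j + 1) * K \<ge> 0" using K by simp
      ultimately show ?thesis using True by auto
    next
      case False
      then have "\<bar>u m\<bar> \<le> 2 * real (j + 1) * (1 + ln m) ^ j / real m ^ 2" using m by (intro ub) auto
      also have "\<dots> \<le> 2 * real (j + 1) * (K * real m powr \<delta>) / real m ^ 2"
        using m K(2)[of "real m"] by (intro divide_right_mono mult_left_mono) auto
      also have "\<dots> = (2 * real (j + 1) * K) * real m powr (-1 - 1 + \<delta>)"
      proof -
        have "real m powr (-1 - 1 + \<delta>) = real m powr (\<delta> - 2)" by (rule arg_cong[of _ _ "\<lambda>t. real m powr t"]) simp
        also have "\<dots> = real m powr \<delta> / real m ^ 2" by (simp only: powr_diff) (simp add: powr_numeral)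
        finally show ?thesis by simp
      qed
      also have "\<dots> \<le> (2 * real (j + 1) * K + 1) * real m powr (-1 - 1 + \<delta>)" by (intro mult_right_mono) auto
      finally show ?thesis .
    qed
    then show "\<exists>K. \<forall>m\<ge>1. \<bar>u m\<bar> \<le> K * real m powr (-1 - 1 + \<delta>)" by blast
  qed simp
  have tele: "(\<Sum>m\<in>{1..N}. ln (real m) ^ j / real m) = (\<Sum>m\<in>{1..N}. u m) + g N" if "N \<ge> 1" for N
    using that
  proof (induction N rule: dec_induct)
    case base
    then show ?case by (simp add: u_def g_def)
  next
    case (step N)
    then show ?case by (simp add: u_def)
  qed
  have 2: "log_poly_asymp (j + 2) 1 (\<lambda>x. g (nat \<lfloor>x\<rfloor>) - ln x ^ Suc j / real (Suc j))"
  proof (rule log_poly_asymp_small)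
    fix \<delta> :: real assume "\<delta> > 0"
    from one_plus_ln_power_le_powr[OF this] obtain K where
      K: "K \<ge> 0" "\<And>x. x \<ge> 1 \<Longrightarrow> (1 + ln x) ^ Suc j \<le> K * x powr \<delta>" by blast
    have "\<bar>g (nat \<lfloor>x\<rfloor>) - ln x ^ Suc j / real (Suc j)\<bar> \<le> (2 * K) * x powr (- 1 + \<delta>)" if x: "x \<ge> 1" for x
    proof -
      define N where "N = real (nat \<lfloor>x\<rfloor>)"
      have N: "N \<ge> 1" "N \<le> x" "x < N + 1" "x / 2 \<le> N"
        using nat_floor_bounds[OF x] by (auto simp: N_def)
      have "ln N ^ Suc j \<le> ln x ^ Suc j" using N by (intro power_mono) auto
      then have "\<bar>g (nat \<lfloor>x\<rfloor>) - ln x ^ Suc j / real (Suc j)\<bar> = (ln x ^ Suc j - ln N ^ Suc j) / real (Suc j)"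
        by (simp add: g_def N_def[symmetric] diff_divide_distrib[symmetric] abs_divide del: power_Suc)
      also have "\<dots> \<le> (real (Suc j) * (1 + ln x) ^ Suc j * ((x - N) / N)) / real (Suc j)"
        using N by (intro divide_right_mono ln_power_diff_le) auto
      also have "\<dots> = (1 + ln x) ^ Suc j * ((x - N) / N)" by (simp del: power_Suc)
      also have "\<dots> \<le> (K * x powr \<delta>) * (1 / (x / 2))"
      proof (rule mult_mono)
        show "(x - N) / N \<le> 1 / (x / 2)" using N x by (intro frac_le) linarith+
        show "0 \<le> K * x powr \<delta>" using K(1) by simp
        show "0 \<le> (x - N) / N" using N by simp
      qed (rule K(2)[OF x])
      also have "\<dots> = (2 * K) * x powr (- 1 + \<delta>)" using x by (simp add: powr_diff)
      finally show ?thesis .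
    qed
    then show "powr_bounded (\<lambda>x. g (nat \<lfloor>x\<rfloor>) - ln x ^ Suc j / real (Suc j)) (- 1 + \<delta>)" by blast
  qed
  have "log_poly_asymp (j + 2) 1 (\<lambda>x. ln x ^ Suc j)"
    by (rule log_poly_asymp_mono[OF log_poly_asymp_ln_power[of "Suc j" 1]]) auto
  from log_poly_asymp_cmult[OF this, of "1 / real (Suc j)"]
  have 3: "log_poly_asymp (j + 2) 1 (\<lambda>x. ln x ^ Suc j / real (Suc j))" by simp
  have 4: "log_poly_asymp (j + 2) 1 (psum u)" by (rule log_poly_asymp_mono[OF 1]) auto
  show ?thesis
  proof (rule log_poly_asymp_cong[OF log_poly_asymp_add[OF 4 log_poly_asymp_add[OF 2 3]]])
    fix x :: real assume "x \<ge> 1"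
    from tele[OF nat_floor_bounds(1)[OF this]]
    show "psum u x + (g (nat \<lfloor>x\<rfloor>) - ln x ^ Suc j / real (Suc j) + ln x ^ Suc j / real (Suc j)) =
         psum (\<lambda>m. ln (real m) ^ j / real m) x"
      unfolding psum_def by linarith
  qed
qed

section \<open>Partial sums of Dirichlet convolutions\<close>

text \<open>Exact Abel summation, from 1/m - 1/(m+1) = 1/(m (m+1)). The boundary term has
  denominator N + 1 because the weighted sum includes m = N.\<close>

lemma psum_divide_nat:
  "psum (\<lambda>m. a m / real m) x =
    psum a x / (real (nat \<lfloor>x\<rfloor>) + 1) + psum (\<lambda>m. psum a (real m) / (real m * (real m + 1))) x"
proof -
  have "(\<Sum>m\<in>{1..N}. a m / real m) =
      (\<Sum>m\<in>{1..N}. a m) / (real N + 1) + (\<Sum>m\<in>{1..N}. (\<Sum>i\<in>{1..m}. a i) / (real m * (real m + 1)))" for N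
  proof (induction N)
    case (Suc N)
    define s where "s = (\<Sum>m\<in>{1..N}. a m)"
    have "X / (n + 2) + X / ((n + 1) * (n + 2)) = X / (n + 1)" if "n \<ge> 0" for X n :: real
      using that by (simp add: divide_simps) (simp add: algebra_simps)
    from this[of "real N" "s + a (Suc N)"] have
      "(s + a (Suc N)) / (real N + 2) + (s + a (Suc N)) / ((real N + 1) * (real N + 2)) =
        s / (real N + 1) + a (Suc N) / (real N + 1)"
      by (simp add: add_divide_distrib)
    then show ?case using Suc by (simp add: s_def add.commute add.assoc)
  qed simp
  then show ?thesis by (simp add: psum_def)
qed

text \<open>After Abel summation the terms are close to M(ln m) / m, where M is the polynomial
  belonging to the averages of \<open>a\<close>. Harmonic sums with logarithms then raise the degree
  by one, and what remains is a convergent series.\<close>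

lemma log_poly_asymp_psum_divide_nat:
  assumes F: "log_poly_asymp k \<eta> (\<lambda>x. psum a x / x)" and \<eta>: "0 < \<eta>" "\<eta> \<le> 1"
  shows "log_poly_asymp (k + 1) \<eta> (psum (\<lambda>m. a m / real m))"
proof -
  from F obtain c where
    c: "\<And>\<delta>. \<delta> > 0 \<Longrightarrow> powr_bounded (\<lambda>x. psum a x / x - (\<Sum>i<k. c i * ln x ^ i)) (- \<eta> + \<delta>)"
    unfolding log_poly_asymp_def by blast
  have bd: "\<exists>K\<ge>0. \<forall>x\<ge>1. \<bar>psum a x / x\<bar> \<le> K * x powr \<delta>" if "\<delta> > 0" for \<delta>
    using log_poly_asymp_bound[OF F _ that] \<eta> by simp
  \<comment> \<open>\<open>v\<close> combines the error of the hypothesis at m with the cost of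
    writing 1/m^2 for 1/(m (m+1)); both are O(m^(-1-\<eta>+\<delta>)), the second because
    \<open>\<eta> \<le> 1\<close>.\<close>
  define v where "v m = psum a (real m) / (real m * (real m + 1)) - (\<Sum>i<k. c i * (ln (real m) ^ i / real m))" for m
  have 1: "log_poly_asymp 1 \<eta> (psum v)"
  proof (rule log_poly_asymp_psum_summable)
    fix \<delta> :: real assume d: "\<delta> > 0"
    from c[OF d] obtain K where
      K: "\<And>x. x\<ge>1 \<Longrightarrow> \<bar>psum a x / x - (\<Sum>i<k. c i * ln x ^ i)\<bar> \<le> K * x powr (- \<eta> + \<delta>)" by blast
    from bd[OF d] obtain L where L: "L \<ge> 0" "\<And>x. x\<ge>1 \<Longrightarrow> \<bar>psum a x / x\<bar> \<le> L * x powr \<delta>" by blast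
    have "\<bar>v m\<bar> \<le> (K + L) * real m powr (-1 - \<eta> + \<delta>)" if "m \<ge> 1" for m
    proof -
      define t where "t = real m"
      have t: "t \<ge> 1" using that by (simp add: t_def)
      define A where "A = psum a t / t"
      have "psum a t / (t * (t + 1)) = A / t - A / (t * (t + 1))"
        using t unfolding A_def by (simp add: divide_simps)
           (simp add: algebra_simps)
      then have "v m = (A - (\<Sum>i<k. c i * ln t ^ i)) / t - A / (t * (t + 1))"
        unfolding v_def t_def[symmetric] by (simp add: sum_divide_distrib diff_divide_distrib)
      then have "\<bar>v m\<bar> \<le> \<bar>A - (\<Sum>i<k. c i * ln t ^ i)\<bar> / t + \<bar>A\<bar> / (t * (t + 1))"
        using t by (simp add: abs_triangle_ineq4[THEN order_trans] abs_divide abs_mult)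
      also have "\<bar>A - (\<Sum>i<k. c i * ln t ^ i)\<bar> / t \<le> (K * t powr (- \<eta> + \<delta>)) / t"
        using K[OF t] t unfolding A_def by (intro divide_right_mono) auto
      also have "\<bar>A\<bar> / (t * (t + 1)) \<le> (L * t powr \<delta>) / (t * t)"
        using L(2)[OF t] L(1) t unfolding A_def by (intro frac_le mult_left_mono) auto
      also have "(K * t powr (- \<eta> + \<delta>)) / t = K * t powr (-1 - \<eta> + \<delta>)"
      proof -
        have "t powr (-1 - \<eta> + \<delta>) = t powr ((- \<eta> + \<delta>) - 1)" by (rule arg_cong[of _ _ "\<lambda>s. t powr s"]) simp
        also have "\<dots> = t powr (- \<eta> + \<delta>) / t" using t by (subst powr_diff) simp
        finally show ?thesis by simp
      qed
      also have "(L * t powr \<delta>) / (t * t) = L * t powr (\<delta> - 2)"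
        using t by (simp add: powr_diff power2_eq_square)
      also have "\<dots> \<le> L * t powr (-1 - \<eta> + \<delta>)" using \<eta> t L(1) by (intro mult_left_mono powr_mono) auto
      finally show ?thesis by (simp add: distrib_right t_def)
    qed
    then show "\<exists>K. \<forall>m\<ge>1. \<bar>v m\<bar> \<le> K * real m powr (-1 - \<eta> + \<delta>)" by blast
  qed fact
  have 2: "log_poly_asymp (k + 1) \<eta> (\<lambda>x. \<Sum>i<k. c i * psum (\<lambda>m. ln (real m) ^ i / real m) x)"
    by (intro log_poly_asymp_sum log_poly_asymp_cmult log_poly_asymp_mono[OF log_poly_asymp_harmonic])
       (use \<eta> in auto)
  have 3: "log_poly_asymp (k + 1) \<eta> (\<lambda>x. psum a x / (real (nat \<lfloor>x\<rfloor>) + 1) - psum a x / x)"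
  proof (rule log_poly_asymp_small)
    fix \<delta> :: real assume d: "\<delta> > 0"
    from bd[OF d] obtain L where L: "L \<ge> 0" "\<And>x. x\<ge>1 \<Longrightarrow> \<bar>psum a x / x\<bar> \<le> L * x powr \<delta>" by blast
    have "\<bar>psum a x / (real (nat \<lfloor>x\<rfloor>) + 1) - psum a x / x\<bar> \<le> L * x powr (-\<eta> + \<delta>)" if x: "x \<ge> 1" for x
    proof -
      define N where "N = real (nat \<lfloor>x\<rfloor>)"
      have N: "N \<ge> 1" "N \<le> x" "x < N + 1" using nat_floor_bounds[OF x] by (auto simp: N_def)
      have "psum a x / (N + 1) - psum a x / x = (psum a x / x) * ((x - (N + 1)) / (N + 1))"
        using N x by (simp add: divide_simps) (simp add: algebra_simps)
      then have "\<bar>psum a x / (N + 1) - psum a x / x\<bar> = \<bar>psum a x / x\<bar> * ((N + 1 - x) / (N + 1))"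
        using N by (simp add: abs_mult abs_divide)
      also have "\<dots> \<le> (L * x powr \<delta>) * (1 / x)"
      proof (rule mult_mono)
        show "(N + 1 - x) / (N + 1) \<le> 1 / x" using N x by (intro frac_le) linarith+
        show "0 \<le> L * x powr \<delta>" using L(1) by simp
        show "0 \<le> (N + 1 - x) / (N + 1)" using N by simp
      qed (rule L(2)[OF x])
      also have "\<dots> = L * x powr (\<delta> - 1)" using x by (simp add: powr_diff)
      also have "\<dots> \<le> L * x powr (-\<eta> + \<delta>)" using \<eta> x L(1) by (intro mult_left_mono powr_mono) auto
      finally show ?thesis unfolding N_def .
    qed
    then show "powr_bounded (\<lambda>x. psum a x / (real (nat \<lfloor>x\<rfloor>) + 1) - psum a x / x) (-\<eta> + \<delta>)" by blast
  qed
  have 4: "log_poly_asymp (k + 1) \<eta> (\<lambda>x. psum a x / x)" by (rule log_poly_asymp_mono[OF F]) auto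
  have 5: "log_poly_asymp (k + 1) \<eta> (psum v)" by (rule log_poly_asymp_mono[OF 1]) auto
  show ?thesis
  proof (rule log_poly_asymp_cong[OF log_poly_asymp_add[OF log_poly_asymp_add[OF 5 2] log_poly_asymp_add[OF 3 4]]])
    fix x :: real
    have "psum v x + (\<Sum>i<k. c i * psum (\<lambda>m. ln (real m) ^ i / real m) x) =
        psum (\<lambda>m. psum a (real m) / (real m * (real m + 1))) x"
      unfolding psum_def sum_distrib_left
      by (subst sum.swap) (simp add: v_def psum_def sum_subtractf)
    then show "psum v x + (\<Sum>i<k. c i * psum (\<lambda>m. ln (real m) ^ i / real m) x) +
         (psum a x / (real (nat \<lfloor>x\<rfloor>) + 1) - psum a x / x + psum a x / x) =
         psum (\<lambda>m. a m / real m) x"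
      by (simp add: psum_divide_nat)
  qed
qed

text \<open>At n = 0 every number is a divisor, so the sum over an infinite set yields 0. Identities
  for convolutions are therefore stated for n > 0, and \<open>psum\<close> starts at 1.\<close>

definition dconv :: "(nat \<Rightarrow> real) \<Rightarrow> (nat \<Rightarrow> real) \<Rightarrow> nat \<Rightarrow> real" where
  "dconv a b n = (\<Sum>d | d dvd n. a d * b (n div d))"

lemma psum_dconv:
  "psum (dconv a b) x = (\<Sum>d\<in>{1..nat \<lfloor>x\<rfloor>}. a d * psum b (x / real d))"
proof -
  have "psum (dconv a b) x = (\<Sum>(n, d)\<in>Sigma {1..nat \<lfloor>x\<rfloor>} (\<lambda>n. {d. d dvd n}). a d * b (n div d))"
    unfolding psum_def dconv_def by (rule sum.Sigma) auto
  also have "\<dots> = (\<Sum>(d, e)\<in>Sigma {1..nat \<lfloor>x\<rfloor>} (\<lambda>d. {1..nat \<lfloor>x / real d\<rfloor>}). a d * b e)"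
  proof (rule sum.reindex_bij_witness[of _ "\<lambda>(d, e). (d * e, d)" "\<lambda>(n, d). (d, n div d)"])
    fix s assume "s \<in> Sigma {1..nat \<lfloor>x\<rfloor>} (\<lambda>n. {d. d dvd n})"
    then obtain n d where s: "s = (n, d)" "n \<in> {1..nat \<lfloor>x\<rfloor>}" "d dvd n" by auto
    then obtain e where e: "n = d * e" by auto
    have n: "1 \<le> d * e" "real (d * e) \<le> x" using s(2) e unfolding mem_nat_floor_iff by auto
    then have de: "1 \<le> d" "1 \<le> e" by (auto simp: Suc_le_eq)
    then have "real d * 1 \<le> real d * real e" by (intro mult_left_mono) auto
    then have "real d \<le> x" using n(2) unfolding of_nat_mult by linarith
    moreover have "real e \<le> x / real d" using n de by (simp add: field_simps)
    ultimately show "(case s of (n, d) \<Rightarrow> (d, n div d)) \<in> Sigma {1..nat \<lfloor>x\<rfloor>} (\<lambda>d. {1..nat \<lfloor>x / real d\<rfloor>})"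
      using s(1) e de by (simp add: mem_nat_floor_iff del: One_nat_def atLeastAtMost_iff)
    show "(case case s of (n, d) \<Rightarrow> (d, n div d) of (d, e) \<Rightarrow> (d * e, d)) = s"
      using s e by simp
    show "(case case s of (n, d) \<Rightarrow> (d, n div d) of (d, e) \<Rightarrow> a d * b e) = (case s of (n, d) \<Rightarrow> a d * b (n div d))"
      using s by simp
  next
    fix t assume "t \<in> Sigma {1..nat \<lfloor>x\<rfloor>} (\<lambda>d. {1..nat \<lfloor>x / real d\<rfloor>})"
    then obtain d e where t: "t = (d, e)" "d \<in> {1..nat \<lfloor>x\<rfloor>}" "e \<in> {1..nat \<lfloor>x / real d\<rfloor>}" by auto
    then have de: "1 \<le> d" "1 \<le> e" "real e \<le> x / real d" unfolding mem_nat_floor_iff by auto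
    then have "real (d * e) \<le> x" "1 \<le> d * e" by (auto simp: field_simps)
    then show "(case t of (d, e) \<Rightarrow> (d * e, d)) \<in> Sigma {1..nat \<lfloor>x\<rfloor>} (\<lambda>n. {d. d dvd n})"
      using t(1) by (simp add: mem_nat_floor_iff del: One_nat_def atLeastAtMost_iff of_nat_mult)
    show "(case case t of (d, e) \<Rightarrow> (d * e, d) of (n, d) \<Rightarrow> (d, n div d)) = t"
      using t(1) de by simp
  qed
  also have "\<dots> = (\<Sum>d\<in>{1..nat \<lfloor>x\<rfloor>}. \<Sum>e\<in>{1..nat \<lfloor>x / real d\<rfloor>}. a d * b e)"
    by (rule sum.Sigma[symmetric]) auto
  finally show ?thesis by (simp add: psum_def sum_distrib_left)
qed

text \<open>On Dirichlet series this is multiplication by the zeta function.\<close>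

abbreviation dsum :: "(nat \<Rightarrow> real) \<Rightarrow> nat \<Rightarrow> real" where
  "dsum a \<equiv> dconv a (\<lambda>_. 1)"

lemma psum_one: "psum (\<lambda>_. 1) x = real (nat \<lfloor>x\<rfloor>)"
  by (simp add: psum_def)

lemma psum_floor_error_le:
  assumes "x \<ge> 0"
  shows "\<bar>psum (\<lambda>d. a d * (real (nat \<lfloor>x / real d\<rfloor>) - x / real d)) y\<bar> \<le> psum (\<lambda>n. \<bar>a n\<bar>) y"
  unfolding psum_def
proof (intro order_trans[OF sum_abs] sum_mono)
  fix d assume "d \<in> {1..nat \<lfloor>y\<rfloor>}"
  have "x / real d \<ge> 0" using assms by simp
  then have "\<bar>real (nat \<lfloor>x / real d\<rfloor>) - x / real d\<bar> \<le> 1" by linarith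
  then show "\<bar>a d * (real (nat \<lfloor>x / real d\<rfloor>) - x / real d)\<bar> \<le> \<bar>a d\<bar>"
    unfolding abs_mult by (intro mult_left_le) auto
qed

text \<open>The sum runs over pairs with d e <= x. Pairs with d <= y are grouped by d; those with d
  > y have e <= x / y and are grouped by e, where d ranges over y < d <= x / e. The subtracted term
  removes the part d <= y from each of these groups.\<close>

lemma psum_hyperbola:
  assumes "1 \<le> y" "y \<le> x"
  shows "psum (dsum a) x = psum (\<lambda>d. a d * real (nat \<lfloor>x / real d\<rfloor>)) y
    + (\<Sum>e\<in>{1..nat \<lfloor>x / y\<rfloor>}. psum a (x / real e)) - real (nat \<lfloor>x / y\<rfloor>) * psum a y"
proof -
  define f where "f d = a d * real (nat \<lfloor>x / real d\<rfloor>)" for d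
  have split: "psum b u = psum b y + sum b ({1..nat \<lfloor>u\<rfloor>} - {1..nat \<lfloor>y\<rfloor>})" if "y \<le> u" for u b
  proof -
    have "{1..nat \<lfloor>y\<rfloor>} \<subseteq> {1..nat \<lfloor>u\<rfloor>}" using that by (auto intro: nat_mono floor_mono order_trans)
    from sum.subset_diff[OF this, of b] show ?thesis by (simp add: psum_def add.commute)
  qed
  have "sum f ({1..nat \<lfloor>x\<rfloor>} - {1..nat \<lfloor>y\<rfloor>}) =
      (\<Sum>d\<in>{1..nat \<lfloor>x\<rfloor>} - {1..nat \<lfloor>y\<rfloor>}. \<Sum>e\<in>{1..nat \<lfloor>x / real d\<rfloor>}. a d)"
    by (simp add: f_def mult.commute)
  also have "\<dots> = (\<Sum>(d, e)\<in>Sigma ({1..nat \<lfloor>x\<rfloor>} - {1..nat \<lfloor>y\<rfloor>}) (\<lambda>d. {1..nat \<lfloor>x / real d\<rfloor>}). a d)"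
    by (rule sum.Sigma) auto
  also have "\<dots> = (\<Sum>(e, d)\<in>Sigma {1..nat \<lfloor>x / y\<rfloor>} (\<lambda>e. {1..nat \<lfloor>x / real e\<rfloor>} - {1..nat \<lfloor>y\<rfloor>}). a d)"
  proof (rule sum.reindex_bij_witness[of _ prod.swap prod.swap])
    fix s assume "s \<in> Sigma ({1..nat \<lfloor>x\<rfloor>} - {1..nat \<lfloor>y\<rfloor>}) (\<lambda>d. {1..nat \<lfloor>x / real d\<rfloor>})"
    then obtain d e where s: "s = (d, e)" and de: "1 \<le> d" "1 \<le> e" "real e \<le> x / real d" "real d > y"
      by (cases s) (simp add: mem_nat_floor_iff del: One_nat_def atLeastAtMost_iff, auto)
    have 1: "real d \<le> x / real e" using de by (simp add: field_simps)
    have "real e * y \<le> real e * real d" using de by (intro mult_left_mono) auto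
    also have "\<dots> \<le> x" using de by (simp add: field_simps)
    finally have 2: "real e \<le> x / y" using assms by (simp add: pos_le_divide_eq)
    show "prod.swap s \<in> Sigma {1..nat \<lfloor>x / y\<rfloor>} (\<lambda>e. {1..nat \<lfloor>x / real e\<rfloor>} - {1..nat \<lfloor>y\<rfloor>})"
      using 1 2 de s by (simp add: mem_nat_floor_iff del: One_nat_def atLeastAtMost_iff)
  next
    fix s assume "s \<in> Sigma {1..nat \<lfloor>x / y\<rfloor>} (\<lambda>e. {1..nat \<lfloor>x / real e\<rfloor>} - {1..nat \<lfloor>y\<rfloor>})"
    then obtain d e where s: "s = (e, d)" and de: "1 \<le> d" "1 \<le> e" "real d \<le> x / real e" "real d > y"
      by (cases s) (simp add: mem_nat_floor_iff del: One_nat_def atLeastAtMost_iff, auto)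
    have 1: "real e \<le> x / real d" using de by (simp add: field_simps)
    have "x / real e \<le> x / 1" using de assms by (intro divide_left_mono) auto
    then have 2: "real d \<le> x" using de by simp
    show "prod.swap s \<in> Sigma ({1..nat \<lfloor>x\<rfloor>} - {1..nat \<lfloor>y\<rfloor>}) (\<lambda>d. {1..nat \<lfloor>x / real d\<rfloor>})"
      using 1 2 de s by (simp add: mem_nat_floor_iff del: One_nat_def atLeastAtMost_iff)
  qed auto
  also have "\<dots> = (\<Sum>e\<in>{1..nat \<lfloor>x / y\<rfloor>}. sum a ({1..nat \<lfloor>x / real e\<rfloor>} - {1..nat \<lfloor>y\<rfloor>}))"
    by (rule sum.Sigma[symmetric]) auto
  also have "\<dots> = (\<Sum>e\<in>{1..nat \<lfloor>x / y\<rfloor>}. psum a (x / real e) - psum a y)"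
  proof (rule sum.cong[OF refl])
    fix e assume "e \<in> {1..nat \<lfloor>x / y\<rfloor>}"
    then have "1 \<le> e" "real e \<le> x / y" unfolding mem_nat_floor_iff by auto
    then have "y \<le> x / real e" using assms by (simp add: field_simps)
    from split[OF this, of a]
    show "sum a ({1..nat \<lfloor>x / real e\<rfloor>} - {1..nat \<lfloor>y\<rfloor>}) = psum a (x / real e) - psum a y" by simp
  qed
  finally have "sum f ({1..nat \<lfloor>x\<rfloor>} - {1..nat \<lfloor>y\<rfloor>}) =
      (\<Sum>e\<in>{1..nat \<lfloor>x / y\<rfloor>}. psum a (x / real e)) - real (nat \<lfloor>x / y\<rfloor>) * psum a y"
    by (simp add: sum_subtractf)
  moreover have "psum (dsum a) x = psum f x"
    unfolding psum_dconv psum_one f_def[abs_def] unfolding psum_def ..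
  ultimately show ?thesis using split[OF assms(2), of f] by (simp add: f_def[abs_def])
qed

text \<open>Comparison with the integral of t powr (s - 1), carried out through mean value
  increments of t powr s / s.\<close>

lemma sum_powr_minus_one_le:
  assumes "0 < s" "s \<le> 1" "x \<ge> 1"
  shows "psum (\<lambda>e. real e powr (s - 1)) x \<le> x powr s / s"
proof -
  have "(\<Sum>e\<in>{1..N}. real e powr (s - 1)) \<le> real N powr s / s" if "N \<ge> 1" for N
    using that
  proof (induction N rule: dec_induct)
    case base
    then show ?case using assms by simp
  next
    case (step N)
    have "\<exists>z>real N. z < real (Suc N) \<and>
        real (Suc N) powr s - real N powr s = (real (Suc N) - real N) * (s * z powr (s - 1))"
      using assms step by (intro MVT2) (auto intro!: derivative_eq_intros)
    then obtain z where z: "z > real N" "z < real (Suc N)"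
      "real (Suc N) powr s - real N powr s = s * z powr (s - 1)" by auto
    have "real (Suc N) powr (s - 1) \<le> z powr (s - 1)" using z assms step by (intro powr_mono2') auto
    then have "s * real (Suc N) powr (s - 1) \<le> real (Suc N) powr s - real N powr s"
      using z assms by simp
    then have "real (Suc N) powr (s - 1) \<le> (real (Suc N) powr s - real N powr s) / s"
      using assms by (simp add: pos_le_divide_eq mult.commute)
    then show ?case using step.IH by (simp add: diff_divide_distrib)
  qed
  from this[OF nat_floor_bounds(1)[OF assms(3)]]
  have "psum (\<lambda>e. real e powr (s - 1)) x \<le> real (nat \<lfloor>x\<rfloor>) powr s / s" by (simp add: psum_def)
  also have "\<dots> \<le> x powr s / s"
    using assms nat_floor_bounds[OF assms(3)] by (intro divide_right_mono powr_mono2) auto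
  finally show ?thesis .
qed

text \<open>Dirichlet's hyperbola method with cut-off \<open>y = x powr \<alpha>\<close>: since \<open>ln y\<close> and \<open>ln (x / y)\<close> are
  multiples of \<open>ln x\<close>, all main terms are polynomials in \<open>ln x\<close> without further computation. The choice
  of \<open>\<alpha>\<close> balances the errors from the two ranges.\<close>

lemma log_poly_asymp_psum_dsum:
  assumes F: "log_poly_asymp k \<eta> (\<lambda>x. psum a x / x)" and \<eta>: "0 < \<eta>" "\<eta> \<le> 1"
    and abs: "\<And>\<delta>. \<delta> > 0 \<Longrightarrow> \<exists>K. \<forall>x\<ge>1. psum (\<lambda>n. \<bar>a n\<bar>) x \<le> K * x powr (1 + \<delta>)"
  shows "log_poly_asymp (k + 1) (\<eta> / (1 + \<eta>)) (\<lambda>x. psum (dsum a) x / x)"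
proof -
  \<comment> \<open>Relative to x, the range d <= Y costs about Y / x = x^(\<alpha>-1), and the
    range e <= Z = x / Y costs about x^(-\<eta>) Z^\<eta> = x^(-\<alpha>\<eta>). They agree when 1 -
    \<alpha> = \<alpha>\<eta>, and the common saving is \<open>\<eta>'\<close>.\<close>
  define \<alpha> where "\<alpha> = 1 / (1 + \<eta>)"
  define \<eta>' where "\<eta>' = \<eta> / (1 + \<eta>)"
  have \<alpha>: "0 < \<alpha>" "\<alpha> < 1" "1 - \<alpha> = \<eta>'" "\<alpha> * \<eta> = \<eta>'" using \<eta> by (auto simp: \<alpha>_def \<eta>'_def field_simps)
  have \<eta>': "0 < \<eta>'" "\<eta>' \<le> \<eta>" "\<eta>' \<le> 1" "\<alpha> = 1 - \<eta>'"
  proof -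
    show "0 < \<eta>'" using \<eta> by (simp add: \<eta>'_def)
    have "\<eta> / (1 + \<eta>) \<le> \<eta> / 1" using \<eta> by (intro divide_left_mono) auto
    then show "\<eta>' \<le> \<eta>" by (simp add: \<eta>'_def)
    then show "\<eta>' \<le> 1" using \<eta> by simp
    show "\<alpha> = 1 - \<eta>'" using \<alpha>(3) by simp
  qed
  from F obtain c where
    c: "\<And>\<delta>. \<delta> > 0 \<Longrightarrow> powr_bounded (\<lambda>x. psum a x / x - (\<Sum>i<k. c i * ln x ^ i)) (- \<eta> + \<delta>)"
    unfolding log_poly_asymp_def by blast
  define M where "M x = (\<Sum>i<k. c i * ln x ^ i)" for x :: real
  define H where "H j = psum (\<lambda>m. ln (real m) ^ j / real m)" for j
  define Y where "Y x = x powr \<alpha>" for x :: real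
  define Z where "Z x = x powr \<eta>'" for x :: real
  have YZ: "Y x \<ge> 1" "Z x \<ge> 1" "Y x * Z x = x" "x / Y x = Z x" "Y x \<le> x" if "x \<ge> 1" for x
  proof -
    show 1: "Y x \<ge> 1" "Z x \<ge> 1" using that \<alpha> \<eta>' by (auto simp: Y_def Z_def ge_one_powr_ge_zero)
    show 2: "Y x * Z x = x" using that \<eta>'(4) by (simp add: Y_def Z_def powr_add[symmetric])
    show "x / Y x = Z x" using 1 2 by (simp add: field_simps)
    have "Y x * 1 \<le> Y x * Z x" using 1 by (intro mult_left_mono) auto
    then show "Y x \<le> x" by (simp add: 2)
  qed

  have L: "log_poly_asymp (k + 1) \<eta>' (\<lambda>x. psum (\<lambda>m. a m / real m) (Y x))"
    using log_poly_asymp_compose_powr[OF log_poly_asymp_psum_divide_nat[OF F \<eta>] \<alpha>(1)]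
    by (simp add: \<alpha> Y_def)
  have FY: "log_poly_asymp (k + 1) \<eta>' (\<lambda>x. psum a (Y x) / Y x)"
    using log_poly_asymp_mono[OF log_poly_asymp_compose_powr[OF F \<alpha>(1)], of "k + 1" \<eta>']
    by (simp add: \<alpha> Y_def)
  have HZ: "log_poly_asymp (j + 2) \<eta>' (\<lambda>x. H j (Z x))" for j
    using log_poly_asymp_compose_powr[OF log_poly_asymp_harmonic \<eta>'(1)] by (simp add: H_def Z_def)
  \<comment> \<open>The main term M(x / e) / e of the second range, summed over e <= Z: the binomial
    theorem for (ln x - ln e)^i separates x from e and leaves the harmonic sums \<open>H j\<close>.
    The degree stays in bounds since (i - j) + (j + 2) <= k + 1 for i < k.\<close>
  have MZ: "log_poly_asymp (k + 1) \<eta>' (\<lambda>x. \<Sum>i<k. \<Sum>j\<le>i. (c i * (real (i choose j) * (-1) ^ j)) * (ln x ^ (i - j) * H j (Z x)))"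
  proof (intro log_poly_asymp_sum log_poly_asymp_cmult)
    fix i j assume "i \<in> {..<k}" "j \<in> {..i}"
    then show "log_poly_asymp (k + 1) \<eta>' (\<lambda>x. ln x ^ (i - j) * H j (Z x))"
      by (intro log_poly_asymp_mono[OF log_poly_asymp_mult_ln_power[OF HZ]]) auto
  qed
  have MZ_eq: "(\<Sum>i<k. \<Sum>j\<le>i. (c i * (real (i choose j) * (-1) ^ j)) * (ln x ^ (i - j) * H j (Z x)))
      = psum (\<lambda>e. M (x / real e) / real e) (Z x)" if x: "x \<ge> 1" for x
  proof -
    have "M (x / real e) / real e =
        (\<Sum>i<k. \<Sum>j\<le>i. (c i * (real (i choose j) * (-1) ^ j)) * (ln x ^ (i - j) * (ln (real e) ^ j / real e)))"
      if "e \<ge> 1" for e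
    proof -
      have "ln (x / real e) = - ln (real e) + ln x" using that x by (simp add: ln_div)
      then have "ln (x / real e) ^ i = (\<Sum>j\<le>i. real (i choose j) * (-1) ^ j * ln (real e) ^ j * ln x ^ (i - j))" for i
        by (simp only: binomial_ring power_minus[of "ln (real e)"] mult.assoc)
      then show ?thesis unfolding M_def
        by (simp add: sum_divide_distrib sum_distrib_left mult_ac)
    qed
    then have "psum (\<lambda>e. M (x / real e) / real e) (Z x) = psum (\<lambda>e.
        (\<Sum>i<k. \<Sum>j\<le>i. (c i * (real (i choose j) * (-1) ^ j)) * (ln x ^ (i - j) * (ln (real e) ^ j / real e)))) (Z x)"
      unfolding psum_def by (intro sum.cong) auto
    also have "\<dots> = (\<Sum>i<k. \<Sum>j\<le>i. (c i * (real (i choose j) * (-1) ^ j)) * (ln x ^ (i - j) * H j (Z x)))"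
      unfolding psum_def H_def
      by (subst sum.swap, rule sum.cong[OF refl], subst sum.swap, rule sum.cong[OF refl])
         (simp add: sum_distrib_left)
    finally show ?thesis by simp
  qed

  \<comment> \<open>Cost of dropping the integer part of x / d in the first range.\<close>
  define R1 where "R1 x = psum (\<lambda>d. a d * (real (nat \<lfloor>x / real d\<rfloor>) - x / real d)) (Y x) / x" for x
  have R1: "log_poly_asymp (k + 1) \<eta>' R1"
  proof (rule log_poly_asymp_small)
    fix \<delta> :: real assume d: "\<delta> > 0"
    from abs[OF this] obtain K where K: "\<And>x. x \<ge> 1 \<Longrightarrow> psum (\<lambda>n. \<bar>a n\<bar>) x \<le> K * x powr (1 + \<delta>)" by blast
    have K0: "0 \<le> K" using K[of 1] by (simp add: psum_def)
    have "\<bar>R1 x\<bar> \<le> K * x powr (- \<eta>' + \<delta>)" if x: "x \<ge> 1" for x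
    proof -
      have "\<bar>psum (\<lambda>d. a d * (real (nat \<lfloor>x / real d\<rfloor>) - x / real d)) (Y x)\<bar> \<le> psum (\<lambda>n. \<bar>a n\<bar>) (Y x)"
        using x by (intro psum_floor_error_le) simp
      also have "\<dots> \<le> K * Y x powr (1 + \<delta>)" by (rule K[OF YZ(1)[OF x]])
      finally have "\<bar>R1 x\<bar> \<le> K * Y x powr (1 + \<delta>) / x"
        unfolding R1_def abs_divide using x by (simp add: divide_right_mono)
      also have "\<dots> = K * x powr (\<alpha> * (1 + \<delta>) - 1)"
        using x by (simp add: Y_def powr_powr powr_diff)
      also have "\<dots> \<le> K * x powr (- \<eta>' + \<delta>)"
      proof (intro mult_left_mono powr_mono)
        have "\<alpha> * \<delta> \<le> 1 * \<delta>" using \<alpha> d by (intro mult_right_mono) auto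
        then show "\<alpha> * (1 + \<delta>) - 1 \<le> - \<eta>' + \<delta>" using \<eta>'(4) by (simp add: distrib_left)
      qed (use x K0 in auto)
      finally show ?thesis .
    qed
    then show "powr_bounded R1 (- \<eta>' + \<delta>)" by blast
  qed

  \<comment> \<open>Cost of replacing the average of \<open>a\<close> at x / e by its main term in
    the second range.\<close>
  define R2 where "R2 x = psum (\<lambda>e. (psum a (x / real e) / (x / real e) - M (x / real e)) / real e) (Z x)" for x
  have R2: "log_poly_asymp (k + 1) \<eta>' R2"
  proof (rule log_poly_asympI[of \<eta>' _ "\<lambda>_. 0"])
    fix \<delta> :: real assume d: "\<delta> > 0" "\<delta> < \<eta>'"
    from c[OF d(1)] obtain K where
      K: "\<And>x. x\<ge>1 \<Longrightarrow> \<bar>psum a x / x - M x\<bar> \<le> K * x powr (- \<eta> + \<delta>)" unfolding M_def by blast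
    have K0: "0 \<le> K" using K[of 1] abs_ge_zero order_trans by fastforce
    define s where "s = \<eta> - \<delta>"
    have s: "0 < s" "s \<le> 1" using d \<eta> \<eta>' by (auto simp: s_def)
    have "\<bar>R2 x\<bar> \<le> (K / s) * x powr (- \<eta>' + \<delta>)" if x: "x \<ge> 1" for x
    proof -
      have "\<bar>R2 x\<bar> \<le> psum (\<lambda>e. (K * x powr (-s)) * real e powr (s - 1)) (Z x)"
        unfolding R2_def psum_def
      proof (intro order_trans[OF sum_abs] sum_mono)
        fix e assume "e \<in> {1..nat \<lfloor>Z x\<rfloor>}"
        then have e: "1 \<le> e" "real e \<le> Z x" unfolding mem_nat_floor_iff by auto
        have "1 * real e \<le> Y x * Z x" using e YZ[OF x] by (intro mult_mono) auto
        then have "1 \<le> x / real e" using e YZ(3)[OF x] by (simp add: field_simps)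
        from K[OF this] have "\<bar>psum a (x / real e) / (x / real e) - M (x / real e)\<bar> / real e
            \<le> (K * (x / real e) powr (-s)) / real e"
          by (intro divide_right_mono) (auto simp: s_def)
        also have "\<dots> = (K * x powr (-s)) * real e powr (s - 1)"
          using e x by (simp add: powr_divide powr_minus powr_diff field_simps)
        finally show "\<bar>((\<Sum>n\<in>{1..nat \<lfloor>x / real e\<rfloor>}. a n) / (x / real e) - M (x / real e)) / real e\<bar>
            \<le> K * x powr - s * real e powr (s - 1)"
          unfolding psum_def abs_divide by simp
      qed
      also have "\<dots> = (K * x powr (-s)) * psum (\<lambda>e. real e powr (s - 1)) (Z x)"
        by (simp add: psum_def sum_distrib_left)
      also have "\<dots> \<le> (K * x powr (-s)) * (Z x powr s / s)"
        using K0 s YZ(2)[OF x] by (intro mult_left_mono sum_powr_minus_one_le) auto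
      also have "\<dots> = (K / s) * (x powr (-s) * Z x powr s)" by simp
      also have "x powr (-s) * Z x powr s = x powr (- (\<alpha> * s))"
      proof -
        have "- (\<alpha> * s) = \<eta>' * s - s" unfolding \<eta>'(4) by (simp add: algebra_simps)
        then show ?thesis using x by (simp add: Z_def powr_powr powr_add[symmetric])
      qed
      also have "(K / s) * x powr (- (\<alpha> * s)) \<le> (K / s) * x powr (- \<eta>' + \<delta>)"
      proof (intro mult_left_mono powr_mono)
        have "\<alpha> * \<delta> \<le> 1 * \<delta>" using \<alpha> d by (intro mult_right_mono) auto
        then show "- (\<alpha> * s) \<le> - \<eta>' + \<delta>" using \<alpha>(4) by (simp add: s_def right_diff_distrib)
      qed (use x K0 s in auto)
      finally show ?thesis .
    qed
    then show "powr_bounded (\<lambda>x. R2 x - (\<Sum>i<k+1. 0 * ln x ^ i)) (- \<eta>' + \<delta>)"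
      by (intro exI[of _ "K / s"]) simp
  qed (rule \<eta>')

  \<comment> \<open>Cost of dropping the integer part of Z in the subtracted term.\<close>
  define R3 where "R3 x = (psum a (Y x) / Y x) * ((Z x - real (nat \<lfloor>Z x\<rfloor>)) / Z x)" for x
  have R3: "log_poly_asymp (k + 1) \<eta>' R3"
  proof (rule log_poly_asymp_small)
    fix \<delta> :: real assume d: "\<delta> > 0"
    obtain K where K: "K \<ge> 0" "\<And>x. x \<ge> 1 \<Longrightarrow> \<bar>psum a (Y x) / Y x\<bar> \<le> K * x powr \<delta>"
      using log_poly_asymp_bound[OF FY _ d] \<eta>' by auto
    have "\<bar>R3 x\<bar> \<le> K * x powr (- \<eta>' + \<delta>)" if x: "x \<ge> 1" for x
    proof -
      note z = YZ(2)[OF x]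
      have fl: "0 \<le> Z x - real (nat \<lfloor>Z x\<rfloor>)" "Z x - real (nat \<lfloor>Z x\<rfloor>) \<le> 1" using z by linarith+
      have "\<bar>R3 x\<bar> = \<bar>psum a (Y x) / Y x\<bar> * ((Z x - real (nat \<lfloor>Z x\<rfloor>)) / Z x)"
        unfolding R3_def abs_mult using fl z by simp
      also have "\<dots> \<le> (K * x powr \<delta>) * (1 / Z x)"
      proof (rule mult_mono)
        show "(Z x - real (nat \<lfloor>Z x\<rfloor>)) / Z x \<le> 1 / Z x" using fl z by (intro divide_right_mono) auto
      qed (use K(2)[OF x] K(1) fl z in auto)
      also have "\<dots> = K * x powr (\<delta> - \<eta>')" using x by (simp add: Z_def powr_diff)
      finally show ?thesis by simp
    qed
    then show "powr_bounded R3 (- \<eta>' + \<delta>)" by blast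
  qed

  have mFY: "log_poly_asymp (k + 1) \<eta>' (\<lambda>x. -1 * (psum a (Y x) / Y x))" by (rule log_poly_asymp_cmult[OF FY])
  show ?thesis unfolding \<eta>'_def[symmetric]
  proof (rule log_poly_asymp_cong[OF log_poly_asymp_add[OF log_poly_asymp_add[OF log_poly_asymp_add[OF L R1]
      log_poly_asymp_add[OF MZ R2]] log_poly_asymp_add[OF mFY R3]]])
    fix x :: real assume x: "x \<ge> 1"
    note yz = YZ[OF x]
    have T1: "psum (\<lambda>d. a d * real (nat \<lfloor>x / real d\<rfloor>)) (Y x) / x = psum (\<lambda>m. a m / real m) (Y x) + R1 x"
      unfolding R1_def psum_def using x
      by (simp add: right_diff_distrib sum_subtractf diff_divide_distrib sum_divide_distrib)
    have T2: "(\<Sum>e\<in>{1..nat \<lfloor>Z x\<rfloor>}. psum a (x / real e)) / x = psum (\<lambda>e. M (x / real e) / real e) (Z x) + R2 x"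
      unfolding R2_def psum_def[of _ "Z x"] using x
      by (simp add: diff_divide_distrib sum_subtractf sum_divide_distrib)
    have T3: "real (nat \<lfloor>Z x\<rfloor>) * psum a (Y x) / x = psum a (Y x) / Y x - R3 x"
    proof -
      have "real (nat \<lfloor>Z x\<rfloor>) * psum a (Y x) / x = (psum a (Y x) / Y x) * (real (nat \<lfloor>Z x\<rfloor>) / Z x)"
        using yz(3) by (simp add: mult.commute)
      also have "real (nat \<lfloor>Z x\<rfloor>) / Z x = 1 - (Z x - real (nat \<lfloor>Z x\<rfloor>)) / Z x"
        using yz(2) by (simp add: diff_divide_distrib)
      finally show ?thesis by (simp add: R3_def right_diff_distrib)
    qed
    have "psum (dsum a) x / x = psum (\<lambda>d. a d * real (nat \<lfloor>x / real d\<rfloor>)) (Y x) / x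
      + (\<Sum>e\<in>{1..nat \<lfloor>Z x\<rfloor>}. psum a (x / real e)) / x - real (nat \<lfloor>Z x\<rfloor>) * psum a (Y x) / x"
      unfolding psum_hyperbola[OF yz(1,5)] yz(4) by (simp add: add_divide_distrib diff_divide_distrib)
    then show "psum (\<lambda>m. a m / real m) (Y x) + R1 x +
       ((\<Sum>i<k. \<Sum>j\<le>i. (c i * (real (i choose j) * (-1) ^ j)) * (ln x ^ (i - j) * H j (Z x))) + R2 x) +
       (-1 * (psum a (Y x) / Y x) + R3 x) = psum (dsum a) x / x"
      unfolding MZ_eq[OF x] T1 T2 T3 by simp
  qed
qed

section \<open>Multiplicative functions\<close>

definition multiplicative :: "(nat \<Rightarrow> real) \<Rightarrow> bool" where
  "multiplicative h \<longleftrightarrow> h 1 = 1 \<and> (\<forall>m n. m > 0 \<longrightarrow> n > 0 \<longrightarrow> coprime m n \<longrightarrow> h (m * n) = h m * h n)"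

lemma multiplicativeD:
  assumes "multiplicative h"
  shows "h 1 = 1" "h (Suc 0) = 1" "m > 0 \<Longrightarrow> n > 0 \<Longrightarrow> coprime m n \<Longrightarrow> h (m * n) = h m * h n"
  using assms by (auto simp: multiplicative_def)

lemma prime_power_split:
  assumes "n > (1::nat)"
  obtains p k m where "prime p" "k > 0" "n = p ^ k * m" "m > 0" "coprime (p ^ k) m" "m < n"
proof -
  obtain p where p: "prime p" "p dvd n" using assms prime_factor_nat[of n] by auto
  have "n \<noteq> 0" "\<not> is_unit p" using assms p by auto
  then obtain m where m: "n = p ^ multiplicity p n * m" "\<not> p dvd m"
    by (rule multiplicity_decompose')
  have k: "multiplicity p n > 0" using p assms by (simp add: prime_multiplicity_gt_zero_iff)
  have cop: "coprime (p ^ multiplicity p n) m" using p(1) m(2) by (simp add: prime_imp_coprime)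
  have m0: "m > 0" using m assms by (cases m) auto
  have "p ^ multiplicity p n > 1" using k prime_gt_1_nat[OF p(1)] by (intro one_less_power)
  then have "1 * m < p ^ multiplicity p n * m" using m0 by (intro mult_strict_right_mono) auto
  then have "m < n" using m(1) by simp
  with that[OF p(1) k m(1) m0 cop] show thesis .
qed

lemma prime_power_induct [consumes 1, case_names one mult]:
  assumes "n > (0::nat)" "Q 1"
    and "\<And>p k m. prime p \<Longrightarrow> k > 0 \<Longrightarrow> m > 0 \<Longrightarrow> coprime (p ^ k) m \<Longrightarrow> Q m \<Longrightarrow> Q (p ^ k * m)"
  shows "Q n"
  using assms(1)
proof (induction n rule: less_induct)
  case (less n)
  show ?case
  proof (cases "n = 1")
    case False
    with less.prems have "n > 1" by simp
    then obtain p k m where "prime p" "k > 0" "n = p ^ k * m" "m > 0" "coprime (p ^ k) m" "m < n"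
      by (rule prime_power_split)
    then show ?thesis using less.IH assms(3) by blast
  qed (use assms(2) in simp)
qed

lemma multiplicative_leI:
  assumes "multiplicative f" "multiplicative g"
    and "\<And>p k. prime p \<Longrightarrow> k > 0 \<Longrightarrow> 0 \<le> f (p ^ k) \<and> f (p ^ k) \<le> g (p ^ k)" and "n > 0"
  shows "0 \<le> f n \<and> f n \<le> g n"
  using \<open>n > 0\<close>
proof (induction rule: prime_power_induct)
  case one
  then show ?case using multiplicativeD(2)[OF assms(1)] multiplicativeD(2)[OF assms(2)] by simp
next
  case (mult p k m)
  have "f (p ^ k * m) = f (p ^ k) * f m" "g (p ^ k * m) = g (p ^ k) * g m"
    using mult multiplicativeD(3)[OF assms(1)] multiplicativeD(3)[OF assms(2)] by (simp_all add: prime_gt_0_nat)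
  then show ?case using mult assms(3)[OF mult(1,2)] by (auto intro!: mult_mono)
qed

lemma multiplicative_eqI:
  assumes "multiplicative f" "multiplicative g"
    and "\<And>p k. prime p \<Longrightarrow> k > 0 \<Longrightarrow> f (p ^ k) = g (p ^ k)" and "n > 0"
  shows "f n = g n"
  using \<open>n > 0\<close>
proof (induction rule: prime_power_induct)
  case one
  then show ?case using multiplicativeD(2)[OF assms(1)] multiplicativeD(2)[OF assms(2)] by simp
next
  case (mult p k m)
  then show ?case using assms(3) multiplicativeD(3)[OF assms(1)] multiplicativeD(3)[OF assms(2)]
    by (simp add: prime_gt_0_nat)
qed

text \<open>The multiplicative function with the values \<open>u p k\<close> at the prime powers
  with k > 0.\<close>

definition mult_ext :: "(nat \<Rightarrow> nat \<Rightarrow> real) \<Rightarrow> nat \<Rightarrow> real" where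
  "mult_ext u n = (\<Prod>p\<in>prime_factors n. u p (multiplicity p n))"

lemma multiplicative_mult_ext: "multiplicative (mult_ext u)"
  unfolding multiplicative_def
proof (intro conjI allI impI)
  show "mult_ext u 1 = 1" by (simp add: mult_ext_def)
  fix m n :: nat assume mn: "m > 0" "n > 0" "coprime m n"
  have disj: "prime_factors m \<inter> prime_factors n = {}"
    using mn(3) by (meson coprime_common_divisor disjoint_iff in_prime_factors_imp_dvd
        in_prime_factors_imp_prime not_prime_unit)
  have pf: "prime_factors (m * n) = prime_factors m \<union> prime_factors n"
    using mn by (simp add: prime_factors_product)
  have 1: "multiplicity p (m * n) = multiplicity p m" if "p \<in> prime_factors m" for p
  proof -
    have "\<not> p dvd n" using that disj mn by (auto simp: prime_factors_dvd)
    then show ?thesis using that mn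
      by (subst prime_elem_multiplicity_mult_distrib) (auto simp: prime_factors_dvd not_dvd_imp_multiplicity_0)
  qed
  have 2: "multiplicity p (m * n) = multiplicity p n" if "p \<in> prime_factors n" for p
  proof -
    have "\<not> p dvd m" using that disj mn by (auto simp: prime_factors_dvd)
    then show ?thesis using that mn
      by (subst prime_elem_multiplicity_mult_distrib) (auto simp: prime_factors_dvd not_dvd_imp_multiplicity_0)
  qed
  show "mult_ext u (m * n) = mult_ext u m * mult_ext u n"
    unfolding mult_ext_def pf using disj 1 2 by (simp add: prod.union_disjoint)
qed

lemma mult_ext_prime_power:
  assumes "prime p" "k > 0"
  shows "mult_ext u (p ^ k) = u p k"
  using assms by (simp add: mult_ext_def prime_factorization_prime_power)

text \<open>A set Q larger than the set of prime factors is allowed, so that all n up to a bound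
  share one index set in the Euler product.\<close>

lemma multiplicative_prod:
  assumes "multiplicative w" "n > 0" "finite Q" "prime_factors n \<subseteq> Q" "\<And>p. p \<in> Q \<Longrightarrow> prime p"
  shows "w n = (\<Prod>p\<in>Q. w (p ^ multiplicity p n))"
proof -
  have "w n = mult_ext (\<lambda>p k. w (p ^ k)) n"
    by (rule multiplicative_eqI[OF assms(1) multiplicative_mult_ext _ assms(2)])
       (simp add: mult_ext_prime_power)
  also have "\<dots> = (\<Prod>p\<in>Q. w (p ^ multiplicity p n))"
    unfolding mult_ext_def
  proof (intro prod.mono_neutral_left assms ballI)
    fix p assume "p \<in> Q - prime_factors n"
    then have "multiplicity p n = 0"
      using assms(2,5) by (auto simp: prime_factors_dvd not_dvd_imp_multiplicity_0)
    then show "w (p ^ multiplicity p n) = 1" using multiplicativeD(2)[OF assms(1)] by simp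
  qed
  finally show ?thesis .
qed

text \<open>A divisor d of m n determines its factors, the first being gcd d m.\<close>

lemma dconv_mult_coprime_bij:
  assumes "coprime m n" "m > 0" "n > (0::nat)"
  shows "bij_betw (\<lambda>(a, b). a * b) ({a. a dvd m} \<times> {b. b dvd n}) {d. d dvd m * n}"
  unfolding bij_betw_def
proof
  have gcd: "gcd (a * b) m = a" if "a dvd m" "b dvd n" for a b
  proof -
    have "coprime b m" using that assms(1) by (meson coprime_divisors coprime_commute dvd_refl)
    then have "gcd (a * b) m = gcd a m" by (simp add: gcd_mult_right_right_cancel coprime_commute gcd.commute)
    then show ?thesis using that by (simp add: gcd_proj1_iff)
  qed
  show "inj_on (\<lambda>(a, b). a * b) ({a. a dvd m} \<times> {b. b dvd n})"
  proof (rule inj_onI, clarify)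
    fix a b a' b' assume *: "a dvd m" "b dvd n" "a' dvd m" "b' dvd n" "a * b = a' * b'"
    have "a = a'" using gcd[OF *(1,2)] gcd[OF *(3,4)] *(5) by simp
    moreover have "a > 0" using *(1) assms(2) by (auto intro: Nat.gr0I)
    ultimately show "a = a' \<and> b = b'" using *(5) by simp
  qed
  show "(\<lambda>(a, b). a * b) ` ({a. a dvd m} \<times> {b. b dvd n}) = {d. d dvd m * n}"
  proof (intro equalityI subsetI)
    fix d assume "d \<in> {d. d dvd m * n}"
    then obtain a b where "d = a * b" "a dvd m" "b dvd n" using division_decomp[of d m n] by auto
    then show "d \<in> (\<lambda>(a, b). a * b) ` ({a. a dvd m} \<times> {b. b dvd n})" by force
  qed (auto intro: mult_dvd_mono)
qed

lemma multiplicative_dconv: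
  assumes f: "multiplicative f" and g: "multiplicative g"
  shows "multiplicative (dconv f g)"
  unfolding multiplicative_def
proof (intro conjI allI impI)
  show "dconv f g 1 = 1" using multiplicativeD(2)[OF f] multiplicativeD(2)[OF g] by (simp add: dconv_def)
  fix m n :: nat assume mn: "m > 0" "n > 0" "coprime m n"
  have "dconv f g (m * n) = (\<Sum>(a, b)\<in>{a. a dvd m} \<times> {b. b dvd n}. f (a * b) * g ((m * n) div (a * b)))"
    unfolding dconv_def
    by (subst sum.reindex_bij_betw[OF dconv_mult_coprime_bij[OF mn(3,1,2)], symmetric])
       (simp add: case_prod_unfold)
  also have "\<dots> = (\<Sum>(a, b)\<in>{a. a dvd m} \<times> {b. b dvd n}. (f a * g (m div a)) * (f b * g (n div b)))"
  proof (rule sum.cong[OF refl], clarify)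
    fix a b assume ab: "a dvd m" "b dvd n"
    then have pos: "a > 0" "b > 0" "m div a > 0" "n div b > 0"
      using mn by (auto simp: div_greater_zero_iff dvd_imp_le intro: Nat.gr0I)
    have "coprime a b" using ab mn(3) by (meson coprime_divisors)
    moreover have "coprime (m div a) (n div b)"
      using ab mn by (intro coprime_divisors[OF _ _ mn(3)]) (auto elim!: dvdE)
    moreover have "(m * n) div (a * b) = (m div a) * (n div b)" using ab by (simp add: div_mult_div_if_dvd)
    ultimately show "f (a * b) * g ((m * n) div (a * b)) = (f a * g (m div a)) * (f b * g (n div b))"
      using multiplicativeD(3)[OF f] multiplicativeD(3)[OF g] pos by simp
  qed
  also have "\<dots> = dconv f g m * dconv f g n"
    unfolding dconv_def sum_product sum.cartesian_product by simp
  finally show "dconv f g (m * n) = dconv f g m * dconv f g n" .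
qed

lemma dconv_prime_power:
  assumes "prime p"
  shows "dconv f g (p ^ k) = (\<Sum>i\<le>k. f (p ^ i) * g (p ^ (k - i)))"
proof -
  have "{d. d dvd p ^ k} = (\<lambda>i. p ^ i) ` {..k}" using divides_primepow_nat[OF assms] by auto
  moreover have "inj_on (\<lambda>i. p ^ i) {..k}"
    using prime_gt_1_nat[OF assms] by (auto simp: inj_on_def power_inject_exp)
  ultimately have "dconv f g (p ^ k) = (\<Sum>i\<le>k. f (p ^ i) * g (p ^ k div p ^ i))"
    unfolding dconv_def by (simp add: sum.reindex)
  also have "\<dots> = (\<Sum>i\<le>k. f (p ^ i) * g (p ^ (k - i)))"
    using prime_gt_0_nat[OF assms] by (intro sum.cong) (auto simp: power_diff)
  finally show ?thesis .
qed

section \<open>Moebius inversion for multiplicative functions\<close>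

lemma dconv_commute: "n > 0 \<Longrightarrow> dconv f g n = dconv g f n"
  unfolding dconv_def
  by (rule sum.reindex_bij_witness[of _ "\<lambda>d. n div d" "\<lambda>d. n div d"])
     (auto simp: mult.commute div_dvd_iff_mult dvd_mult2 elim!: dvdE)

lemma psum_cong: "(\<And>n. n > 0 \<Longrightarrow> a n = b n) \<Longrightarrow> psum a x = psum b x"
  unfolding psum_def by (intro sum.cong) auto

lemma dconv_cong:
  assumes "\<And>n. n > 0 \<Longrightarrow> a n = a' n" "n > 0"
  shows "dconv a b n = dconv a' b n"
  unfolding dconv_def by (rule sum.cong) (use assms in \<open>auto intro!: arg_cong2[of _ _ _ _ "(*)"] Nat.gr0I\<close>)

text \<open>For multiplicative \<open>h\<close> this is convolution with the Moebius function, that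
  is, division by zeta: the local factor 1 - p^(-s) turns values at prime powers into consecutive
  differences. Building it from local values makes it multiplicative by construction.\<close>

definition dsum_inv :: "(nat \<Rightarrow> real) \<Rightarrow> nat \<Rightarrow> real" where
  "dsum_inv h = mult_ext (\<lambda>p k. h (p ^ k) - h (p ^ (k - 1)))"

lemma multiplicative_dsum_inv: "multiplicative (dsum_inv h)"
  unfolding dsum_inv_def by (rule multiplicative_mult_ext)

lemma dsum_inv_prime_power:
  "prime p \<Longrightarrow> k > 0 \<Longrightarrow> dsum_inv h (p ^ k) = h (p ^ k) - h (p ^ (k - 1))"
  unfolding dsum_inv_def by (rule mult_ext_prime_power)

lemma multiplicative_one: "multiplicative (\<lambda>_. 1)"
  by (simp add: multiplicative_def)

text \<open>Both sides are multiplicative, and at a prime power the differences telescope.\<close>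

lemma dsum_dsum_inv:
  assumes h: "multiplicative h" and "n > 0"
  shows "dsum (dsum_inv h) n = h n"
proof (rule multiplicative_eqI[OF multiplicative_dconv[OF multiplicative_dsum_inv multiplicative_one] h _ assms(2)])
  fix p k :: nat assume p: "prime p"
  have "(\<Sum>i\<le>k. dsum_inv h (p ^ i)) = h (p ^ k)"
  proof (induction k)
    case 0
    then show ?case using multiplicativeD(2)[OF h] multiplicativeD(2)[OF multiplicative_dsum_inv, of h] by simp
  next
    case (Suc k)
    then show ?case using dsum_inv_prime_power[OF p, of "Suc k" h] by simp
  qed
  then show "dsum (dsum_inv h) (p ^ k) = h (p ^ k)" by (simp add: dconv_prime_power[OF p])
qed

lemma multiplicative_dsum_inv_funpow: "multiplicative h \<Longrightarrow> multiplicative ((dsum_inv ^^ j) h)"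
  by (induction j) (auto simp: multiplicative_dsum_inv)

lemma multiplicative_dsum_funpow: "multiplicative h \<Longrightarrow> multiplicative ((dsum ^^ j) h)"
  by (induction j) (auto simp: multiplicative_dconv multiplicative_one)

lemma dsum_funpow_cong:
  "(\<And>n. n > 0 \<Longrightarrow> a n = b n) \<Longrightarrow> n > 0 \<Longrightarrow> (dsum ^^ j) a n = (dsum ^^ j) b n"
  by (induction j arbitrary: n) (auto intro!: dconv_cong)

lemma dsum_funpow_dsum_inv_funpow:
  assumes "multiplicative h" "n > 0"
  shows "(dsum ^^ j) ((dsum_inv ^^ j) h) n = h n"
  using assms(2)
proof (induction j arbitrary: n)
  case (Suc j)
  have "(dsum ^^ Suc j) ((dsum_inv ^^ Suc j) h) n = (dsum ^^ j) (dsum (dsum_inv ((dsum_inv ^^ j) h))) n"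
    by (subst funpow_Suc_right) simp
  also have "\<dots> = (dsum ^^ j) ((dsum_inv ^^ j) h) n"
    by (rule dsum_funpow_cong[OF _ Suc.prems])
       (rule dsum_dsum_inv[OF multiplicative_dsum_inv_funpow[OF assms(1)]])
  finally show ?case using Suc by simp
qed simp

text \<open>By unique factorisation the expanded product contains \<open>w n\<close> for each n <= N
  as a separate term; the other terms are nonnegative.\<close>

lemma sum_le_euler_product:
  assumes w: "multiplicative w" and nonneg: "\<And>n. w n \<ge> 0"
  shows "(\<Sum>n\<in>{1..N}. w n) \<le> (\<Prod>p | prime p \<and> p \<le> N. \<Sum>k\<le>N. w (p ^ k))"
proof -
  define Q where "Q = {p. prime p \<and> p \<le> N}"
  have fin: "finite Q" unfolding Q_def by (rule finite_subset[of _ "{..N}"]) auto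
  have prQ: "prime p" if "p \<in> Q" for p using that by (simp add: Q_def)
  define \<phi> where "\<phi> n = (\<lambda>p\<in>Q. multiplicity p n)" for n :: nat
  have pf: "prime_factors n \<subseteq> Q" if "n \<in> {1..N}" for n
  proof
    fix p assume p: "p \<in> prime_factors n"
    then have "p \<le> n" using that by (intro dvd_imp_le) auto
    then show "p \<in> Q" using that p by (auto simp: Q_def)
  qed
  have "inj_on \<phi> {1..N}"
  proof (rule inj_onI)
    fix m n assume m: "m \<in> {1..N}" and n: "n \<in> {1..N}" and eq: "\<phi> m = \<phi> n"
    have rep: "x = (\<Prod>p\<in>Q. p ^ multiplicity p x)" if x: "x \<in> {1..N}" for x
    proof -
      have "x = (\<Prod>p\<in>prime_factors x. p ^ multiplicity p x)"
        using x by (intro prime_factorization_nat) auto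
      also have "\<dots> = (\<Prod>p\<in>Q. p ^ multiplicity p x)"
        using x pf[OF x] fin prQ
        by (intro prod.mono_neutral_left) (auto simp: prime_factors_dvd not_dvd_imp_multiplicity_0)
      finally show ?thesis .
    qed
    have "multiplicity p m = multiplicity p n" if "p \<in> Q" for p
      using fun_cong[OF eq, of p] that by (simp add: \<phi>_def)
    then have "(\<Prod>p\<in>Q. p ^ multiplicity p m) = (\<Prod>p\<in>Q. p ^ multiplicity p n)" by (intro prod.cong) auto
    then show "m = n" using rep[OF m] rep[OF n] by simp
  qed
  moreover have "w n = (\<Prod>p\<in>Q. w (p ^ \<phi> n p))" if "n \<in> {1..N}" for n
    using multiplicative_prod[OF w _ fin pf[OF that] prQ] that by (simp add: \<phi>_def)
  ultimately have "(\<Sum>n\<in>{1..N}. w n) = (\<Sum>e\<in>\<phi> ` {1..N}. \<Prod>p\<in>Q. w (p ^ e p))"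
    by (simp add: sum.reindex)
  also have "\<dots> \<le> (\<Sum>e\<in>PiE Q (\<lambda>_. {..N}). \<Prod>p\<in>Q. w (p ^ e p))"
  proof (rule sum_mono2)
    show "finite (PiE Q (\<lambda>_. {..N}))" using fin by (intro finite_PiE) auto
    show "\<phi> ` {1..N} \<subseteq> PiE Q (\<lambda>_. {..N})"
    proof (intro image_subsetI PiE_I)
      fix n p assume n: "n \<in> {1..N}" and p: "p \<in> Q"
      \<comment> \<open>From k < 2^k <= p^k <= n <= N, every exponent is at most N, so truncating
        the local sums at N loses no n <= N.\<close>
      have "multiplicity p n < 2 ^ multiplicity p n" by simp
      also have "\<dots> \<le> p ^ multiplicity p n" using prime_ge_2_nat[OF prQ[OF p]] by (intro power_mono) auto
      also have "\<dots> \<le> n" using n by (intro dvd_imp_le multiplicity_dvd) auto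
      finally show "\<phi> n p \<in> {..N}" using n p by (simp add: \<phi>_def)
    qed (auto simp: \<phi>_def)
  qed (auto intro!: prod_nonneg nonneg)
  also have "\<dots> = (\<Prod>p\<in>Q. \<Sum>k\<le>N. w (p ^ k))"
    by (rule prod_sum_PiE[symmetric]) (use fin in auto)
  finally show ?thesis by (simp add: Q_def)
qed

lemma summable_poly_geometric:
  assumes "\<delta> > 0"
  shows "summable (\<lambda>k. real (k + 3) ^ r * 2 powr (- \<delta> * real k))"
proof -
  from one_plus_ln_power_le_powr[of "\<delta> / 2" r] assms obtain K where
    K: "K \<ge> 0" "\<And>x. x \<ge> 1 \<Longrightarrow> (1 + ln x) ^ r \<le> K * x powr (\<delta> / 2)" by auto
  have "summable (\<lambda>k. (5 ^ r * K) * (2 powr (- \<delta> / 2)) ^ k)"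
    using assms by (intro summable_mult summable_geometric) (auto simp: powr_less_one)
  then show ?thesis
  proof (rule summable_comparison_test[rotated], intro exI allI impI)
    fix k :: nat
    \<comment> \<open>Any constant that is at least 3 and at least 1 / ln 2 would serve; 5 makes k +
      3 <= 5 (1 + k ln 2). The polynomial factor then costs half of the geometric decay.\<close>
    have "real k * 1 \<le> real k * (5 * ln 2)" using ln2_ge_two_thirds by (intro mult_left_mono) auto
    then have "real (k + 3) \<le> 5 * (1 + ln (2 ^ k))" by (simp add: ln_realpow algebra_simps)
    then have "real (k + 3) ^ r \<le> (5 * (1 + ln (2 ^ k))) ^ r" by (intro power_mono) auto
    also have "\<dots> \<le> 5 ^ r * (K * (2 ^ k) powr (\<delta> / 2))"
      unfolding power_mult_distrib by (intro mult_left_mono K) auto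
    also have "(2 ^ k :: real) powr (\<delta> / 2) = 2 powr (\<delta> / 2 * real k)"
      by (simp add: powr_realpow[symmetric] powr_powr mult.commute)
    finally have "real (k + 3) ^ r * 2 powr (- \<delta> * real k) \<le>
        (5 ^ r * (K * 2 powr (\<delta> / 2 * real k))) * 2 powr (- \<delta> * real k)"
      by (intro mult_right_mono) auto
    also have "\<dots> = (5 ^ r * K) * 2 powr (- \<delta> / 2 * real k)"
      by (simp add: powr_add[symmetric] field_simps)
    also have "\<dots> = (5 ^ r * K) * (2 powr (- \<delta> / 2)) ^ k"
      by (subst powr_powr[symmetric]) (simp add: powr_realpow)
    finally show "norm (real (k + 3) ^ r * 2 powr (- \<delta> * real k)) \<le> (5 ^ r * K) * (2 powr (- \<delta> / 2)) ^ k"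
      by simp
  qed
qed

lemma multiplicative_abs_powr:
  assumes "multiplicative h"
  shows "multiplicative (\<lambda>n. \<bar>h n\<bar> * real n powr s)"
  unfolding multiplicative_def using multiplicativeD[OF assms]
  by (auto simp: abs_mult powr_mult)

text \<open>As \<open>h p = 0\<close>, the local sum at p begins with 1 followed by the term k = 2.
  With \<delta> = \<sigma> - \<theta> the terms k >= 2 are of size p^(-1-\<delta>k) up to powers of
  k, so they add up to O(p^(-1-2\<delta>)), which is summable over p. The -1 in the exponent of the
  hypothesis is exactly what the sum over primes requires.\<close>

lemma abs_dirichlet_series_bounded:
  assumes h: "multiplicative h" and hp: "\<And>p. prime p \<Longrightarrow> h p = 0"
    and hb: "\<And>p k. prime p \<Longrightarrow> k \<ge> 2 \<Longrightarrow> \<bar>h (p ^ k)\<bar> \<le> C * real (k + 1) ^ r * real p powr (\<theta> * real k - 1)"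
    and \<sigma>: "\<sigma> > \<theta>"
  shows "\<exists>K\<ge>0. \<forall>N. (\<Sum>n\<in>{1..N}. \<bar>h n\<bar> * real n powr (- \<sigma>)) \<le> K"
proof -
  define w where "w n = \<bar>h n\<bar> * real n powr (- \<sigma>)" for n
  define \<delta> where "\<delta> = \<sigma> - \<theta>"
  have \<delta>: "\<delta> > 0" using \<sigma> by (simp add: \<delta>_def)
  have w: "multiplicative w" unfolding w_def by (rule multiplicative_abs_powr[OF h])
  have w0: "w n \<ge> 0" for n by (simp add: w_def)
  have C: "C \<ge> 0"
  proof -
    have "0 \<le> C * real (2 + 1) ^ r * real 2 powr (\<theta> * real 2 - 1)"
      using hb[of 2 2] abs_ge_zero order_trans two_is_prime_nat by blast
    then have "0 * (3 ^ r * 2 powr (\<theta> * 2 - 1)) \<le> C * (3 ^ r * 2 powr (\<theta> * 2 - 1))"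
      by (simp add: mult.assoc)
    then show ?thesis by (rule mult_right_le_imp_le) simp
  qed
  \<comment> \<open>Here k stands for the exponent k + 2, and p^(-\<delta>k) is replaced by
    2^(-\<delta>k) to be uniform in p.\<close>
  define u where "u k = real (k + 3) ^ r * 2 powr (- \<delta> * real k)" for k
  have su: "summable u" unfolding u_def by (rule summable_poly_geometric[OF \<delta>])
  have u0: "u k \<ge> 0" for k by (simp add: u_def)
  define B where "B = C * suminf u"
  have B: "B \<ge> 0" unfolding B_def using C su u0 by (intro mult_nonneg_nonneg suminf_nonneg) auto
  define v where "v n = real n powr (- 1 - 2 * \<delta>)" for n :: nat
  have sv: "summable v" unfolding v_def using \<delta> by (subst summable_real_powr_iff) auto
  have local: "(\<Sum>k\<le>N. w (p ^ k)) \<le> 1 + B * v p" if p: "prime p" for p N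
  proof -
    have wk: "w (p ^ (k + 2)) \<le> C * v p * u k" for k
    proof -
      have p2: "real p \<ge> 2" using prime_ge_2_nat[OF p] by simp
      have "w (p ^ (k + 2)) \<le> (C * real (k + 3) ^ r * real p powr (\<theta> * real (k + 2) - 1)) * real (p ^ (k + 2)) powr (- \<sigma>)"
        unfolding w_def using hb[OF p, of "k + 2"] by (intro mult_right_mono) (auto simp: add.commute)
      also have "real (p ^ (k + 2)) powr (- \<sigma>) = real p powr (- \<sigma> * real (k + 2))"
        using p2 by (simp add: powr_realpow[symmetric] powr_powr mult.commute del: power_Suc)
      also have "(C * real (k + 3) ^ r * real p powr (\<theta> * real (k + 2) - 1)) * real p powr (- \<sigma> * real (k + 2))
          = C * real (k + 3) ^ r * real p powr ((\<theta> * real (k + 2) - 1) + - \<sigma> * real (k + 2))"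
        by (simp only: powr_add mult.assoc)
      also have "(\<theta> * real (k + 2) - 1) + - \<sigma> * real (k + 2) = (- 1 - 2 * \<delta>) + (- \<delta> * real k)"
        by (simp add: \<delta>_def algebra_simps)
      also have "C * real (k + 3) ^ r * real p powr \<dots> = C * real (k + 3) ^ r * v p * real p powr (- \<delta> * real k)"
        by (simp only: powr_add mult.assoc v_def)
      also have "\<dots> \<le> C * real (k + 3) ^ r * v p * 2 powr (- \<delta> * real k)"
        using C p2 \<delta> by (intro mult_left_mono powr_mono2') (auto simp: v_def)
      finally show ?thesis by (simp add: u_def mult_ac)
    qed
    have "(\<Sum>k\<le>N. w (p ^ k)) \<le> (\<Sum>k<N + 2. w (p ^ k))" using w0 by (intro sum_mono2) auto
    also have "\<dots> = (\<Sum>k<2. w (p ^ k)) + (\<Sum>k<N. w (p ^ (k + 2)))"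
      by (simp add: sum.lessThan_Suc_shift numeral_2_eq_2 del: sum.lessThan_Suc)
    also have "(\<Sum>k<2. w (p ^ k)) = 1"
      using multiplicativeD(2)[OF w] hp[OF p] by (simp add: numeral_2_eq_2 w_def)
    also have "(\<Sum>k<N. w (p ^ (k + 2))) \<le> (\<Sum>k<N. C * v p * u k)" by (intro sum_mono wk)
    also have "\<dots> = C * v p * (\<Sum>k<N. u k)" by (simp add: sum_distrib_left)
    also have "\<dots> \<le> C * v p * suminf u"
      using C su u0 by (intro mult_left_mono sum_le_suminf) (auto simp: v_def)
    finally show ?thesis by (simp add: B_def mult_ac)
  qed
  have "(\<Sum>n\<in>{1..N}. w n) \<le> exp (B * suminf v)" for N
  proof -
    have fin: "finite {p::nat. prime p \<and> p \<le> N}" by (rule finite_subset[of _ "{..N}"]) auto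
    have "(\<Sum>n\<in>{1..N}. w n) \<le> (\<Prod>p | prime p \<and> p \<le> N. \<Sum>k\<le>N. w (p ^ k))"
      by (rule sum_le_euler_product[OF w w0])
    also have "\<dots> \<le> (\<Prod>p | prime p \<and> p \<le> N. exp (B * v p))"
    proof (intro prod_mono conjI)
      fix p assume "p \<in> {p. prime p \<and> p \<le> N}"
      then have "(\<Sum>k\<le>N. w (p ^ k)) \<le> 1 + B * v p" by (intro local) auto
      also have "\<dots> \<le> exp (B * v p)" by simp
      finally show "(\<Sum>k\<le>N. w (p ^ k)) \<le> exp (B * v p)" .
    qed (auto intro!: sum_nonneg w0)
    also have "\<dots> = exp (B * (\<Sum>p | prime p \<and> p \<le> N. v p))"
      using fin by (simp add: exp_sum sum_distrib_left)
    also have "\<dots> \<le> exp (B * suminf v)"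
      using sum_le_suminf[OF sv fin] B by (auto intro!: mult_left_mono simp: v_def)
    finally show ?thesis .
  qed
  then show ?thesis unfolding w_def by (intro exI[of _ "exp (B * suminf v)"]) auto
qed

text \<open>The size condition behind the error \<open>R1\<close> of the hyperbola method. It is
  carried along with the asymptotics because each further convolution needs it again.\<close>

definition subpoly_avg :: "(nat \<Rightarrow> real) \<Rightarrow> bool" where
  "subpoly_avg a \<longleftrightarrow> (\<forall>\<delta>>0. \<exists>K. \<forall>x\<ge>1. psum (\<lambda>n. \<bar>a n\<bar>) x \<le> K * x powr (1 + \<delta>))"

lemma psum_mono: "(\<And>n. n > 0 \<Longrightarrow> a n \<le> b n) \<Longrightarrow> psum a x \<le> psum b x"
  unfolding psum_def by (intro sum_mono) auto

lemma psum_dsum: "psum (dsum a) x = (\<Sum>e\<in>{1..nat \<lfloor>x\<rfloor>}. psum a (x / real e))"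
proof -
  have "psum (dsum a) x = psum (dconv (\<lambda>_. 1) a) x" by (intro psum_cong dconv_commute)
  then show ?thesis by (simp add: psum_dconv)
qed

text \<open>Summing (x / e)^(1+\<delta>) over e costs only the constant factor zeta(1 +
  \<delta>).\<close>

lemma subpoly_avg_dsum:
  assumes "subpoly_avg a"
  shows "subpoly_avg (dsum a)"
  unfolding subpoly_avg_def
proof (intro allI impI)
  fix \<delta> :: real assume d: "\<delta> > 0"
  with assms obtain K where K: "\<And>x. x \<ge> 1 \<Longrightarrow> psum (\<lambda>n. \<bar>a n\<bar>) x \<le> K * x powr (1 + \<delta>)"
    unfolding subpoly_avg_def by blast
  have K0: "K \<ge> 0" using K[of 1] by (simp add: psum_def)
  define v where "v n = real n powr (- 1 - \<delta>)" for n :: nat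
  have sv: "summable v" unfolding v_def using d by (subst summable_real_powr_iff) auto
  have v0: "v n \<ge> 0" for n by (simp add: v_def)
  have "psum (\<lambda>n. \<bar>dsum a n\<bar>) x \<le> (K * suminf v) * x powr (1 + \<delta>)" if x: "x \<ge> 1" for x
  proof -
    have "psum (\<lambda>n. \<bar>dsum a n\<bar>) x \<le> psum (dsum (\<lambda>n. \<bar>a n\<bar>)) x"
      by (intro psum_mono) (simp add: dconv_def)
    also have "\<dots> \<le> (\<Sum>e\<in>{1..nat \<lfloor>x\<rfloor>}. (K * x powr (1 + \<delta>)) * v e)"
      unfolding psum_dsum
    proof (rule sum_mono)
      fix e assume "e \<in> {1..nat \<lfloor>x\<rfloor>}"
      then have e: "1 \<le> e" "real e \<le> x" unfolding mem_nat_floor_iff by auto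
      then have "1 \<le> x / real e" by (simp add: field_simps)
      then have "psum (\<lambda>n. \<bar>a n\<bar>) (x / real e) \<le> K * (x / real e) powr (1 + \<delta>)" by (rule K)
      also have "(x / real e) powr (1 + \<delta>) = x powr (1 + \<delta>) * v e"
      proof -
        have "v e = real e powr (- (1 + \<delta>))" by (simp add: v_def)
        also have "\<dots> = inverse (real e powr (1 + \<delta>))" by (rule powr_minus)
        finally have "v e = inverse (real e powr (1 + \<delta>))" .
        then show ?thesis using e x by (simp add: powr_divide divide_simps)
      qed
      finally show "psum (\<lambda>n. \<bar>a n\<bar>) (x / real e) \<le> K * x powr (1 + \<delta>) * v e" by (simp add: mult.assoc)
    qed
    also have "\<dots> = (K * x powr (1 + \<delta>)) * (\<Sum>e\<in>{1..nat \<lfloor>x\<rfloor>}. v e)" by (simp add: sum_distrib_left)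
    also have "\<dots> \<le> (K * x powr (1 + \<delta>)) * suminf v"
      using K0 sv v0 by (intro mult_left_mono sum_le_suminf) auto
    finally show ?thesis by (simp add: mult_ac)
  qed
  then show "\<exists>K. \<forall>x\<ge>1. psum (\<lambda>n. \<bar>dsum a n\<bar>) x \<le> K * x powr (1 + \<delta>)" by blast
qed

text \<open>Rankin's trick: each n <= x is weighted with (x / n)^\<sigma> >= 1.\<close>

lemma psum_abs_le_powr:
  assumes "\<And>N. (\<Sum>n\<in>{1..N}. \<bar>g n\<bar> * real n powr (- \<sigma>)) \<le> K" "\<sigma> \<ge> 0" "x \<ge> 1"
  shows "psum (\<lambda>n. \<bar>g n\<bar>) x \<le> K * x powr \<sigma>"
proof -
  have "psum (\<lambda>n. \<bar>g n\<bar>) x \<le> (\<Sum>n\<in>{1..nat \<lfloor>x\<rfloor>}. (\<bar>g n\<bar> * real n powr (- \<sigma>)) * x powr \<sigma>)"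
    unfolding psum_def
  proof (rule sum_mono)
    fix n assume "n \<in> {1..nat \<lfloor>x\<rfloor>}"
    then have n: "1 \<le> n" "real n \<le> x" unfolding mem_nat_floor_iff by auto
    have "1 = real n powr (- \<sigma>) * real n powr \<sigma>" using n by (simp add: powr_add[symmetric])
    also have "\<dots> \<le> real n powr (- \<sigma>) * x powr \<sigma>" using n assms by (intro mult_left_mono powr_mono2) auto
    finally have "\<bar>g n\<bar> * 1 \<le> \<bar>g n\<bar> * (real n powr (- \<sigma>) * x powr \<sigma>)" by (intro mult_left_mono) auto
    then show "\<bar>g n\<bar> \<le> (\<bar>g n\<bar> * real n powr (- \<sigma>)) * x powr \<sigma>" by (simp add: mult.assoc)
  qed
  also have "\<dots> = (\<Sum>n\<in>{1..nat \<lfloor>x\<rfloor>}. \<bar>g n\<bar> * real n powr (- \<sigma>)) * x powr \<sigma>" by (simp add: sum_distrib_right)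
  also have "\<dots> \<le> K * x powr \<sigma>" using assms(1) by (intro mult_right_mono) auto
  finally show ?thesis .
qed

text \<open>For an absolutely convergent factor the trivial estimate loses nothing, so the hyperbola method
  is only needed for the remaining convolutions with 1.\<close>

lemma log_poly_asymp_psum_dsum_abs_conv:
  assumes \<theta>: "0 \<le> \<theta>" "\<theta> < 1"
    and g: "\<And>\<sigma>. \<sigma> > \<theta> \<Longrightarrow> \<exists>K\<ge>0. \<forall>N. (\<Sum>n\<in>{1..N}. \<bar>g n\<bar> * real n powr (- \<sigma>)) \<le> K"
  shows "log_poly_asymp 1 (1 - \<theta>) (\<lambda>x. psum (dsum g) x / x)" "subpoly_avg g"
proof -
  have bd: "\<exists>K. \<forall>x\<ge>1. psum (\<lambda>n. \<bar>g n\<bar>) x \<le> K * x powr (\<theta> + \<delta>)" if d: "\<delta> > 0" for \<delta>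
  proof -
    obtain K where "\<And>N. (\<Sum>n\<in>{1..N}. \<bar>g n\<bar> * real n powr (- (\<theta> + \<delta>))) \<le> K"
      using g[of "\<theta> + \<delta>"] d by auto
    from psum_abs_le_powr[OF this] show ?thesis using d \<theta> by auto
  qed
  have bdx: "\<exists>K. \<forall>x\<ge>1. psum (\<lambda>n. \<bar>g n\<bar>) x / x \<le> K * x powr (- (1 - \<theta>) + \<delta>)" if "\<delta> > 0" for \<delta>
  proof -
    from bd[OF that] obtain K where K: "\<And>x. x \<ge> 1 \<Longrightarrow> psum (\<lambda>n. \<bar>g n\<bar>) x \<le> K * x powr (\<theta> + \<delta>)" by blast
    have "psum (\<lambda>n. \<bar>g n\<bar>) x / x \<le> K * x powr (- (1 - \<theta>) + \<delta>)" if x: "x \<ge> 1" for x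
    proof -
      have "psum (\<lambda>n. \<bar>g n\<bar>) x / x \<le> K * x powr (\<theta> + \<delta>) / x" using K[OF x] x by (intro divide_right_mono) auto
      also have "\<dots> = K * x powr ((\<theta> + \<delta>) - 1)" using x by (simp add: powr_diff)
      also have "(\<theta> + \<delta>) - 1 = - (1 - \<theta>) + \<delta>" by simp
      finally show ?thesis .
    qed
    then show ?thesis by blast
  qed
  show "subpoly_avg g"
    unfolding subpoly_avg_def
  proof (intro allI impI)
    fix \<delta> :: real assume "\<delta> > 0"
    from bd[OF this] obtain K where K: "\<And>x. x \<ge> 1 \<Longrightarrow> psum (\<lambda>n. \<bar>g n\<bar>) x \<le> K * x powr (\<theta> + \<delta>)" by blast
    have K0: "K \<ge> 0" using K[of 1] by (simp add: psum_def)
    have "psum (\<lambda>n. \<bar>g n\<bar>) x \<le> K * x powr (1 + \<delta>)" if "x \<ge> 1" for x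
      using K[OF that] K0 \<theta> that by (intro order_trans[OF K[OF that]] mult_left_mono powr_mono) auto
    then show "\<exists>K. \<forall>x\<ge>1. psum (\<lambda>n. \<bar>g n\<bar>) x \<le> K * x powr (1 + \<delta>)" by blast
  qed
  \<comment> \<open>The sums of \<open>g\<close> have no main term at all, so Abel summation with k
    = 0 yields one constant, the value of the Dirichlet series of \<open>g\<close> at 1.\<close>
  have "log_poly_asymp 0 (1 - \<theta>) (\<lambda>x. psum g x / x)"
  proof (rule log_poly_asymp_small)
    fix \<delta> :: real assume "\<delta> > 0"
    from bdx[OF this] obtain K where K: "\<And>x. x \<ge> 1 \<Longrightarrow> psum (\<lambda>n. \<bar>g n\<bar>) x / x \<le> K * x powr (- (1 - \<theta>) + \<delta>)" by blast
    have "\<bar>psum g x / x\<bar> \<le> psum (\<lambda>n. \<bar>g n\<bar>) x / x" if "x \<ge> 1" for x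
      using that by (simp add: abs_divide psum_def divide_right_mono)
    then show "powr_bounded (\<lambda>x. psum g x / x) (- (1 - \<theta>) + \<delta>)" using K order_trans by blast
  qed
  from log_poly_asymp_psum_divide_nat[OF this]
  have 1: "log_poly_asymp 1 (1 - \<theta>) (psum (\<lambda>m. g m / real m))" using \<theta> by simp
  \<comment> \<open>The cut-off is x itself: all fractional parts of x / d are estimated trivially
    at once.\<close>
  define R where "R x = psum (\<lambda>d. g d * (real (nat \<lfloor>x / real d\<rfloor>) - x / real d)) x / x" for x
  have 2: "log_poly_asymp 1 (1 - \<theta>) R"
  proof (rule log_poly_asymp_small)
    fix \<delta> :: real assume "\<delta> > 0"
    from bdx[OF this] obtain K where K: "\<And>x. x \<ge> 1 \<Longrightarrow> psum (\<lambda>n. \<bar>g n\<bar>) x / x \<le> K * x powr (- (1 - \<theta>) + \<delta>)" by blast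
    have "\<bar>R x\<bar> \<le> psum (\<lambda>n. \<bar>g n\<bar>) x / x" if x: "x \<ge> 1" for x
      using psum_floor_error_le[of x g x] x unfolding R_def abs_divide by (simp add: divide_right_mono)
    then show "powr_bounded R (- (1 - \<theta>) + \<delta>)" using K order_trans by blast
  qed
  show "log_poly_asymp 1 (1 - \<theta>) (\<lambda>x. psum (dsum g) x / x)"
  proof (rule log_poly_asymp_cong[OF log_poly_asymp_add[OF 1 2]])
    fix x :: real assume "x \<ge> 1"
    then show "psum (\<lambda>m. g m / real m) x + R x = psum (dsum g) x / x"
      unfolding R_def psum_dconv psum_one unfolding psum_def
      by (simp add: right_diff_distrib sum_subtractf diff_divide_distrib sum_divide_distrib)
  qed
qed

text \<open>With \<eta> = 1/q the map \<eta> to \<eta> / (1 + \<eta>) becomes q to q + 1, so j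
  convolutions simply add j.\<close>

lemma log_poly_asymp_psum_dsum_funpow:
  assumes "log_poly_asymp k (1 / q) (\<lambda>x. psum a x / x)" "subpoly_avg a" "q \<ge> 1"
  shows "log_poly_asymp (k + j) (1 / (q + real j)) (\<lambda>x. psum ((dsum ^^ j) a) x / x) \<and> subpoly_avg ((dsum ^^ j) a)"
proof (induction j)
  case 0
  then show ?case using assms by simp
next
  case (Suc j)
  have "log_poly_asymp (k + j + 1) (1 / (q + real j) / (1 + 1 / (q + real j))) (\<lambda>x. psum (dsum ((dsum ^^ j) a)) x / x)"
    using Suc assms(3) by (intro log_poly_asymp_psum_dsum) (auto simp: subpoly_avg_def)
  moreover have "1 / (q + real j) / (1 + 1 / (q + real j)) = 1 / (q + real (Suc j))"
    using assms(3) by (simp add: field_simps)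
  ultimately show ?case using Suc subpoly_avg_dsum by simp
qed

lemma dsum_inv_prime: "prime p \<Longrightarrow> multiplicative h \<Longrightarrow> dsum_inv h p = h p - 1"
  using dsum_inv_prime_power[of p 1 h] by (simp add: multiplicativeD)

lemma dsum_inv_funpow_prime:
  "prime p \<Longrightarrow> multiplicative h \<Longrightarrow> (dsum_inv ^^ j) h p = h p - real j"
  by (induction j) (simp_all add: dsum_inv_prime multiplicative_dsum_inv_funpow)

text \<open>Each inversion subtracts the value at p^(k-1). For k > 2 that value obeys an even
  smaller bound. For k = 2 it is the value at p, the constant t - j, and \<theta> >= 1/2 guarantees
  p^(2\<theta>-1) >= 1 to dominate it.\<close>

lemma dsum_inv_funpow_bound:
  assumes h: "multiplicative h" and hp: "\<And>p. prime p \<Longrightarrow> h p = t" and \<theta>: "\<theta> \<ge> 1 / 2"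
    and hb: "\<And>p k. prime p \<Longrightarrow> k \<ge> 2 \<Longrightarrow> \<bar>h (p ^ k)\<bar> \<le> C * real (k + 1) ^ r * real p powr (\<theta> * real k - 1)"
  shows "\<exists>C. \<forall>p k. prime p \<longrightarrow> k \<ge> 2 \<longrightarrow>
    \<bar>(dsum_inv ^^ j) h (p ^ k)\<bar> \<le> C * real (k + 1) ^ r * real p powr (\<theta> * real k - 1)"
proof (induction j)
  case 0
  then show ?case using hb by auto
next
  case (Suc j)
  define u where "u = (dsum_inv ^^ j) h"
  from Suc obtain C where C: "\<And>p k. prime p \<Longrightarrow> k \<ge> 2 \<Longrightarrow>
    \<bar>u (p ^ k)\<bar> \<le> C * real (k + 1) ^ r * real p powr (\<theta> * real k - 1)" unfolding u_def by blast
  define D where "D = \<bar>C\<bar> + \<bar>t - real j\<bar>"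
  have "\<bar>dsum_inv u (p ^ k)\<bar> \<le> (C + D) * real (k + 1) ^ r * real p powr (\<theta> * real k - 1)"
    if p: "prime p" and k: "k \<ge> 2" for p k
  proof -
    have p1: "real p \<ge> 1" using prime_ge_1_nat[OF p] by simp
    have "\<bar>u (p ^ (k - 1))\<bar> \<le> D * real (k + 1) ^ r * real p powr (\<theta> * real k - 1)"
    proof (cases "k = 2")
      case True
      have "\<bar>u (p ^ (k - 1))\<bar> = \<bar>t - real j\<bar> * 1 * 1"
        using True dsum_inv_funpow_prime[OF p h] hp[OF p] by (simp add: u_def)
      also have "\<dots> \<le> D * real (k + 1) ^ r * real p powr (\<theta> * real k - 1)"
        using p1 \<theta> True by (intro mult_mono ge_one_powr_ge_zero one_le_power) (auto simp: D_def)
      finally show ?thesis .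
    next
      case False
      then have "\<bar>u (p ^ (k - 1))\<bar> \<le> C * real (k - 1 + 1) ^ r * real p powr (\<theta> * real (k - 1) - 1)"
        using k by (intro C[OF p]) auto
      also have "\<dots> \<le> D * real (k + 1) ^ r * real p powr (\<theta> * real k - 1)"
        using p1 \<theta> k by (intro mult_mono powr_mono power_mono) (auto simp: D_def)
      finally show ?thesis .
    qed
    with C[OF p k] show ?thesis
      using dsum_inv_prime_power[OF p, of k u] k by (simp add: distrib_right)
  qed
  then show ?case unfolding u_def by (auto intro!: exI[of _ "C + D"])
qed

section \<open>Lower bounds for divisor sums and the exact degree of the polynomial\<close>

lemma psum_nonneg: "(\<And>n. n > 0 \<Longrightarrow> a n \<ge> 0) \<Longrightarrow> psum a x \<ge> 0"
  unfolding psum_def by (intro sum_nonneg) auto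

lemma dsum_funpow_one_nonneg: "(dsum ^^ k) (\<lambda>_. 1) n \<ge> 0"
  by (induction k arbitrary: n) (auto simp: dconv_def intro!: sum_nonneg)

lemma psum_inverse_ge_ln:
  assumes "y \<ge> 1"
  shows "ln y \<le> psum (\<lambda>n. 1 / real n) y"
proof -
  have "ln y \<le> ln (real (nat \<lfloor>y\<rfloor>) + 1)" using nat_floor_bounds[OF assms] assms by simp
  also have "\<dots> \<le> harm (nat \<lfloor>y\<rfloor>)" using ln_le_harm[of "nat \<lfloor>y\<rfloor>"] by (simp add: add.commute)
  finally show ?thesis by (simp add: harm_def psum_def inverse_eq_divide)
qed

text \<open>The iterate counts factorisations into k + 1 factors. In the induction step only e <= y
  = sqrt x is kept. There x / e >= y, and ln y is half of ln x; k such factors come from the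
  induction hypothesis and one from the harmonic sum, whence the division by 2^(k+1).\<close>

lemma psum_dsum_funpow_one_ge:
  "\<exists>c>0. \<forall>x\<ge>1. psum ((dsum ^^ k) (\<lambda>_. 1)) x \<ge> c * x * ln x ^ k"
proof (induction k)
  case 0
  show ?case using nat_floor_bounds(4) by (intro exI[of _ "1/2"]) (auto simp: psum_one)
next
  case (Suc k)
  define a where "a = (dsum ^^ k) (\<lambda>_. 1)"
  have a0: "a n \<ge> 0" for n unfolding a_def by (rule dsum_funpow_one_nonneg)
  from Suc obtain c where c: "c > 0" "\<And>x. x \<ge> 1 \<Longrightarrow> psum a x \<ge> c * x * ln x ^ k" unfolding a_def by blast
  have "psum (dsum a) x \<ge> c / 2 ^ Suc k * x * ln x ^ Suc k" if x: "x \<ge> 1" for x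
  proof -
    define y where "y = sqrt x"
    have y: "y \<ge> 1" "y * y = x" using x by (auto simp: y_def)
    have "y * 1 \<le> y * y" using y by (intro mult_left_mono) auto
    then have yx: "y \<le> x" using y by simp
    have lny: "ln y = ln x / 2" using x by (simp add: y_def ln_sqrt)
    have "c / 2 ^ Suc k * x * ln x ^ Suc k = c * x * ln y ^ k * ln y"
      by (simp add: lny power_divide mult_ac)
    also have "\<dots> \<le> c * x * ln y ^ k * psum (\<lambda>n. 1 / real n) y"
      using c(1) x y psum_inverse_ge_ln[OF y(1)] by (intro mult_left_mono) auto
    also have "\<dots> = (\<Sum>e\<in>{1..nat \<lfloor>y\<rfloor>}. c * (x / real e) * ln y ^ k)"
      by (simp add: psum_def sum_distrib_left)
    also have "\<dots> \<le> (\<Sum>e\<in>{1..nat \<lfloor>y\<rfloor>}. psum a (x / real e))"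
    proof (rule sum_mono)
      fix e assume "e \<in> {1..nat \<lfloor>y\<rfloor>}"
      then have e: "1 \<le> e" "real e \<le> y" unfolding mem_nat_floor_iff by auto
      have "y * real e \<le> y * y" using e y by (intro mult_left_mono) auto
      then have ye: "y \<le> x / real e" using e y by (simp add: pos_le_divide_eq)
      have "c * (x / real e) * ln y ^ k \<le> c * (x / real e) * ln (x / real e) ^ k"
        using c(1) x y ye by (intro mult_left_mono power_mono) auto
      also have "\<dots> \<le> psum a (x / real e)" using ye y by (intro c(2)) auto
      finally show "c * (x / real e) * ln y ^ k \<le> psum a (x / real e)" .
    qed
    also have "\<dots> \<le> psum (dsum a) x"
      unfolding psum_dsum using yx a0
      by (intro sum_mono2 psum_nonneg) (auto intro: order_trans[OF _ nat_mono[OF floor_mono]])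
    finally show ?thesis .
  qed
  then show ?case using c(1) by (intro exI[of _ "c / 2 ^ Suc k"]) (auto simp: a_def)
qed

lemma dsum_prime: "prime p \<Longrightarrow> dsum h p = h 1 + h p"
  using dconv_prime_power[of p h "\<lambda>_. 1" 1] by simp

lemma dsum_funpow_one_prime: "prime p \<Longrightarrow> (dsum ^^ k) (\<lambda>_. 1) p = 1 + real k"
proof (induction k)
  case (Suc k)
  have "(dsum ^^ k) (\<lambda>_. 1) 1 = 1"
    using multiplicativeD(1)[OF multiplicative_dsum_funpow[OF multiplicative_one]] .
  then show ?case using Suc by (simp add: dsum_prime)
qed simp

lemma dsum_funpow_one_prime_power_le:
  "prime p \<Longrightarrow> (dsum ^^ j) (\<lambda>_. 1) (p ^ k) \<le> real (k + 1) ^ j"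
proof (induction j arbitrary: k)
  case (Suc j)
  have "(dsum ^^ Suc j) (\<lambda>_. 1) (p ^ k) = (\<Sum>i\<le>k. (dsum ^^ j) (\<lambda>_. 1) (p ^ i))"
    using Suc.prems by (simp add: dconv_prime_power)
  also have "\<dots> \<le> (\<Sum>i\<le>k. real (k + 1) ^ j)"
  proof (rule sum_mono)
    fix i assume "i \<in> {..k}"
    then have "real (i + 1) ^ j \<le> real (k + 1) ^ j" by (intro power_mono) auto
    with Suc.IH[OF Suc.prems, of i] show "(dsum ^^ j) (\<lambda>_. 1) (p ^ i) \<le> real (k + 1) ^ j" by linarith
  qed
  finally show ?case by simp
qed simp

text \<open>With \<open>h\<close> the restriction of the divisor function \<open>d\<^sub>t\<close> to squarefull numbers one has \<open>d\<^sub>t \<le> h * f\<close>,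
  and \<open>\<Sum> h(n)/n\<close> converges; so the summatory function of \<open>f\<close> cannot be of smaller order than
  that of \<open>d\<^sub>t\<close>.\<close>

lemma psum_not_small:
  assumes f: "multiplicative f" and f0: "\<And>n. f n \<ge> 0" and fp: "\<And>p. prime p \<Longrightarrow> f p = 1 + real t"
    and small: "\<And>x. x \<ge> 1 \<Longrightarrow> psum f x \<le> K * x * (1 + ln x) ^ (t - 1)" and t: "t > 0"
  shows False
proof -
  define d where "d = (dsum ^^ t) (\<lambda>_. 1)"
  have d: "multiplicative d" unfolding d_def by (rule multiplicative_dsum_funpow[OF multiplicative_one])
  have d0: "d n \<ge> 0" for n unfolding d_def by (rule dsum_funpow_one_nonneg)
  define h where "h = mult_ext (\<lambda>p k. if k = 1 then 0 else d (p ^ k))"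
  have h: "multiplicative h" unfolding h_def by (rule multiplicative_mult_ext)
  have hk: "h (p ^ k) = (if k = 1 then 0 else d (p ^ k))" if "prime p" "k > 0" for p k
    unfolding h_def by (rule mult_ext_prime_power[OF that])
  have h0: "h n \<ge> 0" for n unfolding h_def mult_ext_def by (intro prod_nonneg) (auto simp: d0)
  have "\<exists>L\<ge>0. \<forall>N. (\<Sum>n\<in>{1..N}. \<bar>h n\<bar> * real n powr (- 1)) \<le> L"
  \<comment> \<open>For k >= 2 the factor p^(k/2 - 1) is at least 1, so the bound (k + 1)^t on the
    divisor function is enough; any \<theta> from 1/2 up to but excluding 1 would do.\<close>
  proof (rule abs_dirichlet_series_bounded[OF h, where C = 1 and r = t and \<theta> = "1 / 2"])
    show "h p = 0" if "prime p" for p using hk[OF that, of 1] by simp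
    fix p k :: nat assume p: "prime p" and k: "k \<ge> 2"
    have "\<bar>h (p ^ k)\<bar> = d (p ^ k)" using hk[OF p, of k] k d0 by simp
    also have "\<dots> \<le> real (k + 1) ^ t * 1" unfolding d_def using dsum_funpow_one_prime_power_le[OF p] by simp
    also have "\<dots> \<le> real (k + 1) ^ t * real p powr (1 / 2 * real k - 1)"
      using k prime_ge_1_nat[OF p] by (intro mult_left_mono ge_one_powr_ge_zero) auto
    finally show "\<bar>h (p ^ k)\<bar> \<le> 1 * real (k + 1) ^ t * real p powr (1 / 2 * real k - 1)" by simp
  qed simp
  then obtain L where L: "L \<ge> 0" "\<And>N. (\<Sum>n\<in>{1..N}. \<bar>h n\<bar> * real n powr (- 1)) \<le> L" by blast
  have dle: "d n \<le> dconv h f n" if "n > 0" for n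
  proof -
    have "0 \<le> d n \<and> d n \<le> dconv h f n"
    proof (rule multiplicative_leI[OF d multiplicative_dconv[OF h f] _ that])
      fix p k :: nat assume p: "prime p" and k: "k > 0"
      show "0 \<le> d (p ^ k) \<and> d (p ^ k) \<le> dconv h f (p ^ k)"
      \<comment> \<open>A single summand of the convolution already equals \<open>d (p ^ k)\<close>:
        i = 0 when k = 1, because f p = 1 + t = d p, and i = k otherwise, because there h and d
        agree.\<close>
      proof (cases "k = 1")
        case True
        have "d (p ^ k) = f p" unfolding d_def using True dsum_funpow_one_prime[OF p] fp[OF p] by simp
        also have "\<dots> = h (p ^ 0) * f (p ^ (k - 0))" using True multiplicativeD(1)[OF h] by simp
        also have "\<dots> \<le> (\<Sum>i\<le>k. h (p ^ i) * f (p ^ (k - i)))"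
          by (rule member_le_sum) (auto simp: h0 f0)
        finally show ?thesis using d0 by (simp add: dconv_prime_power[OF p])
      next
        case False
        have "d (p ^ k) = h (p ^ k) * f (p ^ (k - k))" using False hk[OF p k] multiplicativeD(1)[OF f] by simp
        also have "\<dots> \<le> (\<Sum>i\<le>k. h (p ^ i) * f (p ^ (k - i)))"
          by (rule member_le_sum) (auto simp: h0 f0)
        finally show ?thesis using d0 by (simp add: dconv_prime_power[OF p])
      qed
    qed
    then show ?thesis ..
  qed
  have up: "psum d x \<le> (K * L) * x * (1 + ln x) ^ (t - 1)" if x: "x \<ge> 1" for x
  proof -
    have K0: "K \<ge> 0" using small[of 1] psum_nonneg[of f 1] f0 by simp
    have "psum d x \<le> psum (dconv h f) x" by (intro psum_mono dle)
    also have "\<dots> \<le> (\<Sum>m\<in>{1..nat \<lfloor>x\<rfloor>}. (\<bar>h m\<bar> * real m powr (- 1)) * (K * x * (1 + ln x) ^ (t - 1)))"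
      unfolding psum_dconv
    proof (rule sum_mono)
      fix m assume "m \<in> {1..nat \<lfloor>x\<rfloor>}"
      then have m: "1 \<le> m" "real m \<le> x" unfolding mem_nat_floor_iff by auto
      then have xm: "1 \<le> x / real m" by (simp add: field_simps)
      have "x / real m \<le> x / 1" using m x by (intro divide_left_mono) auto
      then have "K * (x / real m) * (1 + ln (x / real m)) ^ (t - 1) \<le> K * (x / real m) * (1 + ln x) ^ (t - 1)"
        using xm x K0 by (intro mult_left_mono power_mono) auto
      with small[OF xm] have "psum f (x / real m) \<le> K * (x / real m) * (1 + ln x) ^ (t - 1)" by linarith
      then have "h m * psum f (x / real m) \<le> h m * (K * (x / real m) * (1 + ln x) ^ (t - 1))"
        using h0 by (rule mult_left_mono)
      then show "h m * psum f (x / real m) \<le> (\<bar>h m\<bar> * real m powr (- 1)) * (K * x * (1 + ln x) ^ (t - 1))"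
        using h0 m by (simp add: powr_neg_one mult_ac)
    qed
    also have "\<dots> = (\<Sum>m\<in>{1..nat \<lfloor>x\<rfloor>}. \<bar>h m\<bar> * real m powr (- 1)) * (K * x * (1 + ln x) ^ (t - 1))"
      by (simp add: sum_distrib_right)
    also have "\<dots> \<le> L * (K * x * (1 + ln x) ^ (t - 1))"
      using L K0 x by (intro mult_right_mono) auto
    finally show ?thesis by (simp add: mult_ac)
  qed
  from psum_dsum_funpow_one_ge[of t] obtain c where
    c: "c > 0" "\<And>x. x \<ge> 1 \<Longrightarrow> psum d x \<ge> c * x * ln x ^ t" unfolding d_def by blast
  \<comment> \<open>With x = exp l the two bounds compare c l^t with K L (1 + l)^(t-1), which is at
    most \<bar>K L\<bar> (2 l)^(t-1). This choice of l makes the latter equal to c (l - 1) l^(t-1),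
    which is too small.\<close>
  define l where "l = 1 + \<bar>K * L\<bar> * 2 ^ (t - 1) / c"
  have l: "l \<ge> 1" using c by (simp add: l_def)
  have lm: "c * (l - 1) = \<bar>K * L\<bar> * 2 ^ (t - 1)" using c by (simp add: l_def)
  have "c * exp l * l ^ t \<le> (K * L) * exp l * (1 + l) ^ (t - 1)"
    using order_trans[OF c(2) up, of "exp l"] l by simp
  then have "exp l * (c * l ^ t) \<le> exp l * ((K * L) * (1 + l) ^ (t - 1))"
    by (simp only: mult_ac)
  then have "c * l ^ t \<le> (K * L) * (1 + l) ^ (t - 1)"
    by (rule mult_left_le_imp_le) simp
  also have "\<dots> \<le> \<bar>K * L\<bar> * (2 * l) ^ (t - 1)"
    using l by (intro mult_mono power_mono) auto
  also have "\<dots> = c * ((l - 1) * l ^ (t - 1))"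
    by (simp only: power_mult_distrib lm[symmetric] mult.assoc[symmetric])
  also have "\<dots> < c * (l * l ^ (t - 1))" using c l by (intro mult_strict_left_mono mult_strict_right_mono) auto
  also have "l * l ^ (t - 1) = l ^ t" using t by (cases t) auto
  finally show False by simp
qed

text \<open>\<open>1 + t\<close> is the number of zeta factors to split off, and
  \<open>1 - 1 / q\<close> is the abscissa beyond which the remaining factor converges absolutely.
  The condition q >= 2 places this abscissa at 1/2 or higher, as the bound for repeated inversion
  requires.\<close>

theorem multiplicative_psum_asymp:
  assumes f: "multiplicative f" and f0: "\<And>n. f n \<ge> 0"
    and fp: "\<And>p. prime p \<Longrightarrow> f p = 1 + real t" and t: "t > 0" and q: "q \<ge> 2"
    and fb: "\<And>p k. prime p \<Longrightarrow> k \<ge> 2 \<Longrightarrow> f (p ^ k) \<le> C * real (k + 1) ^ r * real p powr ((1 - 1 / q) * real k - 1)"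
  shows "\<exists>P :: real poly. degree P = t \<and> (\<forall>\<delta>>0. \<exists>K. \<forall>x\<ge>1.
    \<bar>psum f x - x * poly P (ln x)\<bar> \<le> K * x powr (1 - 1 / (q + real t) + \<delta>))"
proof -
  define \<theta> where "\<theta> = 1 - 1 / q"
  have q': "1 / q \<le> 1 / 2" "1 / q > 0" using q by (auto simp: field_simps)
  then have \<theta>: "1 / 2 \<le> \<theta>" "\<theta> < 1" "1 - \<theta> = 1 / q" by (auto simp: \<theta>_def)
  define g where "g = (dsum_inv ^^ Suc t) f"
  have g: "multiplicative g" unfolding g_def by (rule multiplicative_dsum_inv_funpow[OF f])
  have gp: "g p = 0" if "prime p" for p unfolding g_def using dsum_inv_funpow_prime[OF that f, of "Suc t"] fp[OF that] by simp
  have fb': "\<bar>f (p ^ k)\<bar> \<le> C * real (k + 1) ^ r * real p powr (\<theta> * real k - 1)" if "prime p" "k \<ge> 2" for p k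
    using fb[OF that] f0 by (simp add: \<theta>_def)
  obtain C' where C': "\<And>p k. prime p \<Longrightarrow> k \<ge> 2 \<Longrightarrow>
      \<bar>g (p ^ k)\<bar> \<le> C' * real (k + 1) ^ r * real p powr (\<theta> * real k - 1)"
    using dsum_inv_funpow_bound[OF f fp \<theta>(1) fb', of "Suc t"] unfolding g_def by blast
  have gs: "\<exists>K\<ge>0. \<forall>N. (\<Sum>n\<in>{1..N}. \<bar>g n\<bar> * real n powr (- \<sigma>)) \<le> K" if "\<sigma> > \<theta>" for \<sigma>
    by (rule abs_dirichlet_series_bounded[OF g gp C' that])
  have \<theta>0: "0 \<le> \<theta>" using \<theta> by simp
  have "log_poly_asymp 1 (1 / q) (\<lambda>x. psum (dsum g) x / x)" "subpoly_avg (dsum g)"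
    using log_poly_asymp_psum_dsum_abs_conv[OF \<theta>0 \<theta>(2) gs] \<theta>(3) subpoly_avg_dsum by auto
  from log_poly_asymp_psum_dsum_funpow[OF this, of t] q
  have "log_poly_asymp (Suc t) (1 / (q + real t)) (\<lambda>x. psum ((dsum ^^ t) (dsum g)) x / x)" by simp
  moreover have "psum ((dsum ^^ t) (dsum g)) x = psum f x" for x
  proof (rule psum_cong)
    fix n :: nat assume "n > 0"
    from dsum_funpow_dsum_inv_funpow[OF f this, of "Suc t"]
    show "(dsum ^^ t) (dsum g) n = f n" unfolding g_def by (subst (asm) funpow_Suc_right) simp
  qed
  ultimately have "log_poly_asymp (Suc t) (1 / (q + real t)) (\<lambda>x. psum f x / x)" by simp
  then obtain c where c: "\<And>\<delta>. \<delta> > 0 \<Longrightarrow> \<exists>K. \<forall>x\<ge>1.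
      \<bar>psum f x / x - (\<Sum>i<Suc t. c i * ln x ^ i)\<bar> \<le> K * x powr (- (1 / (q + real t)) + \<delta>)"
    unfolding log_poly_asymp_def by blast
  have "c t \<noteq> 0"
  proof
    assume ct: "c t = 0"
    \<comment> \<open>Taking \<delta> equal to the whole saving leaves a bounded error, all that is
      needed against (1 + ln x)^(t-1).\<close>
    have "1 / (q + real t) > 0" using q by simp
    from c[OF this] obtain K where K: "\<And>x. x \<ge> 1 \<Longrightarrow> \<bar>psum f x / x - (\<Sum>i<Suc t. c i * ln x ^ i)\<bar> \<le> K"
      by auto
    have "psum f x \<le> (K + (\<Sum>i<t. \<bar>c i\<bar>)) * x * (1 + ln x) ^ (t - 1)" if x: "x \<ge> 1" for x
    proof -
      have l: "1 + ln x \<ge> 1" using x by simp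
      have "(\<Sum>i<t. c i * ln x ^ i) \<le> (\<Sum>i<t. \<bar>c i\<bar> * (1 + ln x) ^ (t - 1))"
      proof (rule sum_mono)
        fix i assume "i \<in> {..<t}"
        then have "(1 + ln x) ^ i \<le> (1 + ln x) ^ (t - 1)" using l by (intro power_increasing) auto
        moreover have "ln x ^ i \<le> (1 + ln x) ^ i" using x by (intro power_mono) auto
        ultimately show "c i * ln x ^ i \<le> \<bar>c i\<bar> * (1 + ln x) ^ (t - 1)"
          using x by (intro mult_mono) auto
      qed
      moreover have "psum f x / x - (\<Sum>i<t. c i * ln x ^ i) \<le> K" using K[OF x] ct by simp
      moreover have "K \<ge> 0" using K[of 1] by linarith
      then have "K * 1 \<le> K * (1 + ln x) ^ (t - 1)" using l by (intro mult_left_mono one_le_power) auto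
      ultimately have "psum f x / x \<le> K * (1 + ln x) ^ (t - 1) + (\<Sum>i<t. \<bar>c i\<bar> * (1 + ln x) ^ (t - 1))"
        by simp
      also have "\<dots> = (K + (\<Sum>i<t. \<bar>c i\<bar>)) * (1 + ln x) ^ (t - 1)"
        by (simp add: distrib_right sum_distrib_right)
      finally show ?thesis using x by (simp add: pos_divide_le_eq mult_ac)
    qed
    from psum_not_small[OF f f0 fp this t] show False by simp
  qed
  define P where "P = (\<Sum>i<Suc t. Polynomial.monom (c i) i)"
  have coeffP: "Polynomial.coeff P n = (if n < Suc t then c n else 0)" for n
    unfolding P_def coeff_sum by (simp add: sum.delta' coeff_monom)
  have "degree P = t"
    using \<open>c t \<noteq> 0\<close> by (intro antisym degree_le le_degree) (auto simp: coeffP)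
  moreover have polyP: "poly P y = (\<Sum>i<Suc t. c i * y ^ i)" for y
    unfolding P_def poly_sum by (simp add: poly_monom)
  moreover have "\<exists>K. \<forall>x\<ge>1. \<bar>psum f x - x * poly P (ln x)\<bar> \<le> K * x powr (1 - 1 / (q + real t) + \<delta>)"
    if \<delta>: "\<delta> > 0" for \<delta>
  proof -
    from c[OF \<delta>] obtain K where K: "\<And>x. x \<ge> 1 \<Longrightarrow>
      \<bar>psum f x / x - poly P (ln x)\<bar> \<le> K * x powr (- (1 / (q + real t)) + \<delta>)" unfolding polyP by blast
    have "\<bar>psum f x - x * poly P (ln x)\<bar> \<le> K * x powr (1 - 1 / (q + real t) + \<delta>)" if x: "x \<ge> 1" for x
    proof -
      have "psum f x - x * poly P (ln x) = x * (psum f x / x - poly P (ln x))"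
        using x by (simp add: right_diff_distrib)
      then have "\<bar>psum f x - x * poly P (ln x)\<bar> = x * \<bar>psum f x / x - poly P (ln x)\<bar>"
        using x by (simp add: abs_mult)
      also have "\<dots> \<le> x powr 1 * (K * x powr (- (1 / (q + real t)) + \<delta>))"
        using K[OF x] x by (simp add: mult_left_mono)
      also have "\<dots> = K * x powr (1 + (- (1 / (q + real t)) + \<delta>))" by (simp only: powr_add mult_ac)
      finally show ?thesis by (simp add: algebra_simps)
    qed
    then show ?thesis by blast
  qed
  ultimately show ?thesis by blast
qed

section \<open>Multiplicatively closed lattices\<close>

text \<open>Subgroups of the integers are cyclic. Using \<open>Gcd\<close> as generator gives a
  canonical nonnegative choice, with 0 for the trivial subgroup.\<close>

lemma int_subgroup_mem_iff:
  fixes P :: "int set"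
  assumes "0 \<in> P" "\<And>x y. x \<in> P \<Longrightarrow> y \<in> P \<Longrightarrow> x - y \<in> P"
  shows "x \<in> P \<longleftrightarrow> Gcd P dvd x"
proof
  have neg: "- x \<in> P" if "x \<in> P" for x using assms(2)[OF assms(1) that] by simp
  have add: "x + y \<in> P" if "x \<in> P" "y \<in> P" for x y using assms(2)[OF that(1) neg[OF that(2)]] by simp
  have nmult: "int k * x \<in> P" if "x \<in> P" for k x
    by (induction k) (use assms(1) add that in \<open>auto simp: distrib_right\<close>)
  have mult: "k * x \<in> P" if "x \<in> P" for k x
    by (cases k rule: int_cases2) (use nmult neg that in auto)
  show "Gcd P dvd x" if "x \<in> P" using that by (rule Gcd_dvd)
  show "x \<in> P" if dv: "Gcd P dvd x"
  proof (cases "P \<subseteq> {0}")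
    case True
    then have "Gcd P = 0" by (simp add: Gcd_0_iff)
    then show ?thesis using dv assms(1) by (metis dvd_0_left_iff)
  next
    case False
    then obtain y where "y \<in> P" "y \<noteq> 0" by auto
    then have "\<exists>d. 0 < d \<and> int d \<in> P" using neg[of y]
      by (intro exI[of _ "nat \<bar>y\<bar>"]) (auto simp: abs_if)
    then have ex: "\<exists>d. 0 < d \<and> int d \<in> P" .
    define d where "d = (LEAST d. 0 < d \<and> int d \<in> P)"
    have d: "0 < d" "int d \<in> P" using LeastI_ex[OF ex] by (auto simp: d_def)
    have "int d dvd y" if "y \<in> P" for y
    proof (rule ccontr)
      assume "\<not> int d dvd y"
      then have ne: "y mod int d \<noteq> 0" by (simp add: dvd_eq_mod_eq_0)
      have "y mod int d = y - (y div int d) * int d" by (simp add: minus_div_mult_eq_mod)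
      then have "y mod int d \<in> P" using assms(2)[OF that mult[OF d(2)]] by metis
      moreover have "0 \<le> y mod int d" "y mod int d < int d" using d(1) by auto
      ultimately have "0 < nat (y mod int d) \<and> int (nat (y mod int d)) \<in> P" using ne by auto
      then have "d \<le> nat (y mod int d)" unfolding d_def by (rule Least_le)
      with \<open>y mod int d < int d\<close> \<open>0 \<le> y mod int d\<close> show False by linarith
    qed
    then have "int d dvd Gcd P" by (rule Gcd_greatest)
    then have "int d dvd x" using dv by (rule dvd_trans)
    then show ?thesis using mult[OF d(2)] by (auto simp: mult.commute elim!: dvdE)
  qed
qed

lemma Gcd_multiples: "d \<ge> 0 \<Longrightarrow> Gcd {x::int. d dvd x} = d"
  by (rule associated_eqI) (auto intro: Gcd_dvd Gcd_greatest)

text \<open>An arbitrary subgroup; full rank is expressed separately by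
  \<open>ind3 L > 0\<close>.\<close>

definition lattice3 :: "(int \<times> int \<times> int) set \<Rightarrow> bool" where
  "lattice3 L \<longleftrightarrow> (0, 0, 0) \<in> L \<and>
    (\<forall>a b c a' b' c'. (a, b, c) \<in> L \<longrightarrow> (a', b', c') \<in> L \<longrightarrow> (a - a', b - b', c - c') \<in> L)"

definition mult_closed3 :: "(int \<times> int \<times> int) set \<Rightarrow> bool" where
  "mult_closed3 L \<longleftrightarrow>
    (\<forall>a b c a' b' c'. (a, b, c) \<in> L \<longrightarrow> (a', b', c') \<in> L \<longrightarrow> (a * a', b * b', c * c') \<in> L)"

lemma
  assumes "lattice3 L"
  shows lattice3_zero: "(0, 0, 0) \<in> L"
    and lattice3_diff: "(a, b, c) \<in> L \<Longrightarrow> (a', b', c') \<in> L \<Longrightarrow> (a - a', b - b', c - c') \<in> L"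
    and lattice3_add: "(a, b, c) \<in> L \<Longrightarrow> (a', b', c') \<in> L \<Longrightarrow> (a + a', b + b', c + c') \<in> L"
    and lattice3_scale: "(a, b, c) \<in> L \<Longrightarrow> (k * a, k * b, k * c) \<in> L"
proof -
  show z: "(0, 0, 0) \<in> L" using assms by (auto simp: lattice3_def)
  show df: "(a, b, c) \<in> L \<Longrightarrow> (a', b', c') \<in> L \<Longrightarrow> (a - a', b - b', c - c') \<in> L" for a b c a' b' c'
    using assms by (auto simp: lattice3_def)
  have neg: "(- a, - b, - c) \<in> L" if "(a, b, c) \<in> L" for a b c using df[OF z that] by simp
  show add: "(a, b, c) \<in> L \<Longrightarrow> (a', b', c') \<in> L \<Longrightarrow> (a + a', b + b', c + c') \<in> L" for a b c a' b' c'
    using df[of a b c, OF _ neg[of a' b' c']] by simp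
  have nat: "(int k * a, int k * b, int k * c) \<in> L" if "(a, b, c) \<in> L" for k
    by (induction k) (use z add[OF that] in \<open>auto simp: distrib_right\<close>)
  show "(a, b, c) \<in> L \<Longrightarrow> (k * a, k * b, k * c) \<in> L"
    using nat neg by (cases k rule: int_cases2) fastforce+
qed

text \<open>Leading coordinates along the flag of sublattices whose first 0, 1 or 2 coordinates
  vanish. Each is a subgroup of the integers, generated by a diagonal entry of the Hermite
  form.\<close>

definition proj1 :: "(int \<times> int \<times> int) set \<Rightarrow> int set" where "proj1 L = {a. \<exists>b c. (a, b, c) \<in> L}"
definition proj2 :: "(int \<times> int \<times> int) set \<Rightarrow> int set" where "proj2 L = {b. \<exists>c. (0, b, c) \<in> L}"
definition proj3 :: "(int \<times> int \<times> int) set \<Rightarrow> int set" where "proj3 L = {c. (0, 0, c) \<in> L}"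

text \<open>The factors are the diagonal entries of the Hermite normal form; a lattice of infinite index gets the
  value 0.\<close>

definition ind3 :: "(int \<times> int \<times> int) set \<Rightarrow> int" where
  "ind3 L = Gcd (proj1 L) * Gcd (proj2 L) * Gcd (proj3 L)"

lemma proj_mem_iff:
  assumes "lattice3 L"
  shows "a \<in> proj1 L \<longleftrightarrow> Gcd (proj1 L) dvd a" "a \<in> proj2 L \<longleftrightarrow> Gcd (proj2 L) dvd a"
    "a \<in> proj3 L \<longleftrightarrow> Gcd (proj3 L) dvd a"
proof -
  note L = lattice3_zero[OF assms] lattice3_diff[OF assms]
  show "a \<in> proj1 L \<longleftrightarrow> Gcd (proj1 L) dvd a"
    by (rule int_subgroup_mem_iff) (use L in \<open>unfold proj1_def, blast+\<close>)
  show "a \<in> proj2 L \<longleftrightarrow> Gcd (proj2 L) dvd a"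
  proof (rule int_subgroup_mem_iff)
    show "0 \<in> proj2 L" using L(1) by (auto simp: proj2_def)
    show "x - y \<in> proj2 L" if "x \<in> proj2 L" "y \<in> proj2 L" for x y
      using that L(2)[of 0 x _ 0 y] by (fastforce simp: proj2_def)
  qed
  show "a \<in> proj3 L \<longleftrightarrow> Gcd (proj3 L) dvd a"
  proof (rule int_subgroup_mem_iff)
    show "0 \<in> proj3 L" using L(1) by (auto simp: proj3_def)
    show "x - y \<in> proj3 L" if "x \<in> proj3 L" "y \<in> proj3 L" for x y
      using that L(2)[of 0 0 x 0 0 y] by (simp add: proj3_def)
  qed
qed

text \<open>The row span of the triangular matrix with rows (d1, x, y), (0, d2, z) and (0, 0,
  d3).\<close>

definition hnf :: "int \<Rightarrow> int \<Rightarrow> int \<Rightarrow> int \<Rightarrow> int \<Rightarrow> int \<Rightarrow> (int \<times> int \<times> int) set" where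
  "hnf d1 d2 d3 x y z = {(a * d1, a * x + b * d2, a * y + b * z + c * d3) | a b c. True}"

lemma hnf_mem_iff:
  "(u, v, w) \<in> hnf d1 d2 d3 x y z \<longleftrightarrow>
    (\<exists>a b c. u = a * d1 \<and> v = a * x + b * d2 \<and> w = a * y + b * z + c * d3)"
  by (auto simp: hnf_def)

lemma lattice3_hnf: "lattice3 (hnf d1 d2 d3 x y z)"
  unfolding lattice3_def
proof (intro conjI allI impI)
  show "(0, 0, 0) \<in> hnf d1 d2 d3 x y z"
    unfolding hnf_mem_iff by (intro exI[of _ 0]) simp
  fix u v w u' v' w' assume "(u, v, w) \<in> hnf d1 d2 d3 x y z" "(u', v', w') \<in> hnf d1 d2 d3 x y z"
  then obtain a b c a' b' c' where
    "u = a * d1" "v = a * x + b * d2" "w = a * y + b * z + c * d3"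
    "u' = a' * d1" "v' = a' * x + b' * d2" "w' = a' * y + b' * z + c' * d3"
    unfolding hnf_mem_iff by blast
  then show "(u - u', v - v', w - w') \<in> hnf d1 d2 d3 x y z"
    unfolding hnf_mem_iff
    by (intro exI[of _ "a - a'"] exI[of _ "b - b'"] exI[of _ "c - c'"]) (simp add: algebra_simps)
qed

lemma hnf_generators:
  "(d1, x, y) \<in> hnf d1 d2 d3 x y z" "(0, d2, z) \<in> hnf d1 d2 d3 x y z" "(0, 0, d3) \<in> hnf d1 d2 d3 x y z"
  unfolding hnf_mem_iff
  by (rule exI[of _ 1], rule exI[of _ 0], rule exI[of _ 0], simp,
      rule exI[of _ 0], rule exI[of _ 1], rule exI[of _ 0], simp,
      rule exI[of _ 0], rule exI[of _ 0], rule exI[of _ 1], simp)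

lemma Gcd_proj_hnf:
  assumes "d1 > 0" "d2 > 0" "d3 > 0"
  shows "Gcd (proj1 (hnf d1 d2 d3 x y z)) = d1" "Gcd (proj2 (hnf d1 d2 d3 x y z)) = d2"
    "Gcd (proj3 (hnf d1 d2 d3 x y z)) = d3"
proof -
  have "proj1 (hnf d1 d2 d3 x y z) = {a. d1 dvd a}"
    by (auto simp: proj1_def hnf_mem_iff dvd_def mult.commute) blast
  then show "Gcd (proj1 (hnf d1 d2 d3 x y z)) = d1" using assms by (simp add: Gcd_multiples)
  have "proj2 (hnf d1 d2 d3 x y z) = {a. d2 dvd a}"
    using assms by (auto simp: proj2_def hnf_mem_iff dvd_def mult.commute)
  then show "Gcd (proj2 (hnf d1 d2 d3 x y z)) = d2" using assms by (simp add: Gcd_multiples)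
  have "proj3 (hnf d1 d2 d3 x y z) = {a. d3 dvd a}"
    using assms by (auto simp: proj3_def hnf_mem_iff dvd_def mult.commute)
  then show "Gcd (proj3 (hnf d1 d2 d3 x y z)) = d3" using assms by (simp add: Gcd_multiples)
qed

text \<open>Integer elimination from the bottom row upwards: z is reduced modulo d3, then x modulo
  d2 by the reduced second row, and finally the value \<open>y1\<close> that this leaves in the last
  column.\<close>

lemma lattice3_eq_hnf:
  assumes L: "lattice3 L" and ind: "ind3 L > 0"
  obtains d1 d2 d3 x y z where "d1 > 0" "d2 > 0" "d3 > 0" "0 \<le> x" "x < d2" "0 \<le> y" "y < d3" "0 \<le> z" "z < d3"
    "L = hnf d1 d2 d3 x y z" "ind3 L = d1 * d2 * d3"
proof -
  define d1 d2 d3 where d: "d1 = Gcd (proj1 L)" "d2 = Gcd (proj2 L)" "d3 = Gcd (proj3 L)"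
  have "d1 \<ge> 0" "d2 \<ge> 0" "d3 \<ge> 0" by (simp_all add: d)
  moreover have "d1 * d2 * d3 > 0" using ind by (simp only: d ind3_def)
  then have "d1 \<noteq> 0" "d2 \<noteq> 0" "d3 \<noteq> 0" by auto
  ultimately have pos: "d1 > 0" "d2 > 0" "d3 > 0" by auto
  note mem = proj_mem_iff[OF L, folded d]
  obtain x0 y0 where v1: "(d1, x0, y0) \<in> L" using mem(1)[of d1] by (auto simp: proj1_def)
  obtain z0 where v2: "(0, d2, z0) \<in> L" using mem(2)[of d2] by (auto simp: proj2_def)
  have v3: "(0, 0, d3) \<in> L" using mem(3)[of d3] by (auto simp: proj3_def)
  define z where "z = z0 mod d3"
  define x where "x = x0 mod d2"
  define y1 where "y1 = y0 - (x0 div d2) * z"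
  define y where "y = y1 mod d3"
  have w2: "(0, d2, z) \<in> L"
    using lattice3_diff[OF L v2 lattice3_scale[OF L v3, of "z0 div d3"]]
    by (simp add: z_def minus_div_mult_eq_mod)
  have "(d1, x, y1) \<in> L"
    using lattice3_diff[OF L v1 lattice3_scale[OF L w2, of "x0 div d2"]]
    by (simp add: x_def y1_def minus_div_mult_eq_mod)
  from lattice3_diff[OF L this lattice3_scale[OF L v3, of "y1 div d3"]]
  have w1: "(d1, x, y) \<in> L" by (simp add: y_def minus_div_mult_eq_mod)
  have "L = hnf d1 d2 d3 x y z"
  proof (intro equalityI subsetI)
    fix t assume t: "t \<in> L"
    obtain u v w where uvw: "t = (u, v, w)" by (cases t) auto
    have "u \<in> proj1 L" using t uvw by (auto simp: proj1_def)
    then obtain a where a: "u = a * d1" unfolding mem by (metis dvdE mult.commute)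
    have 1: "(0, v - a * x, w - a * y) \<in> L"
      using lattice3_diff[OF L t[unfolded uvw] lattice3_scale[OF L w1, of a]] a by simp
    then have "v - a * x \<in> proj2 L" by (auto simp: proj2_def)
    then obtain b where b: "v - a * x = b * d2" unfolding mem by (metis dvdE mult.commute)
    have "(0, 0, w - a * y - b * z) \<in> L"
      using lattice3_diff[OF L 1 lattice3_scale[OF L w2, of b]] b by simp
    then have "w - a * y - b * z \<in> proj3 L" by (auto simp: proj3_def)
    then obtain c where c: "w - a * y - b * z = c * d3" unfolding mem by (metis dvdE mult.commute)
    show "t \<in> hnf d1 d2 d3 x y z" unfolding uvw hnf_mem_iff
      by (intro exI[of _ a] exI[of _ b] exI[of _ c]) (use a b c in \<open>auto simp: algebra_simps\<close>)
  next
    fix t assume "t \<in> hnf d1 d2 d3 x y z"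
    then obtain a b c where t: "t = (a * d1, a * x + b * d2, a * y + b * z + c * d3)" by (auto simp: hnf_def)
    show "t \<in> L" unfolding t
      using lattice3_add[OF L lattice3_add[OF L lattice3_scale[OF L w1, of a] lattice3_scale[OF L w2, of b]]
          lattice3_scale[OF L v3, of c]] by simp
  qed
  moreover have "ind3 L = d1 * d2 * d3" by (simp add: ind3_def d)
  ultimately show thesis using that[of d1 d2 d3 x y z] pos by (auto simp: x_def y_def z_def)
qed

lemma multiple_eq_0_if_small:
  fixes s t b d :: int
  assumes "s = t + b * d" "0 \<le> s" "s < d" "0 \<le> t" "t < d"
  shows "b = 0"
proof -
  have "s mod d = t mod d" using assms(1) by simp
  then have "s = t" using assms(2-5) by (metis mod_pos_pos_trivial)
  then have "b * d = 0" using assms(1) by linarith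
  moreover have "d \<noteq> 0" using assms by linarith
  ultimately show ?thesis by simp
qed

lemma hnf_inject:
  assumes "d1 > 0" "0 \<le> x" "x < d2" "0 \<le> y" "y < d3" "0 \<le> z" "z < d3"
    and "0 \<le> x'" "x' < d2" "0 \<le> y'" "y' < d3" "0 \<le> z'" "z' < d3"
    and eq: "hnf d1 d2 d3 x y z = hnf d1 d2 d3 x' y' z'"
  shows "x = x' \<and> y = y' \<and> z = z'"
proof -
  have "(d1, x, y) \<in> hnf d1 d2 d3 x' y' z'" using eq hnf_generators(1) by blast
  then obtain a b c where "d1 = a * d1" "x = a * x' + b * d2" "y = a * y' + b * z' + c * d3"
    unfolding hnf_mem_iff by blast
  then have 1: "x = x' + b * d2" "y = y' + b * z' + c * d3" using assms(1) by auto
  have "b = 0" using multiple_eq_0_if_small[OF 1(1)] assms by auto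
  moreover from this have "c = 0" using multiple_eq_0_if_small[of y y' c d3] 1(2) assms by auto
  ultimately have xy: "x = x'" "y = y'" using 1 by auto
  have "(0, d2, z) \<in> hnf d1 d2 d3 x' y' z'" using eq hnf_generators(2) by blast
  then obtain a b c where "0 = a * d1" "d2 = a * x' + b * d2" "z = a * y' + b * z' + c * d3"
    unfolding hnf_mem_iff by blast
  then have "z = z' + c * d3" using assms by auto
  with multiple_eq_0_if_small[OF this] assms have "z = z'" by auto
  with xy show ?thesis by simp
qed

text \<open>Closure of the rows v1, v2, v3 under products. The first and last conditions put v1 v1
  in the span, after subtracting d1 v1 and the right multiple of v2; the second is v2 v2 - d2 v2,
  the third v1 v2 - x v2. Products with v3 are multiples of v3.\<close>

definition hnf_ring_cond :: "int \<Rightarrow> int \<Rightarrow> int \<Rightarrow> int \<Rightarrow> int \<Rightarrow> int \<Rightarrow> bool" where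
  "hnf_ring_cond d1 d2 d3 x y z \<longleftrightarrow> d2 dvd x * (x - d1) \<and> d3 dvd z * (z - d2) \<and> d3 dvd z * (y - x) \<and>
     d3 dvd y * (y - d1) - (x * (x - d1) div d2) * z"

lemma mult_closed3_hnf_iff:
  assumes "d1 > 0" "d2 > 0" "d3 > 0"
  shows "mult_closed3 (hnf d1 d2 d3 x y z) \<longleftrightarrow> hnf_ring_cond d1 d2 d3 x y z"
proof
  assume cl: "mult_closed3 (hnf d1 d2 d3 x y z)"
  have "(d1 * d1, x * x, y * y) \<in> hnf d1 d2 d3 x y z"
    using cl hnf_generators(1) unfolding mult_closed3_def by blast
  then obtain a b c where 1: "d1 * d1 = a * d1" "x * x = a * x + b * d2" "y * y = a * y + b * z + c * d3"
    unfolding hnf_mem_iff by blast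
  then have a: "a = d1" using assms by simp
  have m: "x * (x - d1) = b * d2" using 1(2) a by (simp add: algebra_simps)
  then have "x * (x - d1) div d2 = b" using assms by simp
  moreover have "y * (y - d1) - b * z = c * d3" using 1(3) a by (simp add: algebra_simps)
  ultimately have A: "d2 dvd x * (x - d1)" "d3 dvd y * (y - d1) - (x * (x - d1) div d2) * z"
    using m by auto
  have "(d1 * 0, x * d2, y * z) \<in> hnf d1 d2 d3 x y z"
    using cl hnf_generators(1,2) unfolding mult_closed3_def by blast
  then obtain a b c where 1: "d1 * 0 = a * d1" "x * d2 = a * x + b * d2" "y * z = a * y + b * z + c * d3"
    unfolding hnf_mem_iff by blast
  then have "a = 0" "b = x" using assms by auto
  then have "z * (y - x) = c * d3" using 1(3) by (simp add: algebra_simps)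
  then have B: "d3 dvd z * (y - x)" by simp
  have "(0 * 0, d2 * d2, z * z) \<in> hnf d1 d2 d3 x y z"
    using cl hnf_generators(2) unfolding mult_closed3_def by blast
  then obtain a b c where 1: "0 * 0 = a * d1" "d2 * d2 = a * x + b * d2" "z * z = a * y + b * z + c * d3"
    unfolding hnf_mem_iff by blast
  then have "a = 0" "b = d2" using assms by auto
  then have "z * (z - d2) = c * d3" using 1(3) by (simp add: algebra_simps)
  then have "d3 dvd z * (z - d2)" by simp
  with A B show "hnf_ring_cond d1 d2 d3 x y z" by (simp add: hnf_ring_cond_def)
next
  assume "hnf_ring_cond d1 d2 d3 x y z"
  then obtain m k1 k2 k3 where m: "x * (x - d1) = d2 * m" and k3: "z * (z - d2) = d3 * k3"
    and k2: "z * (y - x) = d3 * k2" and k1: "y * (y - d1) - (x * (x - d1) div d2) * z = d3 * k1"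
    unfolding hnf_ring_cond_def by (elim conjE dvdE) blast
  have "x * (x - d1) div d2 = m" using m assms by simp
  with k1 have yy: "y * y = d1 * y + m * z + d3 * k1" by (simp add: algebra_simps)
  have xx: "x * x = d1 * x + d2 * m" and yz: "y * z = x * z + d3 * k2" and zz: "z * z = d2 * z + d3 * k3"
    using m k2 k3 by (simp_all add: algebra_simps)
  show "mult_closed3 (hnf d1 d2 d3 x y z)"
    unfolding mult_closed3_def
  proof (intro allI impI)
    fix u v w u' v' w' assume "(u, v, w) \<in> hnf d1 d2 d3 x y z" "(u', v', w') \<in> hnf d1 d2 d3 x y z"
    then obtain a b c a' b' c' where e:
      "u = a * d1" "v = a * x + b * d2" "w = a * y + b * z + c * d3"
      "u' = a' * d1" "v' = a' * x + b' * d2" "w' = a' * y + b' * z + c' * d3"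
      unfolding hnf_mem_iff by blast
    show "(u * u', v * v', w * w') \<in> hnf d1 d2 d3 x y z"
      unfolding hnf_mem_iff
    proof (intro exI conjI)
      \<comment> \<open>The witnesses arise by expanding the product of a v1 + b v2 + c v3 and a' v1
        + b' v2 + c' v3 and rewriting each product of rows in terms of the rows.\<close>
      show "u * u' = (a * a' * d1) * d1" using e by simp
      show "v * v' = (a * a' * d1) * x + (a * a' * m + (a * b' + a' * b) * x + b * b' * d2) * d2"
      proof -
        have "v * v' = a * a' * (x * x) + (a * b' + a' * b) * x * d2 + b * b' * d2 * d2"
          by (simp add: e algebra_simps)
        then show ?thesis unfolding xx by (simp add: algebra_simps)
      qed
      show "w * w' = (a * a' * d1) * y + (a * a' * m + (a * b' + a' * b) * x + b * b' * d2) * z +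
          (a * a' * k1 + (a * b' + a' * b) * k2 + b * b' * k3 + c * (a' * y + b' * z) + c' * (a * y + b * z) + c * c' * d3) * d3"
      proof -
        have "w * w' = a * a' * (y * y) + (a * b' + a' * b) * (y * z) + b * b' * (z * z) +
            (c * (a' * y + b' * z) + c' * (a * y + b * z) + c * c' * d3) * d3"
          by (simp add: e algebra_simps)
        then show ?thesis unfolding yy yz zz by (simp add: algebra_simps)
      qed
    qed
  qed
qed

text \<open>The index annihilates the quotient. The witnesses are read off from the adjugate of the
  triangular matrix.\<close>

lemma ind3_scale_mem:
  assumes L: "lattice3 L" and ind: "ind3 L > 0"
  shows "(ind3 L * a, ind3 L * b, ind3 L * c) \<in> L"
proof -
  obtain d1 d2 d3 x y z where h: "L = hnf d1 d2 d3 x y z" "ind3 L = d1 * d2 * d3"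
    by (rule lattice3_eq_hnf[OF L ind])
  show ?thesis
    unfolding h(2) unfolding h(1) hnf_mem_iff
    by (intro exI[of _ "d2 * d3 * a"] exI[of _ "d1 * d3 * b - d3 * a * x"]
        exI[of _ "d1 * d2 * c - d2 * a * y - (d1 * b - a * x) * z"])
       (simp add: algebra_simps)
qed

definition ring_lattices :: "nat \<Rightarrow> (int \<times> int \<times> int) set set" where
  "ring_lattices n = {L. lattice3 L \<and> mult_closed3 L \<and> ind3 L = int n}"

definition hnf_params :: "int \<Rightarrow> int \<Rightarrow> int \<Rightarrow> (int \<times> int \<times> int) set" where
  "hnf_params d1 d2 d3 = {(x, y, z). 0 \<le> x \<and> x < d2 \<and> 0 \<le> y \<and> y < d3 \<and> 0 \<le> z \<and> z < d3 \<and>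
    hnf_ring_cond d1 d2 d3 x y z}"

definition hnf_diags :: "nat \<Rightarrow> (int \<times> int \<times> int) set" where
  "hnf_diags n = {(d1, d2, d3). d1 > 0 \<and> d2 > 0 \<and> d3 > 0 \<and> d1 * d2 * d3 = int n}"

lemma finite_hnf_params: "finite (hnf_params d1 d2 d3)"
  by (rule finite_subset[of _ "{0..<d2} \<times> {0..<d3} \<times> {0..<d3}"]) (auto simp: hnf_params_def)

lemma finite_hnf_diags: "finite (hnf_diags n)"
proof (rule finite_subset[of _ "{0..int n} \<times> {0..int n} \<times> {0..int n}"])
  show "hnf_diags n \<subseteq> {0..int n} \<times> {0..int n} \<times> {0..int n}"
  proof (clarsimp simp: hnf_diags_def)
    fix a b c :: int assume pos: "0 < a" "0 < b" "0 < c" and e: "a * b * c = int n"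
    have "int n > 0" using pos e by (metis mult_pos_pos)
    moreover have "a dvd int n" "b dvd int n" "c dvd int n" by (auto simp: e[symmetric])
    ultimately show "a \<le> int n \<and> b \<le> int n \<and> c \<le> int n" by (auto intro: zdvd_imp_le)
  qed
qed auto

lemma bij_betw_hnf_ring_lattices:
  assumes "n > 0"
  shows "bij_betw (\<lambda>((d1, d2, d3), (x, y, z)). hnf d1 d2 d3 x y z)
    (SIGMA (d1, d2, d3) : hnf_diags n. hnf_params d1 d2 d3) (ring_lattices n)"
  unfolding bij_betw_def
proof
  show "inj_on (\<lambda>((d1, d2, d3), (x, y, z)). hnf d1 d2 d3 x y z)
      (SIGMA (d1, d2, d3) : hnf_diags n. hnf_params d1 d2 d3)"
  proof (rule inj_onI)
    fix s t assume s: "s \<in> (SIGMA (d1, d2, d3) : hnf_diags n. hnf_params d1 d2 d3)"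
      and t: "t \<in> (SIGMA (d1, d2, d3) : hnf_diags n. hnf_params d1 d2 d3)"
      and st: "(\<lambda>((d1, d2, d3), (x, y, z)). hnf d1 d2 d3 x y z) s =
        (\<lambda>((d1, d2, d3), (x, y, z)). hnf d1 d2 d3 x y z) t"
    obtain d1 d2 d3 x y z d1' d2' d3' x' y' z' where
      st_eq: "s = ((d1, d2, d3), (x, y, z))" "t = ((d1', d2', d3'), (x', y', z'))"
      by (metis prod.exhaust)
    have d: "(d1, d2, d3) \<in> hnf_diags n" "(d1', d2', d3') \<in> hnf_diags n"
      and p: "(x, y, z) \<in> hnf_params d1 d2 d3" "(x', y', z') \<in> hnf_params d1' d2' d3'"
      and eq: "hnf d1 d2 d3 x y z = hnf d1' d2' d3' x' y' z'" using s t st by (auto simp: st_eq)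
    have pos: "d1 > 0" "d2 > 0" "d3 > 0" "d1' > 0" "d2' > 0" "d3' > 0" using d by (auto simp: hnf_diags_def)
    have de: "d1 = d1'" "d2 = d2'" "d3 = d3'"
      using Gcd_proj_hnf[OF pos(1-3), of x y z] Gcd_proj_hnf[OF pos(4-6), of x' y' z'] eq by auto
    have "x = x' \<and> y = y' \<and> z = z'"
      using p eq pos by (intro hnf_inject[of d1 x d2 y d3 z x' y' z']) (auto simp: hnf_params_def de)
    with de show "s = t" by (simp add: st_eq)
  qed
  show "(\<lambda>((d1, d2, d3), (x, y, z)). hnf d1 d2 d3 x y z) ` (SIGMA (d1, d2, d3) : hnf_diags n. hnf_params d1 d2 d3)
      = ring_lattices n"
  proof (intro equalityI subsetI)
    fix L assume "L \<in> (\<lambda>((d1, d2, d3), (x, y, z)). hnf d1 d2 d3 x y z) ` (SIGMA (d1, d2, d3) : hnf_diags n. hnf_params d1 d2 d3)"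
    then obtain d1 d2 d3 x y z where L: "L = hnf d1 d2 d3 x y z" and d: "(d1, d2, d3) \<in> hnf_diags n"
      and p: "(x, y, z) \<in> hnf_params d1 d2 d3" by auto
    have pos: "d1 > 0" "d2 > 0" "d3 > 0" "d1 * d2 * d3 = int n" using d by (auto simp: hnf_diags_def)
    show "L \<in> ring_lattices n"
      using p pos by (simp add: L ring_lattices_def lattice3_hnf mult_closed3_hnf_iff ind3_def Gcd_proj_hnf hnf_params_def)
  next
    fix L assume "L \<in> ring_lattices n"
    then have L: "lattice3 L" "mult_closed3 L" "ind3 L = int n" by (auto simp: ring_lattices_def)
    then have ind: "ind3 L > 0" using assms by simp
    obtain d1 d2 d3 x y z where h: "d1 > 0" "d2 > 0" "d3 > 0" "0 \<le> x" "x < d2" "0 \<le> y" "y < d3" "0 \<le> z" "z < d3"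
      "L = hnf d1 d2 d3 x y z" "ind3 L = d1 * d2 * d3" by (rule lattice3_eq_hnf[OF L(1) ind])
    have "(d1, d2, d3) \<in> hnf_diags n" using h L(3) by (simp add: hnf_diags_def)
    moreover have "(x, y, z) \<in> hnf_params d1 d2 d3"
      using h L(2) by (simp add: hnf_params_def mult_closed3_hnf_iff)
    ultimately show "L \<in> (\<lambda>((d1, d2, d3), (x, y, z)). hnf d1 d2 d3 x y z) ` (SIGMA (d1, d2, d3) : hnf_diags n. hnf_params d1 d2 d3)"
      using h(10) by (intro image_eqI[of _ _ "((d1, d2, d3), (x, y, z))"]) auto
  qed
qed

lemma finite_ring_lattices:
  assumes "n > 0"
  shows "finite (ring_lattices n)"
proof -
  have "finite (SIGMA (d1, d2, d3) : hnf_diags n. hnf_params d1 d2 d3)"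
    by (intro finite_SigmaI finite_hnf_diags) (auto simp: finite_hnf_params)
  then show ?thesis using bij_betw_finite[OF bij_betw_hnf_ring_lattices[OF assms]] by simp
qed

lemma card_ring_lattices:
  assumes "n > 0"
  shows "card (ring_lattices n) = (\<Sum>(d1, d2, d3)\<in>hnf_diags n. card (hnf_params d1 d2 d3))"
proof -
  have "card (ring_lattices n) = card (SIGMA d : hnf_diags n. (case d of (d1, d2, d3) \<Rightarrow> hnf_params d1 d2 d3))"
    using bij_betw_same_card[OF bij_betw_hnf_ring_lattices[OF assms]] by simp
  also have "\<dots> = (\<Sum>d\<in>hnf_diags n. card (case d of (d1, d2, d3) \<Rightarrow> hnf_params d1 d2 d3))"
    by (rule card_SigmaI) (auto simp: finite_hnf_diags finite_hnf_params)
  finally show ?thesis by (simp add: case_prod_unfold)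
qed

section \<open>Splitting a lattice along coprime factors of its index\<close>

lemma lattice3_Int: "lattice3 L \<Longrightarrow> lattice3 M \<Longrightarrow> lattice3 (L \<inter> M)"
  by (auto simp: lattice3_def)

lemma mult_closed3_Int: "mult_closed3 L \<Longrightarrow> mult_closed3 M \<Longrightarrow> mult_closed3 (L \<inter> M)"
  by (auto simp: mult_closed3_def)

lemma coprime_combination:
  assumes "coprime (m::int) n"
  obtains u v where "u * m + v * n = 1"
  using bezout_int[of m n] assms by (auto simp: coprime_iff_gcd_eq_1)

text \<open>The Chinese remainder theorem: elements of L and M with the same leading coordinate
  combine to an element of the intersection with that leading coordinate, so the projections commute
  with intersection. The generators for L divide m and those for M divide n, hence they are coprime
  and multiply.\<close>

lemma ind3_Int:
  assumes L: "lattice3 L" and M: "lattice3 M" and cop: "coprime m n"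
    and mL: "\<And>a b c. (m * a, m * b, m * c) \<in> L" and nM: "\<And>a b c. (n * a, n * b, n * c) \<in> M"
  shows "ind3 (L \<inter> M) = ind3 L * ind3 M" "ind3 L dvd m ^ 3" "ind3 M dvd n ^ 3"
proof -
  obtain u v where uv: "u * m + v * n = 1" by (rule coprime_combination[OF cop])
  have comb: "(v * n * a + u * m * a', v * n * b + u * m * b', v * n * c + u * m * c') \<in> L \<inter> M"
    if "(a, b, c) \<in> L" "(a', b', c') \<in> M" for a b c a' b' c'
    using lattice3_add[OF L lattice3_scale[OF L that(1), of "v * n"] lattice3_scale[OF L mL, of u a' b' c']]
      lattice3_add[OF M lattice3_scale[OF M nM, of v a b c] lattice3_scale[OF M that(2), of "u * m"]]
    by (simp add: mult.assoc)
  have comb1: "v * n * a + u * m * a = a" for a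
  proof -
    have "v * n * a + u * m * a = (u * m + v * n) * a" by (simp add: algebra_simps)
    then show ?thesis using uv by simp
  qed
  have p1: "proj1 (L \<inter> M) = proj1 L \<inter> proj1 M"
  proof (intro equalityI subsetI)
    fix a assume "a \<in> proj1 L \<inter> proj1 M"
    then obtain b c b' c' where "(a, b, c) \<in> L" "(a, b', c') \<in> M" by (auto simp: proj1_def)
    from comb[OF this] show "a \<in> proj1 (L \<inter> M)" unfolding comb1 by (auto simp: proj1_def)
  qed (auto simp: proj1_def)
  have p2: "proj2 (L \<inter> M) = proj2 L \<inter> proj2 M"
  proof (intro equalityI subsetI)
    fix a assume "a \<in> proj2 L \<inter> proj2 M"
    then obtain c c' where "(0, a, c) \<in> L" "(0, a, c') \<in> M" by (auto simp: proj2_def)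
    from comb[OF this] show "a \<in> proj2 (L \<inter> M)" unfolding comb1 by (auto simp: proj2_def)
  qed (auto simp: proj2_def)
  have p3: "proj3 (L \<inter> M) = proj3 L \<inter> proj3 M" by (auto simp: proj3_def)
  have lcm: "Gcd (P \<inter> Q) = Gcd P * Gcd Q \<and> Gcd P dvd m \<and> Gcd Q dvd n"
    if P: "\<And>a. a \<in> P \<longleftrightarrow> Gcd P dvd a" and Q: "\<And>a. a \<in> Q \<longleftrightarrow> Gcd Q dvd a" and "m \<in> P" "n \<in> Q" for P Q
  proof -
    have dv: "Gcd P dvd m" "Gcd Q dvd n" using that by auto
    then have cp: "coprime (Gcd P) (Gcd Q)" using cop by (meson coprime_divisors)
    have "a \<in> P \<inter> Q \<longleftrightarrow> Gcd P * Gcd Q dvd a" for a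
      using P[of a] Q[of a] cp by (metis IntD1 IntD2 IntI divides_mult dvd_mult_left dvd_mult_right)
    then have "P \<inter> Q = {a. Gcd P * Gcd Q dvd a}" by blast
    then have "Gcd (P \<inter> Q) = Gcd {a. Gcd P * Gcd Q dvd a}" by (rule arg_cong)
    also have "\<dots> = Gcd P * Gcd Q" by (rule Gcd_multiples) simp
    finally show ?thesis using dv by simp
  qed
  have m: "m \<in> proj1 L" "m \<in> proj2 L" "m \<in> proj3 L"
    using mL[of 1 0 0] mL[of 0 1 0] mL[of 0 0 1] by (auto simp: proj1_def proj2_def proj3_def)
  have n: "n \<in> proj1 M" "n \<in> proj2 M" "n \<in> proj3 M"
    using nM[of 1 0 0] nM[of 0 1 0] nM[of 0 0 1] by (auto simp: proj1_def proj2_def proj3_def)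
  note l = lcm[OF proj_mem_iff(1)[OF L] proj_mem_iff(1)[OF M] m(1) n(1)]
    lcm[OF proj_mem_iff(2)[OF L] proj_mem_iff(2)[OF M] m(2) n(2)]
    lcm[OF proj_mem_iff(3)[OF L] proj_mem_iff(3)[OF M] m(3) n(3)]
  show "ind3 (L \<inter> M) = ind3 L * ind3 M" unfolding ind3_def p1 p2 p3 using l by (simp only: mult_ac)
  show "ind3 L dvd m ^ 3" unfolding ind3_def power3_eq_cube using l by (intro mult_dvd_mono) auto
  show "ind3 M dvd n ^ 3" unfolding ind3_def power3_eq_cube using l by (intro mult_dvd_mono) auto
qed

text \<open>The colon lattice (L : n). If L contains m n times everything with m, n coprime, it
  equals L plus m times everything, so it isolates the part of L belonging to m.\<close>

definition lat_quot :: "int \<Rightarrow> (int \<times> int \<times> int) set \<Rightarrow> (int \<times> int \<times> int) set" where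
  "lat_quot n L = {(a, b, c). (n * a, n * b, n * c) \<in> L}"

lemma lattice3_lat_quot: "lattice3 L \<Longrightarrow> lattice3 (lat_quot n L)"
  unfolding lattice3_def lat_quot_def by (auto simp: right_diff_distrib)

text \<open>Multiplying two elements of L gives n^2 a a' where n a a' is wanted; the surplus factor
  n is removed by n = v n^2 + u m n.\<close>

lemma mult_closed3_lat_quot:
  assumes L: "lattice3 L" "mult_closed3 L" and cop: "coprime m n"
    and mn: "\<And>a b c. (m * n * a, m * n * b, m * n * c) \<in> L"
  shows "mult_closed3 (lat_quot n L)"
  unfolding mult_closed3_def lat_quot_def
proof clarsimp
  obtain u v where uv: "u * m + v * n = 1" by (rule coprime_combination[OF cop])
  fix a b c a' b' c' assume "(n * a, n * b, n * c) \<in> L" "(n * a', n * b', n * c') \<in> L"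
  then have "((n * a) * (n * a'), (n * b) * (n * b'), (n * c) * (n * c')) \<in> L"
    using L(2) unfolding mult_closed3_def by blast
  from lattice3_add[OF L(1) lattice3_scale[OF L(1) this, of v] lattice3_scale[OF L(1) mn, of u "a * a'" "b * b'" "c * c'"]]
  have "(v * (n * a * (n * a')) + u * (m * n * (a * a')), v * (n * b * (n * b')) + u * (m * n * (b * b')),
      v * (n * c * (n * c')) + u * (m * n * (c * c'))) \<in> L" .
  moreover have "v * (n * a * (n * a')) + u * (m * n * (a * a')) = n * (a * a')" for a a'
  proof -
    have "v * (n * a * (n * a')) + u * (m * n * (a * a')) = (u * m + v * n) * (n * (a * a'))"
      by (simp add: algebra_simps)
    then show ?thesis using uv by simp
  qed
  ultimately show "(n * (a * a'), n * (b * b'), n * (c * c')) \<in> L" by simp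
qed

lemma lat_quot_Int:
  assumes L: "lattice3 L" and cop: "coprime m n"
  shows "lat_quot n L \<inter> lat_quot m L = L"
proof -
  obtain u v where uv: "u * m + v * n = 1" by (rule coprime_combination[OF cop])
  have e: "v * (n * a) + u * (m * a) = a" for a
  proof -
    have "v * (n * a) + u * (m * a) = (u * m + v * n) * a" by (simp add: algebra_simps)
    then show ?thesis using uv by simp
  qed
  show ?thesis
  proof (intro equalityI subsetI)
    fix t assume "t \<in> lat_quot n L \<inter> lat_quot m L"
    then obtain a b c where t: "t = (a, b, c)" "(n * a, n * b, n * c) \<in> L" "(m * a, m * b, m * c) \<in> L"
      by (auto simp: lat_quot_def)
    from lattice3_add[OF L lattice3_scale[OF L t(2), of v] lattice3_scale[OF L t(3), of u]]
    show "t \<in> L" unfolding e t(1) .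
  qed (auto simp: lat_quot_def lattice3_scale[OF L])
qed

text \<open>M contains n times everything and so imposes no condition on the colon lattice, while L
  contains m times everything and so equals its colon by n.\<close>

lemma lat_quot_Int_eq:
  assumes L: "lattice3 L" and cop: "coprime m n"
    and mL: "\<And>a b c. (m * a, m * b, m * c) \<in> L" and nM: "\<And>a b c. (n * a, n * b, n * c) \<in> M"
  shows "lat_quot n (L \<inter> M) = L"
proof -
  have "lat_quot m L = UNIV" using mL by (auto simp: lat_quot_def)
  then have "lat_quot n L = L" using lat_quot_Int[OF L cop] by simp
  then show ?thesis using nM by (auto simp: lat_quot_def)
qed

text \<open>Intersection is a bijection from pairs; its inverse sends L to its two colon
  lattices.\<close>

lemma card_ring_lattices_mult:
  assumes mn: "m > 0" "n > 0" "coprime m n"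
  shows "card (ring_lattices (m * n)) = card (ring_lattices m) * card (ring_lattices n)"
proof -
  have cop: "coprime (int m) (int n)" "coprime (int n) (int m)" using mn(3) by (auto simp: coprime_commute)
  have sc: "(int k * a, int k * b, int k * c) \<in> L" if "L \<in> ring_lattices k" "k > 0" for L k a b c
    using ind3_scale_mem[of L a b c] that by (simp add: ring_lattices_def)
  have 1: "lat_quot (int n) (L \<inter> M) = L \<and> lat_quot (int m) (L \<inter> M) = M \<and> L \<inter> M \<in> ring_lattices (m * n)"
    if L: "L \<in> ring_lattices m" and M: "M \<in> ring_lattices n" for L M
  proof -
    have lat: "lattice3 L" "lattice3 M" "mult_closed3 L" "mult_closed3 M" "ind3 L = int m" "ind3 M = int n"
      using L M by (auto simp: ring_lattices_def)
    note scL = sc[OF L mn(1)] and scM = sc[OF M mn(2)]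
    have "lat_quot (int n) (L \<inter> M) = L" by (rule lat_quot_Int_eq[OF lat(1) cop(1) scL scM])
    moreover have "lat_quot (int m) (M \<inter> L) = M" by (rule lat_quot_Int_eq[OF lat(2) cop(2) scM scL])
    moreover have "L \<inter> M \<in> ring_lattices (m * n)"
      using lat ind3_Int(1)[OF lat(1,2) cop(1) scL scM]
      by (simp add: ring_lattices_def lattice3_Int mult_closed3_Int)
    ultimately show ?thesis by (simp add: Int_commute)
  qed
  have 2: "lat_quot (int n) L \<inter> lat_quot (int m) L = L \<and> lat_quot (int n) L \<in> ring_lattices m \<and>
      lat_quot (int m) L \<in> ring_lattices n" if L: "L \<in> ring_lattices (m * n)" for L
  proof -
    have lat: "lattice3 L" "mult_closed3 L" "ind3 L = int m * int n" using L by (auto simp: ring_lattices_def)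
    have scL: "(int m * int n * a, int m * int n * b, int m * int n * c) \<in> L"
      "(int n * int m * a, int n * int m * b, int n * int m * c) \<in> L" for a b c
      using sc[OF L, of a b c] mn by (auto simp: mult_ac)
    define A B where "A = lat_quot (int n) L" and "B = lat_quot (int m) L"
    have AB: "A \<inter> B = L" unfolding A_def B_def by (rule lat_quot_Int[OF lat(1) cop(1)])
    have latAB: "lattice3 A" "lattice3 B" unfolding A_def B_def using lat(1) by (auto intro: lattice3_lat_quot)
    have mcAB: "mult_closed3 A" "mult_closed3 B" unfolding A_def B_def
      using mult_closed3_lat_quot[OF lat(1,2) cop(1) scL(1)] mult_closed3_lat_quot[OF lat(1,2) cop(2) scL(2)] by auto
    have scA: "(int m * a, int m * b, int m * c) \<in> A" for a b c
      using scL(2)[of a b c] by (simp add: A_def lat_quot_def mult.assoc)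
    have scB: "(int n * a, int n * b, int n * c) \<in> B" for a b c
      using scL(1)[of a b c] by (simp add: B_def lat_quot_def mult.assoc)
    note ind = ind3_Int[OF latAB cop(1) scA scB]
    have prod: "ind3 A * ind3 B = int m * int n" using ind(1) AB lat(3) by simp
    have nonneg: "ind3 A \<ge> 0" "ind3 B \<ge> 0" by (auto simp: ind3_def)
    \<comment> \<open>\<open>ind3 A\<close> divides m^3, so it is prime to n; as the two indices
      multiply to m n, it divides m. Likewise \<open>ind3 B\<close> divides n, and the product
      forces both to be equalities.\<close>
    have "coprime (ind3 A) (int n)"
      by (rule coprime_divisors[OF ind(2) dvd_refl]) (use cop(1) in simp)
    then have "ind3 A dvd int m" using prod by (metis coprime_dvd_mult_left_iff dvd_triv_left)
    then have leA: "ind3 A \<le> int m" using mn by (intro zdvd_imp_le) auto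
    have "coprime (ind3 B) (int m)"
      by (rule coprime_divisors[OF ind(3) dvd_refl]) (use cop(2) in simp)
    then have "ind3 B dvd int n" using prod by (metis coprime_dvd_mult_right_iff dvd_triv_right)
    then have leB: "ind3 B \<le> int n" using mn by (intro zdvd_imp_le) auto
    have "ind3 A = int m"
    proof (rule ccontr)
      assume "ind3 A \<noteq> int m"
      then have "ind3 A * int n < int m * int n" using leA mn by (intro mult_strict_right_mono) auto
      moreover have "ind3 A * ind3 B \<le> ind3 A * int n" using leB nonneg by (intro mult_left_mono)
      ultimately show False using prod by linarith
    qed
    moreover from this have "ind3 B = int n" using prod mn by simp
    ultimately show ?thesis using latAB mcAB AB by (auto simp: ring_lattices_def A_def B_def)
  qed
  have "bij_betw (\<lambda>(L, M). L \<inter> M) (ring_lattices m \<times> ring_lattices n) (ring_lattices (m * n))"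
    by (rule bij_betw_byWitness[where f' = "\<lambda>L. (lat_quot (int n) L, lat_quot (int m) L)"])
       (use 1 2 in auto)
  from bij_betw_same_card[OF this] show ?thesis by (simp add: card_cartesian_product)
qed

section \<open>Counting Hermite normal forms of prime power index\<close>

text \<open>If both alternatives failed, the valuations would add up to at most (i - 1) + (j - 1) <=
  c - 1.\<close>

lemma prime_power_dvd_multD:
  fixes P s t :: int
  assumes "prime P" "P ^ c dvd s * t" "i + j \<le> c + 1"
  shows "P ^ i dvd s \<or> P ^ j dvd t"
proof (cases "s = 0 \<or> t = 0")
  case False
  have P: "\<not> is_unit P" "prime_elem P" using assms(1) by auto
  have "c \<le> multiplicity P s + multiplicity P t"
    using assms(2) P False by (simp add: power_dvd_iff_le_multiplicity prime_elem_multiplicity_mult_distrib)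
  then have "i \<le> multiplicity P s \<or> j \<le> multiplicity P t" using assms(3) by linarith
  then show ?thesis by (auto intro: multiplicity_dvd')
qed auto

lemma card_residue_class_le:
  fixes M N r :: int
  assumes "M > 0"
  shows "card {t. 0 \<le> t \<and> t < M * N \<and> M dvd t - r} \<le> nat N"
proof -
  have "card {t. 0 \<le> t \<and> t < M * N \<and> M dvd t - r} \<le> card {0..<N}"
  proof (rule card_inj_on_le[where f = "\<lambda>t. t div M"])
    show "inj_on (\<lambda>t. t div M) {t. 0 \<le> t \<and> t < M * N \<and> M dvd t - r}"
    proof (rule inj_onI, clarsimp)
      fix s t assume st: "M dvd s - r" "M dvd t - r" "s div M = t div M"
      then have "s mod M = t mod M" by (metis mod_eq_dvd_iff)
      with st(3) show "s = t" by (metis mult_div_mod_eq)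
    qed
    show "(\<lambda>t. t div M) ` {t. 0 \<le> t \<and> t < M * N \<and> M dvd t - r} \<subseteq> {0..<N}"
    proof clarsimp
      fix t assume t: "0 \<le> t" "t < M * N"
      have "\<not> N \<le> t div M"
      proof
        assume "N \<le> t div M"
        then have "M * N \<le> M * (t div M)" using assms by (intro mult_left_mono) auto
        also have "\<dots> \<le> t" using mult_div_mod_eq[of M t] pos_mod_sign[OF assms, of t] by linarith
        finally show False using t by simp
      qed
      then show "0 \<le> t div M \<and> t div M < N" using t assms by (simp add: pos_imp_zdiv_nonneg_iff)
    qed
  qed auto
  then show ?thesis by simp
qed

lemma card_prime_power_residue_class_le:
  assumes "prime p" "j \<le> c"
  shows "card {t::int. 0 \<le> t \<and> t < int p ^ c \<and> int p ^ j dvd t - r} \<le> p ^ (c - j)"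
proof -
  have "int p ^ c = int p ^ j * int p ^ (c - j)" using assms(2) by (simp add: power_add[symmetric])
  then show ?thesis using card_residue_class_le[of "int p ^ j" "int p ^ (c - j)" r] prime_gt_0_nat[OF assms(1)]
    by (simp add: nat_power_eq)
qed

lemma card_two_roots_le:
  assumes p: "prime p" and j: "j \<le> c"
    and "\<And>t. t \<in> S \<Longrightarrow> 0 \<le> t \<and> t < int p ^ c \<and> (int p ^ j dvd t - r \<or> int p ^ j dvd t - s)"
  shows "card S \<le> 2 * p ^ (c - j)"
proof -
  let ?A = "\<lambda>r. {t::int. 0 \<le> t \<and> t < int p ^ c \<and> int p ^ j dvd t - r}"
  have fin: "finite (?A r)" for r by (rule finite_subset[of _ "{0..<int p ^ c}"]) auto
  have "card S \<le> card (?A r \<union> ?A s)" using assms(3) fin by (intro card_mono) auto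
  also have "\<dots> \<le> card (?A r) + card (?A s)" by (rule card_Un_le)
  also have "\<dots> \<le> p ^ (c - j) + p ^ (c - j)"
    by (intro add_mono card_prime_power_residue_class_le p j)
  finally show ?thesis by simp
qed

text \<open>One of the two factors carries at least half of the valuation, rounded up; this leaves
  two residue classes with p^(c div 2) members each.\<close>

lemma card_quadratic_split_le:
  assumes p: "prime p"
  shows "card {t::int. 0 \<le> t \<and> t < int p ^ c \<and> int p ^ c dvd (t - r) * (t - s)} \<le> 2 * p ^ (c div 2)"
proof -
  have "card {t::int. 0 \<le> t \<and> t < int p ^ c \<and> int p ^ c dvd (t - r) * (t - s)} \<le> 2 * p ^ (c - (c - c div 2))"
  proof (rule card_two_roots_le[OF p, of _ _ _ r s])
    fix t assume t: "t \<in> {t::int. 0 \<le> t \<and> t < int p ^ c \<and> int p ^ c dvd (t - r) * (t - s)}"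
    have "int p ^ (c - c div 2) dvd t - r \<or> int p ^ (c - c div 2) dvd t - s"
      by (rule prime_power_dvd_multD[where c = c]) (use p t in auto)
    then show "0 \<le> t \<and> t < int p ^ c \<and> (int p ^ (c - c div 2) dvd t - r \<or> int p ^ (c - c div 2) dvd t - s)"
      using t by simp
  qed simp
  then show ?thesis by simp
qed

text \<open>For b <= c div 2 the bound improves: if neither z nor z - p^b were divisible by p^(c-b),
  both would be divisible by p^(b+1), and so would their difference p^b.\<close>

lemma card_idempotent_like_le:
  assumes p: "prime p"
  shows "card {z::int. 0 \<le> z \<and> z < int p ^ c \<and> int p ^ c dvd z * (z - int p ^ b)} \<le> 2 * p ^ min b (c div 2)"
    (is "card ?S \<le> _")
proof (cases "b \<le> c div 2")
  case True
  have pp: "prime (int p)" using p by simp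
  have bc: "b \<le> c" using True by simp
  have "card ?S \<le> 2 * p ^ (c - (c - b))"
  proof (rule card_two_roots_le[OF p, of _ _ _ 0 "int p ^ b"])
    fix z assume z: "z \<in> ?S"
    have "int p ^ (c - b) dvd z \<or> int p ^ (c - b) dvd z - int p ^ b"
    proof (rule ccontr)
      assume no: "\<not> (int p ^ (c - b) dvd z \<or> int p ^ (c - b) dvd z - int p ^ b)"
      have "int p ^ (c - b) dvd z \<or> int p ^ (b + 1) dvd z - int p ^ b"
        by (rule prime_power_dvd_multD[OF pp, where c = c]) (use z bc in auto)
      moreover have "int p ^ (b + 1) dvd z \<or> int p ^ (c - b) dvd z - int p ^ b"
        by (rule prime_power_dvd_multD[OF pp, where c = c]) (use z bc in auto)
      ultimately have "int p ^ (b + 1) dvd z - (z - int p ^ b)" using no dvd_diff by blast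
      then have "int p ^ (b + 1) dvd int p ^ b" by simp
      then have "b + 1 \<le> b" using pp by (subst (asm) dvd_power_iff) (auto simp: prime_int_iff)
      then show False by simp
    qed
    then show "0 \<le> z \<and> z < int p ^ c \<and> (int p ^ (c - b) dvd z - 0 \<or> int p ^ (c - b) dvd z - int p ^ b)"
      using z by simp
  qed simp
  then show ?thesis using True bc by (simp add: min_def)
next
  case False
  then show ?thesis using card_quadratic_split_le[OF p, of c 0 "int p ^ b"] by (simp add: min_def)
qed

text \<open>Relative to one solution s the equation splits: subtracting the equation at s leaves (y
  - s) (y - (A - s)).\<close>

lemma card_monic_quadratic_le:
  assumes p: "prime p"
  shows "card {y::int. 0 \<le> y \<and> y < int p ^ c \<and> int p ^ c dvd y * (y - A) - w} \<le> 2 * p ^ (c div 2)"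
    (is "card ?S \<le> _")
proof (cases "?S = {}")
  case False
  then obtain s where s: "s \<in> ?S" by blast
  have "?S \<subseteq> {y::int. 0 \<le> y \<and> y < int p ^ c \<and> int p ^ c dvd (y - s) * (y - (A - s))}"
  proof
    fix y assume y: "y \<in> ?S"
    have "int p ^ c dvd y * (y - A) - w" "int p ^ c dvd s * (s - A) - w" using y s by auto
    then have "int p ^ c dvd (y * (y - A) - w) - (s * (s - A) - w)" by (rule dvd_diff)
    also have "(y * (y - A) - w) - (s * (s - A) - w) = (y - s) * (y - (A - s))" by (simp add: algebra_simps)
    finally show "y \<in> {y::int. 0 \<le> y \<and> y < int p ^ c \<and> int p ^ c dvd (y - s) * (y - (A - s))}" using y by simp
  qed
  then have "card ?S \<le> card {y::int. 0 \<le> y \<and> y < int p ^ c \<and> int p ^ c dvd (y - s) * (y - (A - s))}"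
    by (rule card_mono[rotated]) (rule finite_subset[of _ "{0..<int p ^ c}"], auto)
  also have "\<dots> \<le> 2 * p ^ (c div 2)" by (rule card_quadratic_split_le[OF p])
  finally show ?thesis .
next
  case True
  show ?thesis unfolding True by simp
qed

text \<open>If \<open>p\<close> divides \<open>w\<close> the two roots of \<open>y (y - 1) = w\<close> are distinct modulo \<open>p\<close>, so each lifts uniquely.\<close>

lemma card_unramified_quadratic_le:
  assumes p: "prime p" and w: "c > 0 \<Longrightarrow> int p dvd w"
  shows "card {y::int. 0 \<le> y \<and> y < int p ^ c \<and> int p ^ c dvd y * (y - 1) - w} \<le> 2"
    (is "card ?S \<le> _")
proof (cases "c = 0")
  case True
  then have "?S \<subseteq> {0}" by auto
  then have "card ?S \<le> card {0::int}" by (intro card_mono) auto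
  then show ?thesis by simp
next
  case False
  have pp: "prime (int p)" using p by simp
  have fin: "finite ?S" by (rule finite_subset[of _ "{0..<int p ^ c}"]) auto
  let ?T = "\<lambda>e. {y \<in> ?S. int p dvd y - e}"
  have dv: "int p dvd y * (y - 1)" if "y \<in> ?S" for y
  proof -
    have "int p dvd int p ^ c" using False by simp
    then have "int p dvd y * (y - 1) - w" using that dvd_trans by blast
    moreover have "int p dvd w" using w False by simp
    ultimately have "int p dvd (y * (y - 1) - w) + w" by (rule dvd_add)
    then show ?thesis by simp
  qed
  have finT: "finite (?T e)" for e by (rule finite_subset[OF _ fin]) auto
  have T1: "card (?T e) \<le> 1" if e: "e = 0 \<or> e = 1" for e
  proof -
    have "y = y'" if y: "y \<in> ?T e" and y': "y' \<in> ?T e" for y y'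
    proof -
      have "int p ^ c dvd y * (y - 1) - w" "int p ^ c dvd y' * (y' - 1) - w" using y y' by auto
      then have "int p ^ c dvd (y * (y - 1) - w) - (y' * (y' - 1) - w)" by (rule dvd_diff)
      also have "(y * (y - 1) - w) - (y' * (y' - 1) - w) = (y - y') * (y + y' - 1)" by (simp add: algebra_simps)
      finally have d: "int p ^ c dvd (y - y') * (y + y' - 1)" .
      \<comment> \<open>With both solutions congruent to e modulo p this number is congruent to 2 e
        - 1, which is 1 or -1.\<close>
      have "\<not> int p dvd y + y' - 1"
      proof
        assume "int p dvd y + y' - 1"
        moreover have "int p dvd (y - e) + (y' - e)" using y y' by (intro dvd_add) auto
        ultimately have "int p dvd (y + y' - 1) - ((y - e) + (y' - e))" by (rule dvd_diff)
        then have "int p dvd 1" using e by auto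
        then show False using pp by (simp add: prime_int_iff)
      qed
      then have "coprime (int p ^ c) (y + y' - 1)" using pp by (simp add: prime_imp_coprime)
      then have "int p ^ c dvd y - y'" using d by (simp add: coprime_dvd_mult_left_iff)
      then have "y mod int p ^ c = y' mod int p ^ c" by (simp add: mod_eq_dvd_iff)
      then show ?thesis using y y' by simp
    qed
    then show ?thesis unfolding One_nat_def card_le_Suc0_iff_eq[OF finT] by blast
  qed
  have "?S \<subseteq> ?T 0 \<union> ?T 1" using dv pp by (auto simp: prime_dvd_mult_iff)
  then have "card ?S \<le> card (?T 0 \<union> ?T 1)" by (intro card_mono finite_UnI finT)
  also have "\<dots> \<le> card (?T 0) + card (?T 1)" by (rule card_Un_le)
  also have "\<dots> \<le> 1 + 1" by (intro add_mono T1) auto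
  finally show ?thesis by simp
qed

text \<open>The summands come from the numbers of admissible \<open>y\<close>, \<open>z\<close> and \<open>x\<close>, in this order.\<close>

definition hnf_exponent :: "nat \<Rightarrow> nat \<Rightarrow> nat \<Rightarrow> nat" where
  "hnf_exponent a b c = (if a = 0 then 0 else c div 2) + min b (c div 2) + min a (b div 2)"

text \<open>x is restricted by (a, b) alone and z by (b, c) alone; for given x and z there remains a
  monic quadratic congruence in y. Each of the three counts contributes a factor 2.\<close>

lemma card_hnf_params_prime_power_le:
  assumes p: "prime p"
  shows "card (hnf_params (int p ^ a) (int p ^ b) (int p ^ c)) \<le> 8 * p ^ hnf_exponent a b c"
proof -
  define X where "X = {x::int. 0 \<le> x \<and> x < int p ^ b \<and> int p ^ b dvd x * (x - int p ^ a)}"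
  define Z where "Z = {z::int. 0 \<le> z \<and> z < int p ^ c \<and> int p ^ c dvd z * (z - int p ^ b)}"
  define Y where "Y x z = {y::int. 0 \<le> y \<and> y < int p ^ c \<and>
    int p ^ c dvd y * (y - int p ^ a) - (x * (x - int p ^ a) div int p ^ b) * z}" for x z
  define e where "e = (if a = 0 then 0 else c div 2)"
  have fin: "finite X" "finite Z" "finite (Y x z)" for x z
    unfolding X_def Y_def Z_def
    by (rule finite_subset[of _ "{0..<int p ^ b}"], auto, rule finite_subset[of _ "{0..<int p ^ c}"], auto,
        rule finite_subset[of _ "{0..<int p ^ c}"], auto)
  have Xc: "card X \<le> 2 * p ^ min a (b div 2)" unfolding X_def by (rule card_idempotent_like_le[OF p])
  have Zc: "card Z \<le> 2 * p ^ min b (c div 2)" unfolding Z_def by (rule card_idempotent_like_le[OF p])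
  have Yc: "card (Y x z) \<le> 2 * p ^ e" if x: "x \<in> X" and z: "z \<in> Z" for x z
  proof (cases "a = 0")
    case False
    then show ?thesis unfolding Y_def e_def using card_monic_quadratic_le[OF p] by simp
  next
    case True
    \<comment> \<open>For b = 0 the entry x is 0. For b > 0 the condition on z reduces to z^2 = 0
      modulo p, so p divides z. Either way the equation for y has two distinct roots modulo
      p.\<close>
    have "int p dvd (x * (x - 1) div int p ^ b) * z" if "c > 0"
    proof (cases "b = 0")
      case True
      then have "x = 0" using x by (auto simp: X_def)
      then show ?thesis by simp
    next
      case False
      have "int p dvd int p ^ c" using that by simp
      then have "int p dvd z * (z - int p ^ b)" using z dvd_trans unfolding Z_def by blast
      then have "int p dvd z \<or> int p dvd z - int p ^ b" using p by (simp add: prime_dvd_mult_iff)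
      moreover have "int p dvd int p ^ b" using False by simp
      ultimately have "int p dvd z" by (metis dvd_diffD1 dvd_diff_commute dvd_diff_right_iff)
      then show ?thesis by simp
    qed
    from card_unramified_quadratic_le[OF p this] show ?thesis unfolding Y_def e_def using True by simp
  qed
  have "card (hnf_params (int p ^ a) (int p ^ b) (int p ^ c)) \<le> card (SIGMA x : X. SIGMA z : Z. Y x z)"
  proof (rule card_inj_on_le[where f = "\<lambda>(x, y, z). (x, z, y)"])
    show "(\<lambda>(x, y, z). (x, z, y)) ` hnf_params (int p ^ a) (int p ^ b) (int p ^ c) \<subseteq> (SIGMA x : X. SIGMA z : Z. Y x z)"
      by (auto simp: hnf_params_def hnf_ring_cond_def X_def Y_def Z_def)
  qed (auto simp: inj_on_def fin intro!: finite_SigmaI)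
  also have "\<dots> = (\<Sum>x\<in>X. \<Sum>z\<in>Z. card (Y x z))" by (simp add: card_SigmaI fin)
  also have "\<dots> \<le> (\<Sum>x\<in>X. \<Sum>z\<in>Z. 2 * p ^ e)" by (intro sum_mono Yc)
  also have "\<dots> = card X * card Z * (2 * p ^ e)" by simp
  also have "\<dots> \<le> (2 * p ^ min a (b div 2)) * (2 * p ^ min b (c div 2)) * (2 * p ^ e)"
    by (intro mult_mono Xc Zc) auto
  also have "\<dots> = 8 * p ^ hnf_exponent a b c"
    by (simp add: hnf_exponent_def e_def power_add)
  finally show ?thesis .
qed

text \<open>The source of 6/7. When all three summands are positive, c >= 2 c', c' >= e2, b >= e2, b
  >= 2 e3 and a >= e3 leave a surplus of at least 7 e3 >= 7, with equality at (a, b, c) = (1, 2, 4).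
  When some summand is zero, a or the total degree 2 supplies the additive 7.\<close>

lemma hnf_exponent_le:
  assumes "a + b + c \<ge> 2"
  shows "7 * hnf_exponent a b c + 7 \<le> 6 * (a + b + c)"
proof -
  define c' b' e2 e3 where "c' = c div 2" and "b' = b div 2" and "e2 = min b c'" and "e3 = min a b'"
  have *: "2 * c' \<le> c" "2 * b' \<le> b" "e2 \<le> b" "e2 \<le> c'" "e3 \<le> a" "e3 \<le> b'"
    by (auto simp: c'_def b'_def e2_def e3_def)
  have E: "hnf_exponent a b c = (if a = 0 then 0 else c') + e2 + e3"
    by (simp add: hnf_exponent_def c'_def b'_def e2_def e3_def)
  show ?thesis
  proof (cases "a = 0")
    case True
    with * have "e3 = 0" by simp
    with True E have E: "hnf_exponent a b c = e2" by simp
    show ?thesis unfolding E using * assms by (cases "e2 = 0"; simp)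
  next
    case False
    with E have E: "hnf_exponent a b c = c' + e2 + e3" by simp
    show ?thesis unfolding E using * assms False
      by (cases "e3 = 0"; cases "e2 = 0"; cases "c' = 0"; simp)
  qed
qed

lemma pos_dvd_int_prime_power:
  assumes "prime p" "(d::int) > 0" "d dvd int p ^ k"
  obtains i where "i \<le> k" "d = int p ^ i"
proof -
  have "nat d dvd p ^ k" using assms by (metis int_dvd_int_iff nat_0_le of_nat_power order_less_imp_le)
  then obtain i where i: "i \<le> k" "nat d = p ^ i" using divides_primepow_nat[OF assms(1)] by blast
  have "d = int (nat d)" using assms(2) by simp
  then have "d = int p ^ i" by (simp add: i(2))
  with i(1) that show thesis by blast
qed

lemma hnf_diags_prime_power:
  assumes p: "prime p" and d: "(d1, d2, d3) \<in> hnf_diags (p ^ k)"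
  obtains a b c where "a + b + c = k" "d1 = int p ^ a" "d2 = int p ^ b" "d3 = int p ^ c"
proof -
  have d': "d1 > 0" "d2 > 0" "d3 > 0" "d1 * d2 * d3 = int p ^ k" using d by (auto simp: hnf_diags_def)
  have "d1 dvd int p ^ k" "d2 dvd int p ^ k" "d3 dvd int p ^ k"
    unfolding d'(4)[symmetric] by auto
  then obtain a b c where abc: "d1 = int p ^ a" "d2 = int p ^ b" "d3 = int p ^ c"
    by (metis pos_dvd_int_prime_power[OF p] d'(1-3))
  have "int p ^ (a + b + c) = int p ^ k" using d'(4) by (simp add: abc power_add)
  then have "a + b + c = k" using prime_gt_1_nat[OF p] by (subst (asm) power_inject_exp) auto
  with abc that show thesis by blast
qed

text \<open>A diagonal is determined by two exponents, each at most k, so there are at most (k +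
  1)^2 of them; each carries at most 8 p^(6k/7 - 1) forms.\<close>

lemma card_ring_lattices_prime_power_le:
  assumes p: "prime p" and k: "k \<ge> 2"
  shows "real (card (ring_lattices (p ^ k))) \<le> 8 * real (k + 1) ^ 2 * real p powr ((1 - 1 / 7) * real k - 1)"
proof -
  define E where "E = real p powr ((1 - 1 / 7) * real k - 1)"
  have p1: "real p \<ge> 1" using prime_ge_1_nat[OF p] by simp
  have le: "real (card (hnf_params d1 d2 d3)) \<le> 8 * E" if d: "(d1, d2, d3) \<in> hnf_diags (p ^ k)" for d1 d2 d3
  proof -
    from hnf_diags_prime_power[OF p d] obtain a b c
      where abc: "a + b + c = k" "d1 = int p ^ a" "d2 = int p ^ b" "d3 = int p ^ c" by blast
    have "real (card (hnf_params d1 d2 d3)) \<le> real (8 * p ^ hnf_exponent a b c)"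
      unfolding abc of_nat_le_iff by (rule card_hnf_params_prime_power_le[OF p])
    also have "\<dots> = 8 * real p powr real (hnf_exponent a b c)" using p1 by (simp add: powr_realpow)
    also have "\<dots> \<le> 8 * E" unfolding E_def
    proof (intro mult_left_mono powr_mono)
      have "7 * hnf_exponent a b c + 7 \<le> 6 * k" using hnf_exponent_le[of a b c] abc(1) k by simp
      then have "real (7 * hnf_exponent a b c + 7) \<le> real (6 * k)" by (simp only: of_nat_le_iff)
      then show "real (hnf_exponent a b c) \<le> (1 - 1 / 7) * real k - 1" by simp
    qed (use p1 in auto)
    finally show ?thesis .
  qed
  have "hnf_diags (p ^ k) \<subseteq> (\<lambda>(a, b). (int p ^ a, int p ^ b, int p ^ (k - a - b))) ` ({..k} \<times> {..k})"
  proof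
    fix d assume d: "d \<in> hnf_diags (p ^ k)"
    obtain d1 d2 d3 where d_eq: "d = (d1, d2, d3)" by (cases d) auto
    from hnf_diags_prime_power[OF p d[unfolded d_eq]] obtain a b c
      where "a + b + c = k" "d1 = int p ^ a" "d2 = int p ^ b" "d3 = int p ^ c" by blast
    then show "d \<in> (\<lambda>(a, b). (int p ^ a, int p ^ b, int p ^ (k - a - b))) ` ({..k} \<times> {..k})"
      unfolding d_eq by (intro image_eqI[of _ _ "(a, b)"]) auto
  qed
  then have "card (hnf_diags (p ^ k)) \<le> card ((\<lambda>(a, b). (int p ^ a, int p ^ b, int p ^ (k - a - b))) ` ({..k} \<times> {..k}))"
    by (intro card_mono) auto
  also have "\<dots> \<le> card ({..k} \<times> {..k})" by (rule card_image_le) auto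
  also have "\<dots> = (k + 1) ^ 2" by (simp add: card_cartesian_product power2_eq_square)
  finally have cd: "real (card (hnf_diags (p ^ k))) \<le> real ((k + 1) ^ 2)" by (simp only: of_nat_le_iff)
  have "real (card (ring_lattices (p ^ k))) = (\<Sum>d\<in>hnf_diags (p ^ k). real (case d of (d1, d2, d3) \<Rightarrow> card (hnf_params d1 d2 d3)))"
    using prime_gt_0_nat[OF p] by (simp add: card_ring_lattices)
  also have "\<dots> \<le> (\<Sum>d\<in>hnf_diags (p ^ k). 8 * E)" using le by (intro sum_mono) auto
  also have "\<dots> = real (card (hnf_diags (p ^ k))) * (8 * E)" by simp
  also have "\<dots> \<le> real ((k + 1) ^ 2) * (8 * E)" using cd by (intro mult_right_mono) (auto simp: E_def)
  finally show ?thesis by (simp add: E_def mult_ac)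
qed

lemma card_ring_lattices_one: "card (ring_lattices 1) = 1"
proof -
  have "hnf_diags 1 = {(1, 1, 1)}"
  proof (intro equalityI subsetI)
    fix d assume d: "d \<in> hnf_diags 1"
    obtain d1 d2 d3 where d_eq: "d = (d1, d2, d3)" by (cases d) auto
    \<comment> \<open>Writing 1 as 2^0 brings the index 1 under the description for prime
      powers.\<close>
    from d d_eq have "(d1, d2, d3) \<in> hnf_diags (2 ^ 0)" by simp
    from hnf_diags_prime_power[OF two_is_prime_nat this] show "d \<in> {(1, 1, 1)}" by (auto simp: d_eq)
  qed (auto simp: hnf_diags_def)
  moreover have "hnf_params 1 1 1 = {(0, 0, 0)}" by (auto simp: hnf_params_def hnf_ring_cond_def)
  ultimately show ?thesis by (simp add: card_ring_lattices)
qed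

text \<open>The diagonals with p in first, second and third place carry 1, 2 and 3 forms.
  Conceptually, a subring of index p is cut out by a congruence modulo p between two of the four
  coordinates, and there are 6 pairs.\<close>

lemma card_ring_lattices_prime:
  assumes p: "prime p"
  shows "card (ring_lattices p) = 6"
proof -
  define P where "P = int p"
  have P: "prime P" "P > 1" using p prime_gt_1_nat[OF p] by (auto simp: P_def)
  have diags: "hnf_diags p = {(P, 1, 1), (1, P, 1), (1, 1, P)}"
  proof (intro equalityI subsetI)
    fix d assume d: "d \<in> hnf_diags p"
    obtain d1 d2 d3 where d_eq: "d = (d1, d2, d3)" by (cases d) auto
    from d d_eq have "(d1, d2, d3) \<in> hnf_diags (p ^ 1)" by simp
    from hnf_diags_prime_power[OF p this] obtain a b c
      where "a + b + c = 1" "d1 = P ^ a" "d2 = P ^ b" "d3 = P ^ c" unfolding P_def by blast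
    moreover from this have "(a = 1 \<and> b = 0 \<and> c = 0) \<or> (a = 0 \<and> b = 1 \<and> c = 0) \<or> (a = 0 \<and> b = 0 \<and> c = 1)"
      by linarith
    ultimately show "d \<in> {(P, 1, 1), (1, P, 1), (1, 1, P)}" by (auto simp: d_eq)
  qed (use P in \<open>auto simp: hnf_diags_def P_def\<close>)
  have small: "x = 0" if "P dvd x" "0 \<le> x" "x < P" for x using that zdvd_not_zless[of x P] by force
  have idem: "x = 0 \<or> x = 1" if "P dvd x * (x - 1)" "0 \<le> x" "x < P" for x
  proof -
    have "P dvd x \<or> P dvd x - 1" using that P by (simp add: prime_dvd_mult_iff)
    then show ?thesis using small[of x] small[of "x - 1"] that by fastforce
  qed
  have 1: "hnf_params P 1 1 = {(0, 0, 0)}" by (auto simp: hnf_params_def hnf_ring_cond_def)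
  have 2: "hnf_params 1 P 1 = {(0, 0, 0), (1, 0, 0)}"
    using P idem by (auto simp: hnf_params_def hnf_ring_cond_def)
  have 3: "hnf_params 1 1 P = {(0, 0, 0), (0, 1, 0), (0, 0, 1)}"
  proof (intro equalityI subsetI)
    fix t assume t: "t \<in> hnf_params 1 1 P"
    obtain x y z where t_eq: "t = (x, y, z)" by (cases t) auto
    have x: "x = 0" using t by (auto simp: t_eq hnf_params_def)
    have "y = 0 \<or> y = 1" "z = 0 \<or> z = 1" "P dvd z * y"
      using t idem[of y] idem[of z] by (auto simp: t_eq x hnf_params_def hnf_ring_cond_def)
    moreover from this have "\<not> (y = 1 \<and> z = 1)" using P by auto
    ultimately show "t \<in> {(0, 0, 0), (0, 1, 0), (0, 0, 1)}" by (auto simp: t_eq x)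
  qed (use P in \<open>auto simp: hnf_params_def hnf_ring_cond_def\<close>)
  have "card (ring_lattices p) = (\<Sum>(d1, d2, d3)\<in>{(P, 1, 1), (1, P, 1), (1, 1, P)}. card (hnf_params d1 d2 d3))"
    using prime_gt_0_nat[OF p] by (simp add: card_ring_lattices diags)
  also have "\<dots> = 6" using P(2) 1 2 3 by simp
  finally show ?thesis .
qed

section \<open>Subrings of the fourth power of the integers\<close>

text \<open>A group homomorphism whose kernel, the constant vectors, lies in every subring; so a
  subring is recovered from its image. It is multiplicative only on vectors with last coordinate 0,
  which is where \<open>embed3\<close> takes its values.\<close>

definition diffs4 :: "int ^ 4 \<Rightarrow> int \<times> int \<times> int" where
  "diffs4 v = (v $ 1 - v $ 4, v $ 2 - v $ 4, v $ 3 - v $ 4)"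

definition embed3 :: "int \<times> int \<times> int \<Rightarrow> int ^ 4" where
  "embed3 t = (\<chi> i. if i = 1 then fst t else if i = 2 then fst (snd t) else if i = 3 then snd (snd t) else 0)"

lemma diffs4_embed3 [simp]: "diffs4 (embed3 t) = t"
  by (cases t) (simp add: diffs4_def embed3_def)

lemma range_diffs4: "range diffs4 = UNIV"
  by (metis diffs4_embed3 surjI)

lemma diffs4_eqD:
  assumes "diffs4 v = diffs4 w"
  shows "v = w + of_int (v $ 4 - w $ 4)"
  using assms unfolding vec_eq_iff forall_4 by (simp add: diffs4_def of_int_vec_nth del: of_int_diff)

lemma subring_Z4_D:
  assumes "subring S Z4"
  shows "1 \<in> S" "0 \<in> S" "x \<in> S \<Longrightarrow> - x \<in> S" "x \<in> S \<Longrightarrow> y \<in> S \<Longrightarrow> x + y \<in> S"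
    "x \<in> S \<Longrightarrow> y \<in> S \<Longrightarrow> x - y \<in> S" "x \<in> S \<Longrightarrow> y \<in> S \<Longrightarrow> x * y \<in> S" "of_int k \<in> S"
proof -
  show one: "1 \<in> S" and neg: "x \<in> S \<Longrightarrow> - x \<in> S" and add: "x \<in> S \<Longrightarrow> y \<in> S \<Longrightarrow> x + y \<in> S"
    and "x \<in> S \<Longrightarrow> y \<in> S \<Longrightarrow> x * y \<in> S" for x y
    using assms unfolding subring_Z4_iff by auto
  show zero: "0 \<in> S" using add[OF one neg[OF one]] by simp
  show "x \<in> S \<Longrightarrow> y \<in> S \<Longrightarrow> x - y \<in> S" using add[of x "- y"] neg[of y] by simp
  have nat: "of_nat m \<in> S" for m by (induction m) (auto intro: add one zero)
  show "of_int k \<in> S" by (cases k rule: int_cases2) (use nat neg in auto)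
qed

lemma vimage_diffs4_image:
  assumes "subring S Z4"
  shows "diffs4 -` (diffs4 ` S) = S"
proof (intro equalityI subsetI)
  fix v assume "v \<in> diffs4 -` (diffs4 ` S)"
  then obtain w where "w \<in> S" "diffs4 v = diffs4 w" by auto
  then show "v \<in> S" using subring_Z4_D(4,7)[OF assms] diffs4_eqD by metis
qed auto

text \<open>For x = t + r and y = t' + r' with constants r, r' the product is t t' + r t' + r' t up
  to a constant, so closure of L under sums and products is enough.\<close>

lemma subring_vimage_diffs4:
  assumes L: "lattice3 L" "mult_closed3 L"
  shows "subring (diffs4 -` L) Z4"
  unfolding subring_Z4_iff
proof (intro conjI ballI)
  show "1 \<in> diffs4 -` L" using lattice3_zero[OF L(1)] by (simp add: diffs4_def)
  fix x assume x: "x \<in> diffs4 -` L"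
  obtain a b c where abc: "diffs4 x = (a, b, c)" by (cases "diffs4 x") auto
  have xL: "(a, b, c) \<in> L" using x abc by simp
  show "- x \<in> diffs4 -` L"
    using lattice3_scale[OF L(1) xL, of "- 1"] abc by (auto simp: diffs4_def)
  fix y assume y: "y \<in> diffs4 -` L"
  obtain a' b' c' where abc': "diffs4 y = (a', b', c')" by (cases "diffs4 y") auto
  have yL: "(a', b', c') \<in> L" using y abc' by simp
  show "x + y \<in> diffs4 -` L"
    using lattice3_add[OF L(1) xL yL] abc abc' by (auto simp: diffs4_def algebra_simps)
  have "(a * a', b * b', c * c') \<in> L" using L(2) xL yL unfolding mult_closed3_def by blast
  from lattice3_add[OF L(1) this lattice3_add[OF L(1) lattice3_scale[OF L(1) yL, of "x $ 4"] lattice3_scale[OF L(1) xL, of "y $ 4"]]]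
  show "x * y \<in> diffs4 -` L" using abc abc' by (auto simp: diffs4_def algebra_simps)
qed

lemma lattice3_image_diffs4:
  assumes "subring S Z4"
  shows "lattice3 (diffs4 ` S)" "mult_closed3 (diffs4 ` S)"
proof -
  note S = subring_Z4_D[OF assms]
  show "lattice3 (diffs4 ` S)"
    unfolding lattice3_def
  proof (intro conjI allI impI)
    show "(0, 0, 0) \<in> diffs4 ` S" using S(2) by (intro image_eqI[of _ _ 0]) (auto simp: diffs4_def)
    fix a b c a' b' c' assume "(a, b, c) \<in> diffs4 ` S" "(a', b', c') \<in> diffs4 ` S"
    then obtain s t where "s \<in> S" "t \<in> S" "(a, b, c) = diffs4 s" "(a', b', c') = diffs4 t" by auto
    then show "(a - a', b - b', c - c') \<in> diffs4 ` S"
      by (intro image_eqI[of _ _ "s - t"]) (auto simp: diffs4_def S)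
  qed
  show "mult_closed3 (diffs4 ` S)"
    unfolding mult_closed3_def
  proof (intro allI impI)
    fix a b c a' b' c' assume "(a, b, c) \<in> diffs4 ` S" "(a', b', c') \<in> diffs4 ` S"
    then obtain s t where st: "s \<in> S" "t \<in> S" "(a, b, c) = diffs4 s" "(a', b', c') = diffs4 t" by auto
    \<comment> \<open>Subtracting constants of S moves the representatives to last coordinate 0,
      where \<open>diffs4\<close> respects products.\<close>
    have "(s - of_int (s $ 4)) * (t - of_int (t $ 4)) \<in> S" by (intro S(6) S(5) S(7) st(1,2))
    then show "(a * a', b * b', c * c') \<in> diffs4 ` S"
      by (rule image_eqI[rotated]) (use st in \<open>auto simp: diffs4_def of_int_vec_nth\<close>)
  qed
qed

lemma coset_eq_iff:
  fixes S :: "(int ^ 4) set"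
  assumes "subring S Z4"
  shows "(\<lambda>h. h + a) ` S = (\<lambda>h. h + b) ` S \<longleftrightarrow> a - b \<in> S"
proof
  note S = subring_Z4_D[OF assms]
  assume "(\<lambda>h. h + a) ` S = (\<lambda>h. h + b) ` S"
  moreover have "a \<in> (\<lambda>h. h + a) ` S" using S(2) by (intro image_eqI[of _ _ 0]) auto
  ultimately obtain h where "h \<in> S" "a = h + b" by auto
  then show "a - b \<in> S" by simp
next
  note S = subring_Z4_D[OF assms]
  assume ab: "a - b \<in> S"
  show "(\<lambda>h. h + a) ` S = (\<lambda>h. h + b) ` S"
  proof (intro equalityI subsetI)
    fix v assume "v \<in> (\<lambda>h. h + a) ` S"
    then obtain h where "h \<in> S" "v = h + a" by auto
    then show "v \<in> (\<lambda>h. h + b) ` S" using S(4)[OF _ ab] by (intro image_eqI[of _ _ "h + (a - b)"]) auto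
  next
    fix v assume "v \<in> (\<lambda>h. h + b) ` S"
    then obtain h where "h \<in> S" "v = h + b" by auto
    then show "v \<in> (\<lambda>h. h + a) ` S" using S(5)[OF _ ab] by (intro image_eqI[of _ _ "h - (a - b)"]) auto
  qed
qed

text \<open>The box with side lengths d1, d2, d3 is a system of coset representatives; this
  identifies the product of the diagonal entries with the genuine index.\<close>

lemma cosets_vimage_diffs4:
  assumes L: "lattice3 L" "mult_closed3 L" and ind: "ind3 L > 0"
  shows "finite (a_rcosets\<^bsub>Z4\<^esub> (diffs4 -` L))" "int (card (a_rcosets\<^bsub>Z4\<^esub> (diffs4 -` L))) = ind3 L"
proof -
  define S where "S = diffs4 -` L"
  have S: "subring S Z4" unfolding S_def by (rule subring_vimage_diffs4[OF L])
  obtain d1 d2 d3 x y z where h: "d1 > 0" "d2 > 0" "d3 > 0" "L = hnf d1 d2 d3 x y z" "ind3 L = d1 * d2 * d3"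
    by (rule lattice3_eq_hnf[OF L(1) ind])
  define Q where "Q = {0..<d1} \<times> {0..<d2} \<times> {0..<d3}"
  define \<phi> where "\<phi> t = (\<lambda>h. h + embed3 t) ` S" for t
  have dS: "embed3 s - embed3 t \<in> S \<longleftrightarrow>
      (fst s - fst t, fst (snd s) - fst (snd t), snd (snd s) - snd (snd t)) \<in> L" for s t
    by (simp add: S_def diffs4_def embed3_def)
  have "inj_on \<phi> Q"
  proof (rule inj_onI)
    fix s t assume st: "s \<in> Q" "t \<in> Q" "\<phi> s = \<phi> t"
    obtain i j k i' j' k' where e: "s = (i, j, k)" "t = (i', j', k')" by (metis prod.exhaust)
    have "embed3 s - embed3 t \<in> S" using st(3) coset_eq_iff[OF S] unfolding \<phi>_def by blast
    then have "(i - i', j - j', k - k') \<in> hnf d1 d2 d3 x y z" by (simp add: dS e h(4))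
    then obtain a b c where abc: "i - i' = a * d1" "j - j' = a * x + b * d2" "k - k' = a * y + b * z + c * d3"
      unfolding hnf_mem_iff by blast
    have Q: "0 \<le> i" "i < d1" "0 \<le> j" "j < d2" "0 \<le> k" "k < d3" "0 \<le> i'" "i' < d1" "0 \<le> j'" "j' < d2" "0 \<le> k'" "k' < d3"
      using st by (auto simp: e Q_def)
    have a: "a = 0" using multiple_eq_0_if_small[of i i' a d1] abc(1) Q by simp
    then have b: "b = 0" using multiple_eq_0_if_small[of j j' b d2] abc(2) Q by simp
    then have "c = 0" using multiple_eq_0_if_small[of k k' c d3] abc(3) a Q by simp
    then show "s = t" using abc a b by (simp add: e)
  qed
  moreover have "\<phi> ` Q = a_rcosets\<^bsub>Z4\<^esub> S"
  proof (intro equalityI subsetI)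
    fix C assume "C \<in> a_rcosets\<^bsub>Z4\<^esub> S"
    then obtain v where C: "C = (\<lambda>h. h + v) ` S" unfolding a_rcosets_Z4 by blast
    obtain p q r where pqr: "diffs4 v = (p, q, r)" by (cases "diffs4 v") auto
    \<comment> \<open>Division with remainder down the triangular form: each quotient fixes how much
      of a row to subtract before the next coordinate is reduced.\<close>
    define a where "a = p div d1"
    define b where "b = (q - a * x) div d2"
    define c where "c = (r - a * y - b * z) div d3"
    define t where "t = (p mod d1, (q - a * x) mod d2, (r - a * y - b * z) mod d3)"
    have "t \<in> Q" using h(1-3) by (simp add: t_def Q_def)
    moreover have "v - embed3 t \<in> S"
    proof -
      have m: "p mod d1 = p - a * d1" "(q - a * x) mod d2 = (q - a * x) - b * d2"
        "(r - a * y - b * z) mod d3 = (r - a * y - b * z) - c * d3"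
        by (simp_all add: a_def b_def c_def minus_div_mult_eq_mod)
      have "diffs4 (v - embed3 t) = (a * d1, a * x + b * d2, a * y + b * z + c * d3)"
        using pqr unfolding t_def m by (auto simp: diffs4_def embed3_def)
      then show ?thesis by (auto simp: S_def h(4) hnf_mem_iff)
    qed
    then have "C = \<phi> t" unfolding C \<phi>_def using coset_eq_iff[OF S] by blast
    ultimately show "C \<in> \<phi> ` Q" by blast
  qed (auto simp: \<phi>_def a_rcosets_Z4)
  ultimately have bij: "bij_betw \<phi> Q (a_rcosets\<^bsub>Z4\<^esub> S)" by (simp add: bij_betw_def)
  have "finite Q" by (simp add: Q_def)
  with bij show "finite (a_rcosets\<^bsub>Z4\<^esub> (diffs4 -` L))" unfolding S_def using bij_betw_finite by blast
  have "card (a_rcosets\<^bsub>Z4\<^esub> S) = card Q" using bij_betw_same_card[OF bij] by simp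
  then show "int (card (a_rcosets\<^bsub>Z4\<^esub> (diffs4 -` L))) = ind3 L"
    unfolding S_def using h by (simp add: Q_def card_cartesian_product)
qed

text \<open>A subring of index n contains n! times everything, so each projection contains the
  nonzero number n! and has a nonzero generator.\<close>

lemma ind3_image_diffs4_pos:
  assumes S: "subring S Z4" and fin: "finite (a_rcosets\<^bsub>Z4\<^esub> S)"
  shows "ind3 (diffs4 ` S) > 0"
proof -
  define M :: int where "M = fact (card (a_rcosets\<^bsub>Z4\<^esub> S))"
  have M: "M \<noteq> 0" by (simp add: M_def)
  have "of_int (M * 1) * embed3 (a, b, c) \<in> S" for a b c
    unfolding M_def by (rule fact_mult_mem[OF S fin order_refl])
  then have mem: "diffs4 (of_int M * embed3 (a, b, c)) \<in> diffs4 ` S" for a b c by simp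
  have "(M * a, M * b, M * c) \<in> diffs4 ` S" for a b c
    using mem[of a b c] by (simp add: diffs4_def embed3_def of_int_vec_nth)
  from this[of 1 0 0] this[of 0 1 0] this[of 0 0 1]
  have "M \<in> proj1 (diffs4 ` S)" "M \<in> proj2 (diffs4 ` S)" "M \<in> proj3 (diffs4 ` S)"
    unfolding proj1_def proj2_def proj3_def by auto
  then have "Gcd (proj1 (diffs4 ` S)) \<noteq> 0" "Gcd (proj2 (diffs4 ` S)) \<noteq> 0" "Gcd (proj3 (diffs4 ` S)) \<noteq> 0"
    using M by (auto simp: Gcd_0_iff)
  then have "Gcd (proj1 (diffs4 ` S)) > 0" "Gcd (proj2 (diffs4 ` S)) > 0" "Gcd (proj3 (diffs4 ` S)) > 0"
    by (metis Gcd_int_greater_eq_0 order_le_less)+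
  then show ?thesis unfolding ind3_def by (intro mult_pos_pos)
qed

lemma N4_eq_psum: "real (N4 B) = psum (\<lambda>n. real (card (ring_lattices n))) B"
proof -
  define U where "U = (\<Union>n\<in>{1..nat \<lfloor>B\<rfloor>}. ring_lattices n)"
  \<comment> \<open>Preimages under a surjective map determine the set.\<close>
  have inj: "inj_on (\<lambda>L. diffs4 -` L) U"
    using range_diffs4 by (auto intro!: inj_onI dest: arg_cong[of _ _ "image diffs4"] simp: image_vimage_eq)
  have "subrings_upto B = (\<lambda>L. diffs4 -` L) ` U"
  proof (intro equalityI subsetI)
    fix S assume "S \<in> subrings_upto B"
    then have S: "subring S Z4" "finite (a_rcosets\<^bsub>Z4\<^esub> S)" "real (card (a_rcosets\<^bsub>Z4\<^esub> S)) \<le> B"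
      by (auto simp: subrings_upto_def)
    define L where "L = diffs4 ` S"
    have eq: "S = diffs4 -` L" using vimage_diffs4_image[OF S(1)] by (simp add: L_def)
    have lat: "lattice3 L" "mult_closed3 L" unfolding L_def using lattice3_image_diffs4[OF S(1)] by auto
    have ind: "ind3 L > 0" unfolding L_def by (rule ind3_image_diffs4_pos[OF S(1,2)])
    define n where "n = card (a_rcosets\<^bsub>Z4\<^esub> S)"
    have n: "ind3 L = int n" using cosets_vimage_diffs4(2)[OF lat ind] by (simp add: eq[symmetric] n_def)
    have "n \<in> {1..nat \<lfloor>B\<rfloor>}" unfolding mem_nat_floor_iff using n ind S(3) by (simp add: n_def)
    moreover have "L \<in> ring_lattices n" using lat n by (simp add: ring_lattices_def)
    ultimately show "S \<in> (\<lambda>L. diffs4 -` L) ` U" unfolding U_def using eq by blast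
  next
    fix S assume "S \<in> (\<lambda>L. diffs4 -` L) ` U"
    then obtain L n where L: "S = diffs4 -` L" "n \<in> {1..nat \<lfloor>B\<rfloor>}" "L \<in> ring_lattices n"
      unfolding U_def by blast
    have n: "n \<ge> 1" "real n \<le> B" using L(2) unfolding mem_nat_floor_iff by auto
    have lat: "lattice3 L" "mult_closed3 L" "ind3 L = int n" using L(3) by (auto simp: ring_lattices_def)
    then have ind: "ind3 L > 0" using n by simp
    show "S \<in> subrings_upto B"
      using subring_vimage_diffs4[OF lat(1,2)] cosets_vimage_diffs4[OF lat(1,2) ind] lat(3) n
      by (simp add: subrings_upto_def L(1))
  qed
  then have "N4 B = card U" unfolding N4_def using card_image[OF inj] by simp
  also have "\<dots> = (\<Sum>n\<in>{1..nat \<lfloor>B\<rfloor>}. card (ring_lattices n))"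
    unfolding U_def
  proof (rule card_UN_disjoint)
    show "\<forall>n\<in>{1..nat \<lfloor>B\<rfloor>}. finite (ring_lattices n)" by (auto intro!: finite_ring_lattices)
    show "\<forall>i\<in>{1..nat \<lfloor>B\<rfloor>}. \<forall>j\<in>{1..nat \<lfloor>B\<rfloor>}. i \<noteq> j \<longrightarrow> ring_lattices i \<inter> ring_lattices j = {}"
      by (auto simp: ring_lattices_def)
  qed simp
  finally show ?thesis by (simp add: psum_def)
qed

lemma multiplicative_card_ring_lattices: "multiplicative (\<lambda>n. real (card (ring_lattices n)))"
  unfolding multiplicative_def using card_ring_lattices_one card_ring_lattices_mult by simp

theorem theorem4p2:
  shows "\<exists>P :: real poly. degree P = 5 \<and>
    (\<forall>\<epsilon>::real. \<epsilon> > 0 \<longrightarrow>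
      (\<lambda>B::real. real (N4 B) - B * poly P (ln B)) \<in> O[at_top](\<lambda>B. B powr (11 / 12 + \<epsilon>)))"
proof -
  have "\<exists>P :: real poly. degree P = 5 \<and> (\<forall>\<delta>>0. \<exists>K. \<forall>x\<ge>1.
    \<bar>psum (\<lambda>n. real (card (ring_lattices n))) x - x * poly P (ln x)\<bar> \<le> K * x powr (1 - 1 / (7 + real 5) + \<delta>))"
  \<comment> \<open>t = 5 comes from f(p) = 6 and q = 7 from the bound at prime powers, so the error
    exponent is 1 - 1/(7 + 5) = 11/12.\<close>
  proof (rule multiplicative_psum_asymp[OF multiplicative_card_ring_lattices])
    show "real (card (ring_lattices p)) = 1 + real 5" if "prime p" for p
      by (simp add: card_ring_lattices_prime[OF that])
    show "real (card (ring_lattices (p ^ k))) \<le> 8 * real (k + 1) ^ 2 * real p powr ((1 - 1 / 7) * real k - 1)"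
      if "prime p" "k \<ge> 2" for p k by (rule card_ring_lattices_prime_power_le[OF that])
  qed simp_all
  then obtain P :: "real poly" where P: "degree P = 5" and
    K: "\<And>\<delta>. \<delta> > 0 \<Longrightarrow> \<exists>K. \<forall>x\<ge>1. \<bar>real (N4 x) - x * poly P (ln x)\<bar> \<le> K * x powr (11 / 12 + \<delta>)"
    unfolding N4_eq_psum by (simp, blast)
  show ?thesis
  proof (intro exI[of _ P] conjI allI impI P)
    fix \<epsilon> :: real assume "\<epsilon> > 0"
    from K[OF this] obtain K where
      K: "\<And>x. x \<ge> 1 \<Longrightarrow> \<bar>real (N4 x) - x * poly P (ln x)\<bar> \<le> K * x powr (11 / 12 + \<epsilon>)" by blast
    show "(\<lambda>B. real (N4 B) - B * poly P (ln B)) \<in> O[at_top](\<lambda>B. B powr (11 / 12 + \<epsilon>))"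
    proof (rule bigoI[of _ K])
      show "\<forall>\<^sub>F B in at_top. norm (real (N4 B) - B * poly P (ln B)) \<le> K * norm (B powr (11 / 12 + \<epsilon>))"
        using eventually_ge_at_top[of 1] by eventually_elim (use K in simp)
    qed
  qed
qed

end
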